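(* Let $\nu>0$, $T>0$, and let $u_0$ be a probability measure on $\mathbb{R}^2$. Let $X$ on $(\Omega,\mathcal{F},(\mathcal{F}_t)_{t\ge0},\mathbb{P})$ and $\tilde X$ on $(\tilde\Omega,\tilde{\mathcal{F}},(\tilde{\mathcal{F}}_t)_{t\ge0},\tilde{\mathbb{P}})$ be two probabilistically weak solutions of $$dX(t)=K(u(t,\cdot))(X(t))\,dt+\sqrt{2\nu}\,dW(t),\qquad \mathbb{P}\circ X(0)^{-1}=u_0,$$ and let $u(t,\cdot)$, $\tilde u(t,\cdot)$ be the Lebesgue densities of $\mathbb{P}\circ X(t)^{-1}$, $\tilde{\mathbb{P}}\circ\tilde X(t)^{-1}$, $t>0$. Assume $$u,\tilde u\in L^4(0,T;L^4(\mathbb{R}^2))\cap L^\infty(0,T;H^{-1}(\mathbb{R}^2)).$$ Then $X$ and $\tilde X$ have the same law: $\mathbb{P}\circ X^{-1}=\tilde{\mathbb{P}}\circ\tilde X^{-1}$.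
   Context: The Biot–Savart kernel is $k(x)=\frac{(-x_2,x_1)}{2\pi|x|^2}$, $x\ne0$, and $K(z)=k*z$. $H^{-1}(\mathbb{R}^2)$ is the dual of $H^1(\mathbb{R}^2)$. A probabilistically weak solution is a stochastic basis with a 2-dimensional $(\mathcal{F}_t)$-Brownian motion $W$ and a progressively measurable, a.s. continuous process $X$ in $\mathbb{R}^2$ such that for each $t>0$ the law of $X(t)$ has a Lebesgue density $u(t,\cdot)$, $\mathbb{E}\int_0^T|K(u(s,\cdot))(X(s))|\,ds<\infty$, and $X(t)=X(0)+\int_0^tK(u(s,\cdot))(X(s))\,ds+\sqrt{2\nu}\,W(t)$ a.s. for all $t$. *)

theory Defs
  imports "HOL-Probability.Probability"
begin

definition bs_kernel :: "real^2 \<Rightarrow> real^2" where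
  "bs_kernel x = (if x = 0 then 0
     else (1 / (2 * pi * (norm x)^2)) *\<^sub>R vector [- (x$2), x$1])"

definition BS :: "(real^2 \<Rightarrow> real) \<Rightarrow> real^2 \<Rightarrow> real^2" where
  "BS z x = (\<integral>y. z y *\<^sub>R bs_kernel (x - y) \<partial>lborel)"

definition gauss2 :: "real \<Rightarrow> real^2 \<Rightarrow> real" where
  "gauss2 s x = exp (- ((norm x)^2 / (2 * s))) / (2 * pi * s)"

definition is_filtration :: "'a measure \<Rightarrow> (real \<Rightarrow> 'a measure) \<Rightarrow> bool" where
  "is_filtration M F \<longleftrightarrow> (\<forall>t. subalgebra M (F t)) \<and> (\<forall>s t. s \<le> t \<longrightarrow> sets (F s) \<subseteq> sets (F t))"

definition brownian2 :: "real \<Rightarrow> 'a measure \<Rightarrow> (real \<Rightarrow> 'a measure) \<Rightarrow> (real \<Rightarrow> 'a \<Rightarrow> real^2) \<Rightarrow> bool" where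
  "brownian2 T M F W \<longleftrightarrow>
     (\<forall>t\<in>{0..T}. W t \<in> borel_measurable (F t)) \<and>
     (AE \<omega> in M. W 0 \<omega> = 0) \<and>
     (AE \<omega> in M. continuous_on {0..T} (\<lambda>t. W t \<omega>)) \<and>
     (\<forall>s t. 0 \<le> s \<and> s < t \<and> t \<le> T \<longrightarrow>
        distr M borel (\<lambda>\<omega>. W t \<omega> - W s \<omega>) = density lborel (\<lambda>x. ennreal (gauss2 (t - s) x)) \<and>
        (\<forall>A\<in>sets (F s). \<forall>B\<in>sets borel.
           measure M (A \<inter> {\<omega>\<in>space M. W t \<omega> - W s \<omega> \<in> B})
             = measure M A * measure M {\<omega>\<in>space M. W t \<omega> - W s \<omega> \<in> B}))"

definition prog_measurable :: "real \<Rightarrow> (real \<Rightarrow> 'a measure) \<Rightarrow> (real \<Rightarrow> 'a \<Rightarrow> real^2) \<Rightarrow> bool" where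
  "prog_measurable T F X \<longleftrightarrow>
     (\<forall>t\<in>{0..T}. (\<lambda>(s, \<omega>). X s \<omega>) \<in> borel_measurable (restrict_space borel {0..t} \<Otimes>\<^sub>M F t))"

definition weak_solution ::
  "real \<Rightarrow> real \<Rightarrow> (real^2) measure \<Rightarrow> 'a measure \<Rightarrow> (real \<Rightarrow> 'a measure) \<Rightarrow>
   (real \<Rightarrow> 'a \<Rightarrow> real^2) \<Rightarrow> (real \<Rightarrow> 'a \<Rightarrow> real^2) \<Rightarrow> (real \<Rightarrow> real^2 \<Rightarrow> real) \<Rightarrow> bool" where
  "weak_solution \<nu> T u0 M F W X u \<longleftrightarrow>
     prob_space M \<and> is_filtration M F \<and> brownian2 T M F W \<and>
     prog_measurable T F X \<and>
     (AE \<omega> in M. continuous_on {0..T} (\<lambda>t. X t \<omega>)) \<and>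
     distr M borel (X 0) = u0 \<and>
     (\<forall>t\<in>{0<..T}. (\<forall>x. 0 \<le> u t x) \<and> u t \<in> borel_measurable lborel \<and>
         distr M borel (X t) = density lborel (\<lambda>x. ennreal (u t x))) \<and>
     (\<integral>\<^sup>+\<omega>. (\<integral>\<^sup>+s\<in>{0..T}. ennreal (norm (BS (u s) (X s \<omega>))) \<partial>lborel) \<partial>M) < \<infinity> \<and>
     (\<forall>t\<in>{0..T}. AE \<omega> in M.
        X t \<omega> = X 0 \<omega> + (\<integral>s\<in>{0..t}. BS (u s) (X s \<omega>) \<partial>lborel) + sqrt (2 * \<nu>) *\<^sub>R W t \<omega>)"

definition L4L4 :: "real \<Rightarrow> (real \<Rightarrow> real^2 \<Rightarrow> real) \<Rightarrow> bool" where
  "L4L4 T u \<longleftrightarrow>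
     (\<lambda>(t, x). u t x) \<in> borel_measurable (restrict_space lborel {0<..<T} \<Otimes>\<^sub>M lborel) \<and>
     (\<integral>\<^sup>+t\<in>{0<..<T}. (\<integral>\<^sup>+x. ennreal (\<bar>u t x\<bar> ^ 4) \<partial>lborel) \<partial>lborel) < \<infinity>"

text \<open>C^1 functions with compact support (dense in H^1(R^2)), with derivative phi'.\<close>
definition C1c :: "(real^2 \<Rightarrow> real) \<Rightarrow> (real^2 \<Rightarrow> (real^2) \<Rightarrow>\<^sub>L real) \<Rightarrow> bool" where
  "C1c \<phi> \<phi>' \<longleftrightarrow> (\<forall>x. (\<phi> has_derivative blinfun_apply (\<phi>' x)) (at x)) \<and>
     continuous_on UNIV \<phi>' \<and> compact (closure {x. \<phi> x \<noteq> 0})"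

definition H1_sq :: "(real^2 \<Rightarrow> real) \<Rightarrow> (real^2 \<Rightarrow> (real^2) \<Rightarrow>\<^sub>L real) \<Rightarrow> real" where
  "H1_sq \<phi> \<phi>' = (\<integral>x. (\<phi> x)^2 + (norm (\<phi>' x))^2 \<partial>lborel)"

definition Hm1_norm :: "(real^2 \<Rightarrow> real) \<Rightarrow> ennreal" where
  "Hm1_norm z = (SUP \<phi> \<in> {\<phi>. \<exists>\<phi>'. C1c \<phi> \<phi>' \<and> H1_sq \<phi> \<phi>' \<le> 1}.
                   ennreal \<bar>\<integral>x. z x * \<phi> x \<partial>lborel\<bar>)"

definition LinfHm1 :: "real \<Rightarrow> (real \<Rightarrow> real^2 \<Rightarrow> real) \<Rightarrow> bool" where
  "LinfHm1 T u \<longleftrightarrow> (\<exists>C::real. AE t in lborel. t \<in> {0<..<T} \<longrightarrow> Hm1_norm (u t) \<le> ennreal C)"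

definition path_law :: "real \<Rightarrow> 'a measure \<Rightarrow> (real \<Rightarrow> 'a \<Rightarrow> real^2) \<Rightarrow> (real \<Rightarrow> real^2) measure" where
  "path_law T M X = distr M (\<Pi>\<^sub>M t\<in>{0..T}. borel) (\<lambda>\<omega>. \<lambda>t\<in>{0..T}. X t \<omega>)"

end

theory Submission
  imports Defs
begin

text \<open>
  A function in $L^1 \cap L^4$ has a bounded Biot--Savart velocity, with a bound linear in its
  $L^4$ norm, so both drifts belong to $L^4(0,T;L^\infty)$. For such a drift, a weight $Y$ measurable
  with respect to the past of $s$ and a smooth bounded $f$, the Duhamel formula
  \[ E[Y f(X_t)] = E[Y P_{t-s} f(X_s)] + \int_s^t E[Y b_r(X_r) \cdot \nabla P_{t-r} f(X_r)] dr \]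
  follows by chaining small time steps: over one step the Brownian increment is absorbed by the heat
  semigroup and the drift is expanded to first order, so no stochastic integral is needed.
  Since $|\nabla P_\tau f| \le C \tau^{-1/2} \sup |f|$, subtracting the formulas of two solutions gives a
  contraction in total variation on short time intervals. For the nonlinear drift
  ($Y = 1$) the difference of the two velocities is controlled as well, because Fubini moves the
  kernel onto the other density. Hence the marginals agree, so the two drifts are equal, and the same
  contraction with $Y$ an indicator of past positions propagates equality of the finite-dimensional laws.
\<close>

section \<open>Gaussian averages\<close>

text \<open>The exponent 4 enters twice. In space, |z|^{-1} is locally in the conjugate space
  L^{4/3}, which with mass one outside a box bounds the velocity. In time, (t - r)^{-1/2} is in
  L^{4/3} near t, so the heat gradient can be paired with a drift whose sup norm is only L^4 in
  time. The weights Y are there because equal marginals do not determine the path law. They cannot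
  be treated together with the marginals: the velocity is generated by the unweighted law, so a
  difference of weighted laws does not control a difference of velocities. Once the marginals agree,
  the remaining problem is linear. Total variation is the natural distance because b_r \<bullet>
  grad P_{t-r} f is merely measurable in space, so the estimate has to be closed on bounded
  measurable functions. This works since the second order constant of a test function affects only
  the step size in the Duhamel argument and not the final bound. The two solutions live on different
  probability spaces and are never coupled; only expectations are compared.\<close>

lemma nn_integral_lborel_vec2:
  fixes f g :: "real \<Rightarrow> ennreal"
  assumes [measurable]: "f \<in> borel_measurable borel" "g \<in> borel_measurable borel"
  shows "(\<integral>\<^sup>+x. f (x$1) * g (x$2) \<partial>(lborel :: (real^2) measure))
       = (\<integral>\<^sup>+x. f x \<partial>lborel) * (\<integral>\<^sup>+x. g x \<partial>lborel)"
proof -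
  have B: "(Basis :: (real^2) set) = {axis 1 1, axis 2 1}"
    unfolding Basis_vec_def by (auto simp: UNIV_2)
  have ne: "axis 1 1 \<noteq> (axis 2 1 :: real^2)"
    by (simp add: axis_eq_axis)
  let ?h = "\<lambda>b::real^2. if b = axis 1 1 then f else g"
  have "(\<integral>\<^sup>+x. (\<Prod>b\<in>Basis. ?h b (x \<bullet> b)) \<partial>(lborel :: (real^2) measure))
      = (\<Prod>b\<in>Basis. (\<integral>\<^sup>+x. ?h b x \<partial>lborel))"
    by (rule nn_integral_lborel_prod) auto
  then show ?thesis
    using ne by (simp add: B inner_axis)
qed

lemma norm_vec2: "(norm (x::real^2))^2 = (x$1)^2 + (x$2)^2"
  by (simp add: norm_vec_def L2_set_def UNIV_2)

lemma gauss2_nonneg [simp]: "0 \<le> s \<Longrightarrow> 0 \<le> gauss2 s x"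
  by (simp add: gauss2_def)

lemma gauss2_measurable [measurable]: "gauss2 s \<in> borel_measurable borel"
  unfolding gauss2_def by measurable

lemma nn_integral_gauss2_1: "(\<integral>\<^sup>+y. ennreal (gauss2 1 y) \<partial>lborel) = 1"
proof -
  have "gauss2 1 y = std_normal_density (y$1) * std_normal_density (y$2)" for y
  proof -
    have "exp (- ((norm y)\<^sup>2 / 2)) = exp (- (y$1)\<^sup>2 / 2) * exp (- (y$2)\<^sup>2 / 2)"
      unfolding exp_add[symmetric] by (simp add: norm_vec2 add_divide_distrib)
    moreover have "2 * pi = sqrt (2 * pi) * sqrt (2 * pi)"
      by simp
    ultimately show ?thesis
      unfolding gauss2_def std_normal_density_def by simp
  qed
  then have "(\<integral>\<^sup>+y. ennreal (gauss2 1 y) \<partial>lborel)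
     = (\<integral>\<^sup>+y. ennreal (std_normal_density (y$1)) * ennreal (std_normal_density (y$2)) \<partial>(lborel::(real^2) measure))"
    by (simp add: ennreal_mult)
  also have "\<dots> = (\<integral>\<^sup>+x. ennreal (std_normal_density x) \<partial>lborel) * (\<integral>\<^sup>+x. ennreal (std_normal_density x) \<partial>lborel)"
    by (rule nn_integral_lborel_vec2) auto
  also have "(\<integral>\<^sup>+x. ennreal (std_normal_density x) \<partial>lborel) = 1"
    using prob_space.emeasure_space_1[OF prob_space_normal_density[of 1 0]]
    by (simp add: emeasure_density)
  finally show ?thesis by simp
qed

definition std_gauss :: "(real^2) measure" where
  "std_gauss = density lborel (\<lambda>y. ennreal (gauss2 1 y))"

lemma sets_std_gauss [simp, measurable_cong]: "sets std_gauss = sets borel"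
  and space_std_gauss [simp]: "space std_gauss = UNIV"
  by (simp_all add: std_gauss_def)

interpretation std_gauss: prob_space std_gauss
  by (rule prob_spaceI) (simp add: std_gauss_def emeasure_density nn_integral_gauss2_1)

lemma nn_integral_lborel_scaleR:
  fixes f :: "real^2 \<Rightarrow> ennreal"
  assumes [measurable]: "f \<in> borel_measurable borel" and "a \<noteq> 0"
  shows "(\<integral>\<^sup>+x. f x \<partial>lborel) = ennreal (a^2) * (\<integral>\<^sup>+x. f (t + a *\<^sub>R x) \<partial>lborel)"
  by (subst lborel_affine[OF \<open>a \<noteq> 0\<close>, of t])
     (simp add: nn_integral_density nn_integral_distr nn_integral_cmult)

lemma gauss2_eq_distr_std_gauss:
  assumes "s > 0"
  shows "density lborel (\<lambda>x. ennreal (gauss2 s x)) = distr std_gauss borel (\<lambda>y. sqrt s *\<^sub>R y)"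
proof (rule measure_eqI)
  fix A assume "A \<in> sets (density lborel (\<lambda>x. ennreal (gauss2 s x)))"
  then have [measurable]: "A \<in> sets borel" by simp
  have g: "s * gauss2 s (sqrt s *\<^sub>R x) = gauss2 1 x" for x
    using assms by (simp add: gauss2_def power_mult_distrib)
  have "emeasure (density lborel (\<lambda>x. ennreal (gauss2 s x))) A
      = (\<integral>\<^sup>+x. ennreal (gauss2 s x) * indicator A x \<partial>lborel)"
    by (simp add: emeasure_density)
  also have "\<dots> = ennreal s * (\<integral>\<^sup>+x. ennreal (gauss2 s (sqrt s *\<^sub>R x)) * indicator A (sqrt s *\<^sub>R x) \<partial>lborel)"
    using assms by (subst nn_integral_lborel_scaleR[where a="sqrt s" and t=0]) auto
  also have "\<dots> = (\<integral>\<^sup>+x. ennreal (gauss2 1 x) * indicator A (sqrt s *\<^sub>R x) \<partial>lborel)"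
    using assms
    by (subst nn_integral_cmult[symmetric]) (simp_all add: mult.assoc[symmetric] ennreal_mult'[symmetric] g)
  also have "\<dots> = emeasure (distr std_gauss borel (\<lambda>y. sqrt s *\<^sub>R y)) A"
    by (simp add: emeasure_distr std_gauss_def emeasure_density indicator_vimage[symmetric] vimage_def)
  finally show "emeasure (density lborel (\<lambda>x. ennreal (gauss2 s x))) A
    = emeasure (distr std_gauss borel (\<lambda>y. sqrt s *\<^sub>R y)) A" .
qed simp

text \<open>A wider Gaussian absorbs the polynomial: r / 4 \<le> exp (r / 4) for r = |y|^2 turns the
  density of variance 1 into that of variance 2. The 8 is 4 from this inequality times 2 from the
  normalising constants.\<close>

lemma integrable_std_gauss_norm_sq: "integrable std_gauss (\<lambda>y. (norm y)^2)"
proof (rule integrableI_bounded)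
  have bound: "ennreal (gauss2 1 y) * ennreal (norm ((norm y)^2))
      \<le> 8 * ennreal (gauss2 2 y)" for y :: "real^2"
  proof -
    let ?r = "(norm y)^2"
    have "?r / 4 \<le> exp (?r / 4)"
      using exp_ge_add_one_self[of "?r/4"] by linarith
    then have "exp (- (?r/2)) * ?r \<le> exp (- (?r/2)) * (4 * exp (?r / 4))"
      by (intro mult_left_mono) auto
    also have "\<dots> = 4 * exp (- (?r/4))"
      by (simp add: exp_add[symmetric])
    finally have "gauss2 1 y * ?r \<le> 8 * gauss2 2 y"
      by (simp add: gauss2_def divide_simps)
    then have "ennreal (gauss2 1 y * ?r) \<le> ennreal (8 * gauss2 2 y)"
      by (rule ennreal_leI)
    then show ?thesis
      by (simp add: ennreal_mult)
  qed
  interpret g2: prob_space "density lborel (\<lambda>x. ennreal (gauss2 2 x))"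
    by (subst gauss2_eq_distr_std_gauss) (auto intro: std_gauss.prob_space_distr)
  have g2: "(\<integral>\<^sup>+y. ennreal (gauss2 2 y) \<partial>lborel) = 1"
    using g2.emeasure_space_1 by (simp add: emeasure_density)
  have "(\<integral>\<^sup>+y. ennreal (norm ((norm y)^2)) \<partial>std_gauss)
      = (\<integral>\<^sup>+y. ennreal (gauss2 1 y) * ennreal (norm ((norm y)^2)) \<partial>(lborel :: (real^2) measure))"
    unfolding std_gauss_def by (rule nn_integral_density) auto
  also have "\<dots> \<le> (\<integral>\<^sup>+y. 8 * ennreal (gauss2 2 y) \<partial>lborel)"
    by (intro nn_integral_mono bound)
  also have "\<dots> = 8"
    by (simp add: nn_integral_cmult g2)
  finally show "(\<integral>\<^sup>+y. ennreal (norm ((norm y)^2)) \<partial>std_gauss) < \<infinity>"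
    by (rule le_less_trans) simp
qed simp

lemma integrable_std_gauss_norm: "integrable std_gauss norm"
proof (rule Bochner_Integration.integrable_bound)
  show "integrable std_gauss (\<lambda>y. 1 + (norm y)^2)"
    by (intro Bochner_Integration.integrable_add integrable_std_gauss_norm_sq) simp
  have "norm y \<le> 1 + (norm y)^2" for y :: "real^2"
    using sum_power2_ge_zero[of "norm y - 1/2" 0] by (simp add: power2_eq_square algebra_simps)
  then show "AE y in std_gauss. norm (norm y) \<le> norm (1 + (norm y)^2)"
    by auto
qed simp

text \<open>This is the heat semigroup at variance a^2. Scaling a fixed Gaussian variable, rather
  than convolving with a density, makes a = 0 the identity, so the terminal time of the Duhamel
  formula needs no separate treatment.\<close>

definition gauss_avg :: "real \<Rightarrow> (real^2 \<Rightarrow> 'b::{banach,second_countable_topology}) \<Rightarrow> real^2 \<Rightarrow> 'b" where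
  "gauss_avg a f x = (\<integral>y. f (x + a *\<^sub>R y) \<partial>std_gauss)"

lemma gauss_avg_0 [simp]: "gauss_avg 0 f x = f x"
  using std_gauss.prob_space by (simp add: gauss_avg_def)

lemma integrable_bounded_std_gauss:
  fixes f :: "real^2 \<Rightarrow> 'b::{banach,second_countable_topology}"
  assumes "f \<in> borel_measurable borel" "\<And>x. norm (f x) \<le> L"
  shows "integrable std_gauss f"
  by (rule std_gauss.integrable_const_bound[of _ L]) (use assms in auto)

lemma gauss_avg_bound:
  fixes f :: "real^2 \<Rightarrow> 'b::{banach,second_countable_topology}"
  assumes [measurable]: "f \<in> borel_measurable borel" and "\<And>x. norm (f x) \<le> L"
  shows "norm (gauss_avg a f x) \<le> L"
proof -
  have "norm (gauss_avg a f x) \<le> (\<integral>y. norm (f (x + a *\<^sub>R y)) \<partial>std_gauss)"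
    unfolding gauss_avg_def by (rule integral_norm_bound)
  also have "\<dots> \<le> (\<integral>y. L \<partial>std_gauss)"
    by (intro integral_mono integrable_bounded_std_gauss[where L=L])
      (use assms order_trans[OF norm_ge_zero assms(2)] in auto)
  finally show ?thesis using std_gauss.prob_space by simp
qed

lemma gauss_avg_measurable [measurable]:
  fixes f :: "real^2 \<Rightarrow> 'b::{banach,second_countable_topology}"
  assumes [measurable]: "f \<in> borel_measurable borel"
  shows "gauss_avg a f \<in> borel_measurable borel"
  unfolding gauss_avg_def by measurable

text \<open>Dominated convergence works jointly in scale and point, down to scale 0. This serves
  both the heat gradient along paths up to the terminal time and the convergence of
  mollifications.\<close>

lemma continuous_gauss_avg:
  fixes f :: "real^2 \<Rightarrow> 'b::{banach,second_countable_topology}"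
  assumes f: "continuous_on UNIV f" and L: "\<And>x. norm (f x) \<le> L"
  shows "continuous_on UNIV (\<lambda>p. gauss_avg (fst p) f (snd p))"
proof (rule continuous_on_sequentiallyI)
  fix u :: "nat \<Rightarrow> real \<times> (real^2)" and p
  assume u: "u \<longlonglongrightarrow> p"
  have [measurable]: "f \<in> borel_measurable borel"
    using f by (rule borel_measurable_continuous_onI)
  show "(\<lambda>n. gauss_avg (fst (u n)) f (snd (u n))) \<longlonglongrightarrow> gauss_avg (fst p) f (snd p)"
    unfolding gauss_avg_def
  proof (rule integral_dominated_convergence[where w="\<lambda>_. L"])
    show "AE y in std_gauss. (\<lambda>n. f (snd (u n) + fst (u n) *\<^sub>R y)) \<longlonglongrightarrow> f (snd p + fst p *\<^sub>R y)"
    proof (rule AE_I2)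
      fix y
      have "(\<lambda>n. snd (u n) + fst (u n) *\<^sub>R y) \<longlonglongrightarrow> snd p + fst p *\<^sub>R y"
        using u by (intro tendsto_add tendsto_scaleR tendsto_fst tendsto_snd tendsto_const)
      then show "(\<lambda>n. f (snd (u n) + fst (u n) *\<^sub>R y)) \<longlonglongrightarrow> f (snd p + fst p *\<^sub>R y)"
        by (rule continuous_on_tendsto_compose[OF f]) auto
    qed
  qed (use L in auto)
qed

section \<open>Shifts of the standard Gaussian and their expansion\<close>

text \<open>The Cameron--Martin density of the standard Gaussian shifted by \<open>w\<close>.\<close>

definition cm_density :: "real^2 \<Rightarrow> real^2 \<Rightarrow> real" where
  "cm_density w y = exp (y \<bullet> w - (norm w)^2 / 2)"

lemma cm_density_measurable [measurable]: "cm_density w \<in> borel_measurable borel"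
  unfolding cm_density_def by measurable

lemma cm_density_pos: "0 < cm_density w y"
  by (simp add: cm_density_def)

lemma std_gauss_shift: "distr std_gauss borel (\<lambda>y. y + w) = density std_gauss (\<lambda>y. ennreal (cm_density w y))"
proof (rule measure_eqI)
  fix A assume "A \<in> sets (distr std_gauss borel (\<lambda>y. y + w))"
  then have [measurable]: "A \<in> sets borel" by simp
  have g: "gauss2 1 (y - w) = gauss2 1 y * cm_density w y" for y
  proof -
    have "(norm (y - w))\<^sup>2 = (norm y)\<^sup>2 - 2 * (y \<bullet> w) + (norm w)\<^sup>2"
      by (simp add: power2_norm_eq_inner inner_diff_left inner_diff_right inner_commute)
    then have "exp (- ((norm (y - w))\<^sup>2 / 2)) = exp (- ((norm y)\<^sup>2 / 2)) * cm_density w y"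
      unfolding cm_density_def exp_add[symmetric] by (simp add: field_simps)
    then show ?thesis
      by (simp add: gauss2_def)
  qed
  have "emeasure (distr std_gauss borel (\<lambda>y. y + w)) A
      = (\<integral>\<^sup>+y. ennreal (gauss2 1 y) * indicator A (y + w) \<partial>lborel)"
    by (simp add: emeasure_distr std_gauss_def emeasure_density indicator_def vimage_def)
  also have "\<dots> = (\<integral>\<^sup>+y. ennreal (gauss2 1 (y - w)) * indicator A y \<partial>(distr lborel borel ((+) w)))"
    by (subst nn_integral_distr) (auto simp: add.commute)
  also have "\<dots> = (\<integral>\<^sup>+y. ennreal (gauss2 1 y) * (ennreal (cm_density w y) * indicator A y) \<partial>lborel)"
    by (simp add: lborel_distr_plus g ennreal_mult cm_density_pos less_imp_le mult.assoc)
  also have "\<dots> = emeasure (density std_gauss (\<lambda>y. ennreal (cm_density w y))) A"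
    by (simp add: std_gauss_def emeasure_density nn_integral_density)
  finally show "emeasure (distr std_gauss borel (\<lambda>y. y + w)) A
    = emeasure (density std_gauss (\<lambda>y. ennreal (cm_density w y))) A" .
qed simp

text \<open>Moving the shift from f to the Gaussian weight makes the dependence on w smooth even if
  f is only bounded and measurable. The smoothing effect of the heat flow is derived from this
  identity.\<close>

lemma integral_std_gauss_shift:
  fixes f :: "real^2 \<Rightarrow> real"
  assumes [measurable]: "f \<in> borel_measurable borel"
  shows "(\<integral>y. f (y + w) \<partial>std_gauss) = (\<integral>y. cm_density w y * f y \<partial>std_gauss)"
proof -
  have "(\<integral>y. f (y + w) \<partial>std_gauss) = (\<integral>y. f y \<partial>(distr std_gauss borel (\<lambda>y. y + w)))"
    by (subst integral_distr) auto
  also have "\<dots> = (\<integral>y. cm_density w y * f y \<partial>std_gauss)"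
    unfolding std_gauss_shift
    by (subst integral_density) (auto simp: cm_density_pos less_imp_le)
  finally show ?thesis .
qed

lemma integrable_std_gauss_shift:
  fixes f :: "real^2 \<Rightarrow> real"
  assumes [measurable]: "f \<in> borel_measurable borel"
  shows "integrable std_gauss (\<lambda>y. f (y + w)) \<longleftrightarrow> integrable std_gauss (\<lambda>y. cm_density w y * f y)"
proof -
  have "integrable std_gauss (\<lambda>y. f (y + w)) \<longleftrightarrow> integrable (distr std_gauss borel (\<lambda>y. y + w)) f"
    by (subst integrable_distr_eq) auto
  also have "\<dots> \<longleftrightarrow> integrable std_gauss (\<lambda>y. cm_density w y * f y)"
    unfolding std_gauss_shift
    by (subst integrable_density) (auto simp: cm_density_pos less_imp_le)
  finally show ?thesis .
qed

text \<open>The factor 1 + exp z serves both signs: exp z is the part needed for z \<ge> 0, and 1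
  the part needed for z < 0. In the application exp z is \<open>cm_density\<close>, so integrating
  against 1 + exp z means integrating once under the Gaussian and once under its shift.\<close>

lemma abs_exp_minus_one_le: "\<bar>exp z - 1\<bar> \<le> \<bar>z\<bar> * (1 + exp (z::real))"
proof (cases "z \<ge> 0")
  case True
  have "exp z * (1 - z) \<le> exp z * exp (- z)"
    by (intro mult_left_mono) (use exp_ge_add_one_self[of "-z"] in auto)
  then have "exp z - 1 \<le> z * exp z"
    by (simp add: exp_minus algebra_simps)
  with True show ?thesis
    by (simp add: algebra_simps)
next
  case False
  then have "1 - exp z \<le> - z" "exp z \<le> 1" "0 \<le> - z * exp z"
    using exp_ge_add_one_self[of z] mult_nonneg_nonneg[of "- z" "exp z"] by (auto simp: algebra_simps)
  with False show ?thesis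
    unfolding ring_distribs by linarith
qed

text \<open>The inequality exp z - 1 \<le> z * exp z holds for both signs and gives exp z - 1 - z
  \<le> z * (exp z - 1). Bounding exp z - 1 once more, by z * exp z or from below by z, supplies the
  second factor z.\<close>

lemma abs_exp_taylor2_le: "\<bar>exp z - 1 - z\<bar> \<le> z^2 * (1 + exp (z::real))"
proof -
  have le: "exp z - 1 - z \<le> z^2 * (1 + exp z)"
  proof -
    show ?thesis
    proof (cases "z \<ge> 0")
      case True
      have "exp z * (1 - z) \<le> exp z * exp (- z)"
        by (intro mult_left_mono) (use exp_ge_add_one_self[of "-z"] in auto)
      then have 1: "exp z - 1 \<le> z * exp z"
        by (simp add: exp_minus algebra_simps)
      have "z * (exp z - 1) \<le> z * (z * exp z)"
        by (rule mult_left_mono[OF 1 True])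
      moreover have "exp z - 1 - z \<le> z * (exp z - 1)"
        using 1 by (simp add: algebra_simps)
      ultimately show ?thesis
        by (simp add: algebra_simps power2_eq_square) (use zero_le_square[of z] in linarith)
    next
      case False
      have "exp z * (1 - z) \<le> exp z * exp (- z)"
        by (intro mult_left_mono) (use exp_ge_add_one_self[of "-z"] in auto)
      then have 1: "exp z - 1 - z * exp z \<le> 0"
        by (simp add: exp_minus algebra_simps)
      have "1 + z \<le> exp z" by (rule exp_ge_add_one_self)
      then have "z * exp z - z \<le> z * z"
        using False mult_left_mono_neg[of "1 + z" "exp z" z] by (simp add: algebra_simps)
      moreover have "0 \<le> z * z * exp z" by (simp add: mult_nonneg_nonneg)
      ultimately show ?thesis
        using 1 by (simp add: algebra_simps power2_eq_square)
    qed
  qed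
  moreover have "exp z - 1 - z \<ge> 0"
    using exp_ge_add_one_self[of z] by linarith
  ultimately show ?thesis by simp
qed

text \<open>For norm w \<le> 1 the exponent of \<open>cm_density\<close> is at most norm w * (norm y
  + 1) in modulus. Under the weight \<open>cm_density w\<close> the variable becomes y + w, which
  costs another 1 and explains norm y + 2; the factor 2 counts the unweighted and the weighted
  integral.\<close>

lemma gauss_shift_integral_le:
  fixes k :: nat
  assumes w: "norm w \<le> 1" and k: "integrable std_gauss (\<lambda>y. (norm y + 2) ^ k)"
  shows "integrable std_gauss (\<lambda>y. \<bar>y \<bullet> w - (norm w)^2 / 2\<bar> ^ k * (1 + cm_density w y))"
    and "(\<integral>y. \<bar>y \<bullet> w - (norm w)^2 / 2\<bar> ^ k * (1 + cm_density w y) \<partial>std_gauss)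
       \<le> 2 * (\<integral>y. (norm y + 2) ^ k \<partial>std_gauss) * norm w ^ k"
proof -
  let ?z = "\<lambda>y. \<bar>y \<bullet> w - (norm w)^2 / 2\<bar> ^ k"
  let ?Z = "\<lambda>y::real^2. norm w ^ k * (norm y + 2) ^ k"
  have z: "\<bar>y \<bullet> w - (norm w)^2 / 2\<bar> \<le> norm w * (norm y + 1)" for y
  proof -
    have "\<bar>y \<bullet> w\<bar> \<le> norm y * norm w" by (rule Cauchy_Schwarz_ineq2)
    moreover have "(norm w)^2 / 2 \<le> norm w"
      using w mult_left_le[of "norm w" "norm w"] norm_ge_zero[of w] unfolding power2_eq_square by linarith
    moreover have "0 \<le> (norm w)^2 / 2" by simp
    ultimately show ?thesis unfolding ring_distribs mult.commute[of "norm w"] by linarith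
  qed
  have z1: "?z y \<le> ?Z y" for y
    unfolding power_mult_distrib[symmetric]
    by (intro power_mono order_trans[OF z] mult_left_mono) auto
  have z2: "?z (y + w) \<le> ?Z y" for y
    unfolding power_mult_distrib[symmetric]
    by (intro power_mono order_trans[OF z] mult_left_mono)
       (use w norm_triangle_ineq[of y w] in auto)
  have I: "integrable std_gauss ?Z"
    using k by simp
  have i1: "integrable std_gauss ?z"
    by (rule Bochner_Integration.integrable_bound[OF I]) (use z1 in auto)
  have "integrable std_gauss (\<lambda>y. ?z (y + w))"
    by (rule Bochner_Integration.integrable_bound[OF I]) (use z2 in auto)
  then have i2: "integrable std_gauss (\<lambda>y. cm_density w y * ?z y)"
    by (subst integrable_std_gauss_shift[symmetric]) auto
  have eq: "?z y * (1 + cm_density w y) = ?z y + cm_density w y * ?z y" for y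
    by (simp add: algebra_simps)
  show "integrable std_gauss (\<lambda>y. ?z y * (1 + cm_density w y))"
    unfolding eq using i1 i2 by simp
  have "(\<integral>y. ?z y * (1 + cm_density w y) \<partial>std_gauss) = (\<integral>y. ?z y \<partial>std_gauss) + (\<integral>y. ?z (y + w) \<partial>std_gauss)"
    unfolding eq using i1 i2 integral_std_gauss_shift[of ?z w] by simp
  also have "\<dots> \<le> (\<integral>y. ?Z y \<partial>std_gauss) + (\<integral>y. ?Z y \<partial>std_gauss)"
    by (intro add_mono Bochner_Integration.integral_mono i1 I z1 z2)
       (fact \<open>integrable std_gauss (\<lambda>y. ?z (y + w))\<close>)
  finally show "(\<integral>y. ?z y * (1 + cm_density w y) \<partial>std_gauss)
      \<le> 2 * (\<integral>y. (norm y + 2) ^ k \<partial>std_gauss) * norm w ^ k"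
    by (simp add: mult.commute)
qed

lemma integrable_std_gauss_norm_plus2:
  "integrable std_gauss (\<lambda>y. (norm y + 2) ^ 1)" "integrable std_gauss (\<lambda>y. (norm y + 2) ^ 2)"
  using integrable_std_gauss_norm integrable_std_gauss_norm_sq
  by (simp_all add: power2_sum)

definition gauss_C1 :: real where
  "gauss_C1 = 2 * (\<integral>y. (norm y + 2) ^ 1 \<partial>std_gauss)"

text \<open>Large enough for both regimes of the second order bound: 1 plus twice the second moment
  for norm w \<le> 1, and 2 plus the mean norm for norm w > 1.\<close>

definition gauss_C2 :: real where
  "gauss_C2 = 4 + 2 * (\<integral>y. (norm y + 2) ^ 2 \<partial>std_gauss) + (\<integral>y. norm y \<partial>std_gauss)"

lemma gauss_C_nonneg: "0 \<le> gauss_C1" "0 \<le> gauss_C2"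
  by (auto simp: gauss_C1_def gauss_C2_def intro!: add_nonneg_nonneg)

lemma integrable_cm_density_mult:
  assumes [measurable]: "f \<in> borel_measurable borel" and "\<And>x. \<bar>f x\<bar> \<le> 1"
  shows "integrable std_gauss (\<lambda>y. cm_density w y * f y)"
  by (subst integrable_std_gauss_shift[symmetric])
     (use assms in \<open>auto intro!: integrable_bounded_std_gauss[where L=1]\<close>)

text \<open>In effect this bounds the total variation distance between the Gaussian and its shift.
  Of f only the sup bound enters, which later makes the gradient bound independent of the regularity
  of f.\<close>

lemma gauss_shift_first_order:
  assumes [measurable]: "f \<in> borel_measurable borel" and f: "\<And>x. \<bar>f x\<bar> \<le> 1" and w: "norm w \<le> 1"
  shows "\<bar>(\<integral>y. f (y + w) \<partial>std_gauss) - (\<integral>y. f y \<partial>std_gauss)\<bar> \<le> gauss_C1 * norm w"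
proof -
  have i: "integrable std_gauss f"
    by (rule integrable_bounded_std_gauss[where L=1]) (use f in auto)
  note k = gauss_shift_integral_le[OF w integrable_std_gauss_norm_plus2(1)]
  have "(\<integral>y. f (y + w) \<partial>std_gauss) - (\<integral>y. f y \<partial>std_gauss) = (\<integral>y. cm_density w y * f y - f y \<partial>std_gauss)"
    using i integrable_cm_density_mult[OF _ f] by (simp add: integral_std_gauss_shift)
  also have "\<bar>\<dots>\<bar> \<le> (\<integral>y. \<bar>y \<bullet> w - (norm w)^2 / 2\<bar> ^ 1 * (1 + cm_density w y) \<partial>std_gauss)"
  proof (rule integral_abs_bound_integral)
    fix y
    have "\<bar>cm_density w y * f y - f y\<bar> = \<bar>cm_density w y - 1\<bar> * \<bar>f y\<bar>"
      by (simp add: abs_mult[symmetric] algebra_simps)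
    also have "\<dots> \<le> \<bar>cm_density w y - 1\<bar> * 1"
      by (intro mult_left_mono f) simp
    also have "\<dots> \<le> \<bar>y \<bullet> w - (norm w)^2 / 2\<bar> ^ 1 * (1 + cm_density w y)"
      unfolding cm_density_def using abs_exp_minus_one_le by simp
    finally show "\<bar>cm_density w y * f y - f y\<bar> \<le> \<bar>y \<bullet> w - (norm w)^2 / 2\<bar> ^ 1 * (1 + cm_density w y)" .
  qed (use i k(1) integrable_cm_density_mult[OF _ f] in auto)
  also have "\<dots> \<le> gauss_C1 * norm w"
    using k(2) by (simp add: gauss_C1_def)
  finally show ?thesis .
qed

lemma gauss_shift_second_order:
  assumes [measurable]: "f \<in> borel_measurable borel" and f: "\<And>x. \<bar>f x\<bar> \<le> 1"
  shows "\<bar>(\<integral>y. f (y + w) \<partial>std_gauss) - (\<integral>y. f y \<partial>std_gauss) - (\<integral>y. f y * (y \<bullet> w) \<partial>std_gauss)\<bar>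
    \<le> gauss_C2 * (norm w)^2"
proof -
  have i: "integrable std_gauss f"
    by (rule integrable_bounded_std_gauss[where L=1]) (use f in auto)
  have fy: "\<bar>f y * (y \<bullet> w)\<bar> \<le> norm w * norm y" for y
    unfolding abs_mult using mult_mono[OF f Cauchy_Schwarz_ineq2[of y w]] by (simp add: mult.commute)
  have in1: "integrable std_gauss (\<lambda>y. norm w * norm y)"
    using integrable_std_gauss_norm by simp
  have iy: "integrable std_gauss (\<lambda>y. f y * (y \<bullet> w))"
    by (rule Bochner_Integration.integrable_bound[OF in1]) (use fy in auto)
  show ?thesis
  proof (cases "norm w \<le> 1")
    case True
    note k = gauss_shift_integral_le[OF True integrable_std_gauss_norm_plus2(2)]
    have ic: "integrable std_gauss (\<lambda>y. cm_density w y * f y)"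
      by (rule integrable_cm_density_mult) (use f in auto)
    have "(\<integral>y. f (y + w) \<partial>std_gauss) - (\<integral>y. f y \<partial>std_gauss) - (\<integral>y. f y * (y \<bullet> w) \<partial>std_gauss)
        = (\<integral>y. cm_density w y * f y - f y - f y * (y \<bullet> w) \<partial>std_gauss)"
      using i ic iy by (simp add: integral_std_gauss_shift)
    also have "\<bar>\<dots>\<bar> \<le> (\<integral>y. \<bar>y \<bullet> w - (norm w)^2 / 2\<bar> ^ 2 * (1 + cm_density w y) + (norm w)^2 \<partial>std_gauss)"
    proof (rule integral_abs_bound_integral)
      fix y
      have "\<bar>cm_density w y * f y - f y - f y * (y \<bullet> w)\<bar> = \<bar>cm_density w y - 1 - y \<bullet> w\<bar> * \<bar>f y\<bar>"
        by (simp add: abs_mult[symmetric] algebra_simps)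
      also have "\<dots> \<le> \<bar>cm_density w y - 1 - y \<bullet> w\<bar> * 1"
        by (intro mult_left_mono f) simp
      \<comment> \<open>The linear term wanted is y \<bullet> w, while the expansion of exp produces
        the whole exponent; the difference (norm w)^2 / 2 goes into the additive term.\<close>
      also have "\<dots> \<le> \<bar>cm_density w y - 1 - (y \<bullet> w - (norm w)^2 / 2)\<bar> + (norm w)^2"
      proof -
        have "\<bar>a - 1 - b\<bar> \<le> \<bar>a - 1 - (b - c / 2)\<bar> + c" if "0 \<le> c" for a b c :: real
          using that by linarith
        then show ?thesis by simp
      qed
      also have "\<bar>cm_density w y - 1 - (y \<bullet> w - (norm w)^2 / 2)\<bar>
          \<le> \<bar>y \<bullet> w - (norm w)^2 / 2\<bar> ^ 2 * (1 + cm_density w y)"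
        unfolding cm_density_def power2_abs by (rule abs_exp_taylor2_le)
      finally show "\<bar>cm_density w y * f y - f y - f y * (y \<bullet> w)\<bar>
        \<le> \<bar>y \<bullet> w - (norm w)^2 / 2\<bar> ^ 2 * (1 + cm_density w y) + (norm w)^2"
        by simp
    qed (use i ic iy k(1) in auto)
    also have "\<dots> = (\<integral>y. \<bar>y \<bullet> w - (norm w)^2 / 2\<bar> ^ 2 * (1 + cm_density w y) \<partial>std_gauss) + (norm w)^2"
      using k(1) std_gauss.prob_space by (subst Bochner_Integration.integral_add) auto
    also have "\<dots> \<le> (1 + 2 * (\<integral>y. (norm y + 2) ^ 2 \<partial>std_gauss)) * (norm w)^2"
      using k(2) by (simp add: algebra_simps)
    also have "\<dots> \<le> gauss_C2 * (norm w)^2"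
      unfolding gauss_C2_def by (intro mult_right_mono) auto
    finally show ?thesis .
  next
    case False
    \<comment> \<open>No expansion for large w: the three integrals are bounded one by one, and both
      1 and norm w are at most (norm w)^2.\<close>
    have i': "integrable std_gauss (\<lambda>y. f (y + w))"
      by (rule integrable_bounded_std_gauss[where L=1]) (use f in auto)
    have 1: "\<bar>\<integral>y. f (y + w) \<partial>std_gauss\<bar> \<le> 1"
      using integral_abs_bound_integral[OF i', of "\<lambda>_. 1"] f std_gauss.prob_space by simp
    have 2: "\<bar>\<integral>y. f y \<partial>std_gauss\<bar> \<le> 1"
      using integral_abs_bound_integral[OF i, of "\<lambda>_. 1"] f std_gauss.prob_space by simp
    have 3: "\<bar>\<integral>y. f y * (y \<bullet> w) \<partial>std_gauss\<bar> \<le> norm w * (\<integral>y. norm y \<partial>std_gauss)"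
      using integral_abs_bound_integral[OF iy in1 fy] by simp
    have w: "1 \<le> (norm w)^2" "norm w \<le> (norm w)^2"
      using False mult_left_mono[of 1 "norm w" "norm w"] by (simp_all add: power2_eq_square)
    have "norm w * (\<integral>y. norm y \<partial>std_gauss) \<le> (norm w)^2 * (\<integral>y. norm y \<partial>std_gauss)"
      by (intro mult_right_mono w) auto
    with 1 2 3 w(1) have "\<bar>(\<integral>y. f (y + w) \<partial>std_gauss) - (\<integral>y. f y \<partial>std_gauss) - (\<integral>y. f y * (y \<bullet> w) \<partial>std_gauss)\<bar>
      \<le> (2 + (\<integral>y. norm y \<partial>std_gauss)) * (norm w)^2"
      by (simp add: algebra_simps)
    also have "\<dots> \<le> gauss_C2 * (norm w)^2"
      unfolding gauss_C2_def by (intro mult_right_mono) (auto intro!: add_nonneg_nonneg)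
    finally show ?thesis .
  qed
qed

section \<open>Smooth test functions and the gradient bound for the heat flow\<close>

text \<open>Test functions normalised by $|f| \le 1$, with \<open>f'\<close> in the role of the gradient.\<close>

definition C11_test :: "(real^2 \<Rightarrow> real) \<Rightarrow> (real^2 \<Rightarrow> real^2) \<Rightarrow> real \<Rightarrow> bool" where
  "C11_test f f' L \<longleftrightarrow> continuous_on UNIV f \<and> continuous_on UNIV f' \<and>
     (\<forall>x. \<bar>f x\<bar> \<le> 1) \<and> (\<forall>x. norm (f' x) \<le> L) \<and>
     (\<forall>x v. \<bar>f (x + v) - f x - v \<bullet> f' x\<bar> \<le> L * (norm v)^2)"

lemma C11_testD:
  assumes "C11_test f f' L"
  shows "continuous_on UNIV f" "continuous_on UNIV f'" "\<bar>f x\<bar> \<le> 1" "norm (f' x) \<le> L"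
    "\<bar>f (x + v) - f x - v \<bullet> f' x\<bar> \<le> L * (norm v)^2" "0 \<le> L"
    "f \<in> borel_measurable borel" "f' \<in> borel_measurable borel"
  using assms order_trans[OF norm_ge_zero]
  by (auto simp: C11_test_def intro: borel_measurable_continuous_onI)

text \<open>The remainder is averaged pointwise, so the constant L survives at every scale,
  including 0. Hence the Taylor error in the Duhamel argument does not blow up near the terminal
  time.\<close>

lemma gauss_avg_taylor:
  assumes "C11_test f f' L"
  shows "\<bar>gauss_avg a f (x + v) - gauss_avg a f x - v \<bullet> gauss_avg a f' x\<bar> \<le> L * (norm v)^2"
proof -
  note C = C11_testD[OF assms]
  note [measurable] = C(7,8)
  have i: "integrable std_gauss (\<lambda>y. f (z + a *\<^sub>R y))" for z
    by (rule integrable_bounded_std_gauss[where L=1]) (use C(3) in auto)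
  have i': "integrable std_gauss (\<lambda>y. f' (x + a *\<^sub>R y))"
    by (rule integrable_bounded_std_gauss[where L=L]) (use C(4) in auto)
  have "gauss_avg a f (x + v) - gauss_avg a f x - v \<bullet> gauss_avg a f' x
      = (\<integral>y. f (x + v + a *\<^sub>R y) - f (x + a *\<^sub>R y) - v \<bullet> f' (x + a *\<^sub>R y) \<partial>std_gauss)"
    unfolding gauss_avg_def using i i' by simp
  also have "\<bar>\<dots>\<bar> \<le> (\<integral>y. L * (norm v)^2 \<partial>std_gauss)"
  proof (rule integral_abs_bound_integral)
    fix y show "\<bar>f (x + v + a *\<^sub>R y) - f (x + a *\<^sub>R y) - v \<bullet> f' (x + a *\<^sub>R y)\<bar> \<le> L * (norm v)^2"
      using C(5)[of "x + a *\<^sub>R y" v] by (simp add: algebra_simps)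
  qed (use i i' in auto)
  finally show ?thesis using std_gauss.prob_space by simp
qed

lemma gauss_avg_shift:
  assumes "a \<noteq> 0"
  shows "gauss_avg a f (x + v) = (\<integral>y. f (x + a *\<^sub>R (y + (1/a) *\<^sub>R v)) \<partial>std_gauss)"
  unfolding gauss_avg_def using assms by (simp add: algebra_simps)

text \<open>Over a step of length t along the gradient direction, the increment of the average is at
  most \<open>gauss_C1\<close> * t / a, since a shift by t amounts to a Gaussian shift by t / a (at
  most 1 if t \<le> a). The Taylor remainder is L * t^2. Dividing by t and letting t tend to 0
  removes L.\<close>

lemma gauss_avg_grad_bound:
  assumes "C11_test f f' L" and a: "a > 0"
  shows "norm (gauss_avg a f' x) \<le> gauss_C1 / a"
proof -
  note C = C11_testD[OF assms(1)]
  note [measurable] = C(7,8)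
  define g where "g = gauss_avg a f' x"
  show ?thesis
  proof (cases "g = 0")
    case False
    define e where "e = (1 / norm g) *\<^sub>R g"
    have e: "norm e = 1" "e \<bullet> g = norm g"
      using False by (simp_all add: e_def dot_square_norm power2_eq_square)
    have le: "norm g \<le> gauss_C1 / a + L * t" if t: "0 < t" "t \<le> a" for t
    proof -
      let ?v = "t *\<^sub>R e"
      have "t * norm g = ?v \<bullet> g" using e by simp
      also have "\<dots> \<le> \<bar>gauss_avg a f (x + ?v) - gauss_avg a f x\<bar> + L * (norm ?v)^2"
        using gauss_avg_taylor[OF assms(1), of a x ?v] unfolding g_def by linarith
      also have "\<bar>gauss_avg a f (x + ?v) - gauss_avg a f x\<bar> \<le> gauss_C1 * norm ((1/a) *\<^sub>R ?v)"
      proof -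
        have "gauss_avg a f x = (\<integral>y. f (x + a *\<^sub>R y) \<partial>std_gauss)"
          by (simp add: gauss_avg_def)
        moreover have "gauss_avg a f (x + ?v) = (\<integral>y. f (x + a *\<^sub>R (y + (1/a) *\<^sub>R ?v)) \<partial>std_gauss)"
          using a by (intro gauss_avg_shift) simp
        moreover have "norm ((1/a) *\<^sub>R ?v) \<le> 1"
          using t a e by simp
        ultimately show ?thesis
          using gauss_shift_first_order[of "\<lambda>y. f (x + a *\<^sub>R y)" "(1/a) *\<^sub>R ?v"] C(3) by simp
      qed
      also have "gauss_C1 * norm ((1/a) *\<^sub>R ?v) + L * (norm ?v)^2 = t * (gauss_C1 / a + L * t)"
        using t a e by (simp add: field_simps power2_eq_square)
      finally show ?thesis using t by simp
    qed
    have "((\<lambda>t. gauss_C1 / a + L * t) \<longlongrightarrow> gauss_C1 / a + L * 0) (at_right 0)"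
      by (intro tendsto_intros)
    moreover have "eventually (\<lambda>t. norm g \<le> gauss_C1 / a + L * t) (at_right 0)"
      unfolding eventually_at_right_field using a le by (intro exI[of _ a]) auto
    ultimately have "norm g \<le> gauss_C1 / a + L * 0"
      by (rule tendsto_lowerbound) simp
    then show ?thesis by (simp add: g_def)
  qed (use a gauss_C_nonneg in \<open>simp add: g_def[symmetric]\<close>)
qed

text \<open>The derivatives fall on the Gaussian, so continuity of g suffices. The constant blows up
  as a tends to 0, which is harmless because the estimates passed to the limit do not depend on
  it.\<close>

lemma C11_test_gauss_avg:
  assumes g: "continuous_on UNIV g" "\<And>x. \<bar>g x\<bar> \<le> 1" and a: "a > 0"
  shows "\<exists>f' L. C11_test (gauss_avg a g) f' L"
proof -
  have [measurable]: "g \<in> borel_measurable borel"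
    using g(1) by (rule borel_measurable_continuous_onI)
  \<comment> \<open>Gaussian integration by parts: the gradient of the average is the average of g
    times y / a. In \<open>L\<close> below, the second summand bounds the Taylor remainder and the
    third the gradient.\<close>
  define f' where "f' x = (1 / a) *\<^sub>R (\<integral>y. g (x + a *\<^sub>R y) *\<^sub>R y \<partial>std_gauss)" for x
  define L where "L = gauss_C1 / a + gauss_C2 / a^2 + (\<integral>y. norm y \<partial>std_gauss) / a"
  have gy: "norm (g (x + a *\<^sub>R y) *\<^sub>R y) \<le> norm y" for x y
    using mult_right_mono[OF g(2)[of "x + a *\<^sub>R y"], of "norm y"] by simp
  have iy: "integrable std_gauss (\<lambda>y. g (x + a *\<^sub>R y) *\<^sub>R y)" for x
    by (rule Bochner_Integration.integrable_bound[OF integrable_std_gauss_norm]) (use gy in auto)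
  have avg_bound: "\<bar>gauss_avg a g x\<bar> \<le> 1" for x
    using gauss_avg_bound[of g 1 a x] g(2) by simp
  have pair: "continuous_on UNIV (\<lambda>x. (a, x :: real^2))"
    by (intro continuous_intros)
  have cont: "continuous_on UNIV (gauss_avg a g)"
    using continuous_on_compose2[OF continuous_gauss_avg[OF g(1), of 1] pair] g(2) by simp
  have cont': "continuous_on UNIV f'"
    unfolding f'_def
  proof (rule continuous_on_scaleR[OF continuous_on_const], rule continuous_on_sequentiallyI)
    fix u :: "nat \<Rightarrow> real^2" and x assume u: "u \<longlonglongrightarrow> x"
    show "(\<lambda>n. \<integral>y. g (u n + a *\<^sub>R y) *\<^sub>R y \<partial>std_gauss) \<longlonglongrightarrow> (\<integral>y. g (x + a *\<^sub>R y) *\<^sub>R y \<partial>std_gauss)"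
    proof (rule integral_dominated_convergence[OF _ _ integrable_std_gauss_norm])
      show "AE y in std_gauss. (\<lambda>n. g (u n + a *\<^sub>R y) *\<^sub>R y) \<longlonglongrightarrow> g (x + a *\<^sub>R y) *\<^sub>R y"
        by (intro AE_I2 tendsto_scaleR tendsto_const continuous_on_tendsto_compose[OF g(1)] tendsto_add u) auto
    qed (use gy in auto)
  qed
  have bound': "norm (f' x) \<le> L" for x
  proof -
    have "norm (\<integral>y. g (x + a *\<^sub>R y) *\<^sub>R y \<partial>std_gauss) \<le> (\<integral>y. norm y \<partial>std_gauss)"
      using Bochner_Integration.integral_norm_bound_integral[OF iy integrable_std_gauss_norm gy] .
    then have "norm (f' x) \<le> (\<integral>y. norm y \<partial>std_gauss) / a"
      using a by (simp add: f'_def divide_right_mono)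
    also have "\<dots> \<le> L"
      using gauss_C_nonneg a by (simp add: L_def)
    finally show ?thesis .
  qed
  have taylor: "\<bar>gauss_avg a g (x + v) - gauss_avg a g x - v \<bullet> f' x\<bar> \<le> L * (norm v)^2" for x v
  proof -
    let ?h = "\<lambda>y. g (x + a *\<^sub>R y)" and ?w = "(1/a) *\<^sub>R v"
    have "\<bar>(\<integral>y. ?h (y + ?w) \<partial>std_gauss) - (\<integral>y. ?h y \<partial>std_gauss) - (\<integral>y. ?h y * (y \<bullet> ?w) \<partial>std_gauss)\<bar>
        \<le> gauss_C2 * (norm ?w)^2"
      by (rule gauss_shift_second_order) (use g(2) in auto)
    moreover have "(\<integral>y. ?h y * (y \<bullet> ?w) \<partial>std_gauss) = v \<bullet> f' x"
    proof -
      have "(\<integral>y. ?h y * (y \<bullet> ?w) \<partial>std_gauss) = (\<integral>y. ?w \<bullet> (?h y *\<^sub>R y) \<partial>std_gauss)"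
        by (simp add: inner_commute mult.commute)
      also have "\<dots> = ?w \<bullet> (\<integral>y. ?h y *\<^sub>R y \<partial>std_gauss)"
        by (rule integral_inner_right) (use iy in auto)
      finally show ?thesis by (simp add: f'_def)
    qed
    moreover have "(\<integral>y. ?h (y + ?w) \<partial>std_gauss) = gauss_avg a g (x + v)"
      using a gauss_avg_shift[of a g x v] by simp
    moreover have "(\<integral>y. ?h y \<partial>std_gauss) = gauss_avg a g x"
      by (simp add: gauss_avg_def)
    moreover have "gauss_C2 * (norm ?w)^2 \<le> L * (norm v)^2"
    proof -
      have "gauss_C2 * (norm ?w)^2 = gauss_C2 / a^2 * (norm v)^2"
        using a by (simp add: power_divide)
      also have "\<dots> \<le> L * (norm v)^2"
        unfolding L_def using a gauss_C_nonneg
        by (intro mult_right_mono) (auto intro!: add_nonneg_nonneg)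
      finally show ?thesis .
    qed
    ultimately show ?thesis by simp
  qed
  show ?thesis
    unfolding C11_test_def using cont cont' avg_bound bound' taylor by blast
qed

section \<open>Velocity bounds\<close>

lemma bs_kernel_measurable [measurable]: "bs_kernel \<in> borel_measurable borel"
proof -
  have v: "vector [a, b] = a *\<^sub>R axis 1 1 + b *\<^sub>R (axis 2 1 :: real^2)" for a b :: real
    by (simp add: vec_eq_iff forall_2 axis_def)
  show ?thesis
    unfolding bs_kernel_def v by measurable
qed

text \<open>Valid at the origin as well: there both sides are 0, by the value chosen for the kernel
  and by division by zero.\<close>

lemma norm_bs_kernel: "norm (bs_kernel x) = 1 / (2 * pi * norm x)"
proof (cases "x = 0")
  case False
  have "(norm (vector [- (x$2), x$1] :: real^2))^2 = (norm x)^2"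
    by (simp add: norm_vec2)
  then have "norm (vector [- (x$2), x$1] :: real^2) = norm x"
    by (simp add: power2_eq_iff_nonneg)
  with False show ?thesis
    by (simp add: bs_kernel_def power2_eq_square)
qed (simp add: bs_kernel_def)

text \<open>
  The bound $1/|z| \le |z_1|^{-1/2} |z_2|^{-1/2}$ makes $|z|^{-4/3}$ integrable over a square by a product
  argument, without polar coordinates. The value \<open>\<infinity>\<close> at \<open>0\<close> keeps the bound valid on the axes.
\<close>

definition box_weight :: "real \<Rightarrow> ennreal" where
  "box_weight t = (if t = 0 then \<infinity> else ennreal (\<bar>t\<bar> powr (-2/3))) * indicator {-1..1} t"

lemma box_weight_measurable [measurable]: "box_weight \<in> borel_measurable borel"
  unfolding box_weight_def by measurable

lemma nn_integral_box_weight: "(\<integral>\<^sup>+t. box_weight t \<partial>lborel) \<le> 6"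
proof -
  let ?f = "\<lambda>t::real. ennreal (t powr (-2/3)) * indicator {0..1} t"
  have "((\<lambda>x::real. x powr (-2/3)) has_integral (1 powr (-2/3+1) / (-2/3+1))) {0..1}"
    by (rule has_integral_powr_from_0) auto
  then have f: "(\<integral>\<^sup>+t. ?f t \<partial>lborel) = 3"
    by (subst nn_integral_has_integral_lebesgue'[of "{0..1}" "\<lambda>x. x powr (-2/3)" 3]) auto
  have "(\<integral>\<^sup>+t. box_weight t \<partial>lborel) \<le> (\<integral>\<^sup>+t. ?f t + ?f (- t) \<partial>lborel)"
  proof (rule nn_integral_mono_AE)
    show "AE t in lborel. box_weight t \<le> ?f t + ?f (- t)"
      using AE_lborel_singleton[of "0::real"]
      by eventually_elim (auto simp: box_weight_def indicator_def abs_if)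
  qed
  also have "\<dots> = (\<integral>\<^sup>+t. ?f t \<partial>lborel) + (\<integral>\<^sup>+t. ?f (- t) \<partial>lborel)"
    by (rule nn_integral_add) auto
  also have "(\<integral>\<^sup>+t. ?f (- t) \<partial>lborel) = (\<integral>\<^sup>+t. ?f t \<partial>lborel)"
    by (subst nn_integral_real_affine[of ?f "-1" 0]) auto
  finally show ?thesis using f by simp
qed

text \<open>Young's inequality for the conjugate exponents 4 and 4/3, without sharp constants:
  according to whether q \<le> p^3 or not, one of the two summands alone dominates the
  product.\<close>

lemma young_4_third:
  fixes p q :: real
  assumes "0 \<le> p" "0 < q"
  shows "p * q \<le> p^4 + q powr (4/3)"
proof (cases "q \<le> p^3")
  case True
  then have "p * q \<le> p * p^3"
    using assms by (intro mult_left_mono) auto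
  also have "\<dots> = p^4" by (simp add: power_numeral_reduce)
  finally show ?thesis by (simp add: add_increasing2)
next
  case False
  have "p \<le> q powr (1/3)"
  proof (rule ccontr)
    assume "\<not> ?thesis"
    then have "(q powr (1/3))^3 < p^3"
      by (intro power_strict_mono) auto
    moreover have "(q powr (1/3))^3 = q"
      using assms by (simp add: powr_power)
    ultimately show False using False by simp
  qed
  then have "p * q \<le> q powr (1/3) * q"
    using assms by (intro mult_right_mono) auto
  also have "\<dots> = q powr (1/3) * q powr 1" using assms by simp
  also have "\<dots> = q powr (4/3)" by (subst powr_add[symmetric]) simp
  finally show ?thesis by (simp add: add_increasing)
qed

text \<open>Outside the unit box the kernel is at most 1, so p itself suffices. Inside, p * q is
  written as m * ((p / m) * q) before Young's inequality is applied; with m comparable to the L^4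
  norm of the density, the integrated bound becomes linear in m.\<close>

lemma kernel_young:
  fixes p :: real and z :: "real^2"
  assumes p: "0 \<le> p" and m: "0 < m"
  shows "ennreal (p * norm (bs_kernel z))
    \<le> ennreal p + ennreal m * (ennreal ((p / m)^4) + box_weight (z$1) * box_weight (z$2))"
proof -
  have k1: "norm (bs_kernel z) \<le> 1 / norm z"
  proof (cases "z = 0")
    case False
    have "1 * norm z \<le> 2 * pi * norm z"
      using pi_gt3 by (intro mult_right_mono) auto
    with False show ?thesis
      unfolding norm_bs_kernel by (intro divide_left_mono) auto
  qed (simp add: bs_kernel_def)
  have zi: "\<bar>z$i\<bar> \<le> norm z" for i
    using component_le_norm_cart[of z i] by simp
  show ?thesis
  proof (cases "\<bar>z$1\<bar> \<le> 1 \<and> \<bar>z$2\<bar> \<le> 1")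
    case False
    then have "1 < norm z" using zi[of 1] zi[of 2] by linarith
    then have "norm (bs_kernel z) \<le> 1"
      by (intro order_trans[OF k1]) (subst divide_le_eq_1_pos, auto)
    then have "p * norm (bs_kernel z) \<le> p"
      using p mult_left_mono[of "norm (bs_kernel z)" 1 p] by simp
    then show ?thesis
      by (simp add: ennreal_leI add_increasing2)
  next
    case box: True
    show ?thesis
    proof (cases "z$1 = 0 \<or> z$2 = 0")
      case True
      with box have "box_weight (z$1) * box_weight (z$2) = \<infinity>"
        by (auto simp: box_weight_def indicator_def ennreal_mult_eq_top_iff ennreal_top_mult)
      then have "ennreal m * (ennreal ((p / m)^4) + box_weight (z$1) * box_weight (z$2)) = \<infinity>"
        using m by (simp only: add_top infinity_ennreal_def) (simp add: ennreal_mult_eq_top_iff)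
      then show ?thesis by simp
    next
      case False
      define q where "q = \<bar>z$1\<bar> powr (-1/2) * \<bar>z$2\<bar> powr (-1/2)"
      have q: "0 < q" using False by (simp add: q_def)
      have z: "z \<noteq> 0" using False by auto
      have ab: "\<bar>z$1\<bar> * \<bar>z$2\<bar> \<le> (norm z)^2"
        using zi[of 1] zi[of 2] by (auto simp: power2_eq_square intro!: mult_mono)
      have "1 / norm z \<le> q"
      proof -
        have "((norm z)^2) powr (-1/2) \<le> (\<bar>z$1\<bar> * \<bar>z$2\<bar>) powr (-1/2)"
          using False ab by (intro powr_mono2') auto
        moreover have "((norm z)^2) powr (-1/2) = 1 / norm z"
        proof -
          have "(norm z)^2 = norm z powr 2" using z by simp
          then have "((norm z)^2) powr (-1/2) = norm z powr (-1)" by (simp only: powr_powr) simp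
          also have "\<dots> = 1 / norm z" using z by (simp add: powr_minus_divide)
          finally show ?thesis .
        qed
        ultimately show ?thesis
          by (simp add: q_def powr_mult)
      qed
      with k1 have "p * norm (bs_kernel z) \<le> p * q"
        using p by (intro mult_left_mono) auto
      also have "\<dots> = m * ((p / m) * q)" using m by simp
      also have "\<dots> \<le> m * ((p / m)^4 + q powr (4/3))"
        using m p q by (intro mult_left_mono young_4_third) auto
      also have "q powr (4/3) = \<bar>z$1\<bar> powr (-2/3) * \<bar>z$2\<bar> powr (-2/3)"
        by (simp add: q_def powr_mult powr_powr)
      finally have "ennreal (p * norm (bs_kernel z))
          \<le> ennreal (m * ((p / m)^4 + \<bar>z$1\<bar> powr (-2/3) * \<bar>z$2\<bar> powr (-2/3)))"
        by (rule ennreal_leI)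
      also have "\<dots> = ennreal m * (ennreal ((p / m)^4) + box_weight (z$1) * box_weight (z$2))"
        using False box m p by (simp add: box_weight_def indicator_def ennreal_mult abs_le_iff)
      finally show ?thesis by (simp add: add_increasing)
    qed
  qed
qed

text \<open>Integrating \<open>kernel_young\<close>, the mass gives 1, the scaled fourth power 1,
  and the box weight 6 * 6 = 36. Then 1 + 37 * m \<le> 38 * m because 1 \<le> m.\<close>

lemma nn_integral_kernel_bound:
  fixes v :: "real^2 \<Rightarrow> real"
  assumes [measurable]: "v \<in> borel_measurable borel" and v: "\<And>y. 0 \<le> v y"
    and mass: "(\<integral>\<^sup>+y. ennreal (v y) \<partial>lborel) \<le> 1"
    and m: "1 \<le> m" and L4: "(\<integral>\<^sup>+y. ennreal ((v y)^4) \<partial>lborel) \<le> ennreal (m^4)"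
  shows "(\<integral>\<^sup>+y. ennreal (v y * norm (bs_kernel (x - y))) \<partial>lborel) \<le> ennreal (38 * m)"
proof -
  let ?w = "\<lambda>z::real^2. box_weight (z$1) * box_weight (z$2)"
  have w: "(\<integral>\<^sup>+y. ?w (x - y) \<partial>lborel) \<le> 36"
  proof -
    have "(\<integral>\<^sup>+y. ?w (x - y) \<partial>lborel) = (\<integral>\<^sup>+z. ?w z \<partial>lborel)"
      by (subst nn_integral_lborel_scaleR[of ?w "-1" x]) auto
    also have "\<dots> = (\<integral>\<^sup>+t. box_weight t \<partial>lborel) * (\<integral>\<^sup>+t. box_weight t \<partial>lborel)"
      by (rule nn_integral_lborel_vec2) auto
    also have "\<dots> \<le> 6 * 6"
      by (intro mult_mono nn_integral_box_weight) auto
    finally show ?thesis by simp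
  qed
  have l4: "(\<integral>\<^sup>+y. ennreal ((v y / m)^4) \<partial>lborel) \<le> 1"
  proof -
    have "(\<integral>\<^sup>+y. ennreal ((v y / m)^4) \<partial>lborel) = (\<integral>\<^sup>+y. ennreal (1 / m^4) * ennreal ((v y)^4) \<partial>lborel)"
      using m v by (simp add: ennreal_mult[symmetric] power_divide)
    also have "\<dots> = ennreal (1 / m^4) * (\<integral>\<^sup>+y. ennreal ((v y)^4) \<partial>lborel)"
      by (rule nn_integral_cmult) auto
    also have "\<dots> \<le> ennreal (1 / m^4) * ennreal (m^4)"
      by (intro mult_left_mono L4) simp
    also have "\<dots> = 1" using m by (subst ennreal_mult[symmetric]) auto
    finally show ?thesis .
  qed
  have "(\<integral>\<^sup>+y. ennreal (v y * norm (bs_kernel (x - y))) \<partial>lborel)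
     \<le> (\<integral>\<^sup>+y. ennreal (v y) + ennreal m * (ennreal ((v y / m)^4) + ?w (x - y)) \<partial>lborel)"
    using m v by (intro nn_integral_mono) (use kernel_young[of _ m "x - _"] in \<open>force\<close>)
  also have "\<dots> = (\<integral>\<^sup>+y. ennreal (v y) \<partial>lborel)
      + ennreal m * ((\<integral>\<^sup>+y. ennreal ((v y / m)^4) \<partial>lborel) + (\<integral>\<^sup>+y. ?w (x - y) \<partial>lborel))"
    by (subst nn_integral_add, simp, simp, subst nn_integral_cmult, simp, subst nn_integral_add) auto
  also have "\<dots> \<le> 1 + ennreal m * (1 + 36)"
    by (intro add_mono mult_left_mono mass w l4) auto
  also have "\<dots> = ennreal (1 + m * 37)"
    using m by (simp add: ennreal_mult ennreal_plus)
  also have "\<dots> \<le> ennreal (38 * m)"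
    using m by (intro ennreal_leI) simp
  finally show ?thesis .
qed

section \<open>The Duhamel formula\<close>

text \<open>Telescoping over equal short steps gives |G t - G s| \<le> \<epsilon> * (V t - V s) for
  every \<epsilon> > 0. Measuring increments against V instead of q - p admits a drift bound that is
  merely integrable in time.\<close>

lemma small_increments_imp_eq:
  fixes G V :: "real \<Rightarrow> real"
  assumes st: "s < t"
    and small: "\<And>\<epsilon>. \<epsilon> > 0 \<Longrightarrow> \<exists>\<delta>>0. \<forall>p q. s \<le> p \<and> p < q \<and> q \<le> t \<and> q - p < \<delta> \<longrightarrow> \<bar>G q - G p\<bar> \<le> \<epsilon> * (V q - V p)"
  shows "G t = G s"
proof -
  have main: "\<bar>G t - G s\<bar> \<le> \<epsilon> * (V t - V s)" if "\<epsilon> > 0" for \<epsilon>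
  proof -
    obtain \<delta> where \<delta>: "\<delta> > 0" "\<And>p q. s \<le> p \<Longrightarrow> p < q \<Longrightarrow> q \<le> t \<Longrightarrow> q - p < \<delta> \<Longrightarrow> \<bar>G q - G p\<bar> \<le> \<epsilon> * (V q - V p)"
      using small[OF \<open>\<epsilon> > 0\<close>] by blast
    obtain n :: nat where n: "(t - s) / \<delta> < real n"
      using reals_Archimedean2 by blast
    have n0: "0 < real n"
      using n st \<delta>(1) by (smt (verit) divide_pos_pos)
    define h where "h = (t - s) / real n"
    have h: "0 < h" "h < \<delta>"
      using n n0 st \<delta>(1) by (auto simp: h_def field_simps)
    have nh: "real n * h = t - s" using n0 by (simp add: h_def)
    have "k \<le> n \<Longrightarrow> \<bar>G (s + real k * h) - G s\<bar> \<le> \<epsilon> * (V (s + real k * h) - V s)" for k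
    proof (induction k)
      case (Suc k)
      have "real (Suc k) * h \<le> real n * h"
        using Suc.prems h by (intro mult_right_mono) auto
      then have le: "s + real (Suc k) * h \<le> t" using nh by simp
      have "\<bar>G (s + real (Suc k) * h) - G (s + real k * h)\<bar>
          \<le> \<epsilon> * (V (s + real (Suc k) * h) - V (s + real k * h))"
        by (rule \<delta>(2)) (use h le in \<open>auto simp: algebra_simps\<close>)
      with Suc show ?case by (simp add: algebra_simps)
    qed simp
    from this[of n] nh show ?thesis by simp
  qed
  show ?thesis
  proof (rule ccontr)
    assume "G t \<noteq> G s"
    then have pos: "0 < \<bar>G t - G s\<bar>" by simp
    define D where "D = \<bar>V t - V s\<bar> + 1"
    have D: "0 < D" "V t - V s < D" by (auto simp: D_def)
    have e: "0 < \<bar>G t - G s\<bar> / D" using pos D by simp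
    have "\<bar>G t - G s\<bar> \<le> \<bar>G t - G s\<bar> / D * (V t - V s)"
      by (rule main[OF e])
    also have "\<dots> < \<bar>G t - G s\<bar> / D * D"
      using e D by (intro mult_strict_left_mono) auto
    finally show False using D by simp
  qed
qed

lemma norm_integral_le_integral:
  fixes f :: "'a \<Rightarrow> 'b::{banach,second_countable_topology}"
  assumes "f \<in> borel_measurable M" "integrable M g" "\<And>x. x \<in> space M \<Longrightarrow> norm (f x) \<le> g x"
  shows "norm (\<integral>x. f x \<partial>M) \<le> (\<integral>x. g x \<partial>M)"
proof -
  have i: "integrable M (\<lambda>x. norm (f x))"
    by (rule Bochner_Integration.integrable_bound[OF assms(2)])
       (use assms in \<open>auto intro!: AE_I2 order_trans[OF _ abs_ge_self]\<close>)
  have "norm (\<integral>x. f x \<partial>M) \<le> (\<integral>x. norm (f x) \<partial>M)" by (rule integral_norm_bound)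
  also have "\<dots> \<le> (\<integral>x. g x \<partial>M)"
    by (intro integral_mono i assms)
  finally show ?thesis .
qed

text \<open>The drift is a given function here; its dependence on the law of X enters only in
  \<open>biot_savart_pair\<close>. Joint measurability and the drift bound are required at all real
  times, so that Fubini over \<open>lborel\<close> applies without restricting the time
  axis.\<close>

locale drift_sde = prob_space M for M :: "'a measure" +
  fixes T c :: real and F :: "real \<Rightarrow> 'a measure" and W X :: "real \<Rightarrow> 'a \<Rightarrow> real^2"
    and b :: "real \<Rightarrow> real^2 \<Rightarrow> real^2" and \<beta> :: "real \<Rightarrow> real"
  assumes c_pos: "0 < c"
    and filtration: "is_filtration M F"
    and brownian: "brownian2 T M F W"
    and X_adapted: "\<And>t. t \<in> {0..T} \<Longrightarrow> X t \<in> borel_measurable (F t)"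
    and X_joint: "(\<lambda>(s, \<omega>). X s \<omega>) \<in> borel_measurable (borel \<Otimes>\<^sub>M M)"
    and X_cont: "AE \<omega> in M. continuous_on {0..T} (\<lambda>t. X t \<omega>)"
    and b_joint: "(\<lambda>(s, x). b s x) \<in> borel_measurable (borel \<Otimes>\<^sub>M borel)"
    and b_bound: "\<And>s x. norm (b s x) \<le> \<beta> s"
    and \<beta>_integrable: "integrable lborel \<beta>"
    and sde: "\<And>t. t \<in> {0..T} \<Longrightarrow> AE \<omega> in M.
        X t \<omega> = X 0 \<omega> + (\<integral>s\<in>{0..t}. b s (X s \<omega>) \<partial>lborel) + c *\<^sub>R W t \<omega>"
begin

lemma subalg: "subalgebra M (F t)" and F_mono: "s \<le> t \<Longrightarrow> sets (F s) \<subseteq> sets (F t)"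
  using filtration by (auto simp: is_filtration_def)

lemma space_F [simp]: "space (F t) = space M"
  using subalg by (simp add: subalgebra_def)

lemma measurable_F_M: "f \<in> borel_measurable (F t) \<Longrightarrow> f \<in> borel_measurable M"
  by (rule measurable_from_subalg[OF subalg])

lemma measurable_F_mono: "f \<in> borel_measurable (F s) \<Longrightarrow> s \<le> t \<Longrightarrow> f \<in> borel_measurable (F t)"
  by (rule measurable_from_subalg[of "F t" "F s"]) (simp_all add: subalgebra_def F_mono)

lemma W_adapted: "t \<in> {0..T} \<Longrightarrow> W t \<in> borel_measurable (F t)"
  using brownian by (auto simp: brownian2_def)

lemma X_measurable2 [measurable (raw)]:
  "f \<in> borel_measurable N \<Longrightarrow> g \<in> measurable N M \<Longrightarrow> (\<lambda>x. X (f x) (g x)) \<in> borel_measurable N"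
  using measurable_compose[OF measurable_Pair X_joint, of f N g] by simp

lemma b_measurable2 [measurable (raw)]:
  "f \<in> borel_measurable N \<Longrightarrow> g \<in> borel_measurable N \<Longrightarrow> (\<lambda>x. b (f x) (g x)) \<in> borel_measurable N"
  using measurable_compose[OF measurable_Pair b_joint, of f N g] by simp

lemma \<beta>_measurable [measurable]: "\<beta> \<in> borel_measurable borel"
  using borel_measurable_integrable[OF \<beta>_integrable] by simp

lemma \<beta>_nonneg: "0 \<le> \<beta> s"
  using order_trans[OF norm_ge_zero b_bound] .

text \<open>Independence of the increment from all events of \<open>F p\<close> says that the state
  and the increment have a product law, first on rectangles and hence everywhere. Fubini then
  integrates out the Gaussian increment.\<close>

lemma expectation_increment:
  fixes Y :: "'a \<Rightarrow> real"
  assumes pq: "0 \<le> p" "p < q" "q \<le> T"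
    and Y: "Y \<in> borel_measurable (F p)" "\<And>\<omega>. \<bar>Y \<omega>\<bar> \<le> 1"
    and \<xi>: "\<xi> \<in> borel_measurable (F p)"
    and \<phi> [measurable]: "\<phi> \<in> borel_measurable borel" and \<phi>1: "\<And>x. \<bar>\<phi> x\<bar> \<le> 1"
  shows "(\<integral>\<omega>. Y \<omega> * \<phi> (\<xi> \<omega> + c *\<^sub>R (W q \<omega> - W p \<omega>)) \<partial>M)
       = (\<integral>\<omega>. Y \<omega> * gauss_avg (c * sqrt (q - p)) \<phi> (\<xi> \<omega>) \<partial>M)"
proof -
  define N where "N = restr_to_subalg M (F p)"
  define D where "D \<omega> = W q \<omega> - W p \<omega>" for \<omega>
  have sN: "sets N = sets (F p)" "space N = space M"
    by (simp_all add: N_def sets_restr_to_subalg[OF subalg] space_restr_to_subalg)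
  have [measurable]: "W q \<in> borel_measurable M" "W p \<in> borel_measurable M"
    using W_adapted pq by (auto intro: measurable_F_M[of _ q] measurable_F_M[of _ p])
  have [measurable]: "D \<in> borel_measurable M" unfolding D_def by measurable
  have YN [measurable]: "Y \<in> borel_measurable N" and \<xi>N [measurable]: "\<xi> \<in> borel_measurable N"
    using Y(1) \<xi> by (simp_all add: measurable_cong_sets[OF sN(1) refl])
  have idM [measurable]: "(\<lambda>\<omega>. \<omega>) \<in> measurable M N"
    using subalg[of p] sN by (auto simp: measurable_def subalgebra_def sets.sets_into_space Int_absorb2)
  have eN: "emeasure N A = emeasure M A" if "A \<in> sets N" for A
    using that sN by (simp add: N_def emeasure_restr_to_subalg[OF subalg])
  have "emeasure N (space N) = 1"
    by (subst eN[OF sets.top]) (simp only: sN(2) emeasure_space_1)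
  then interpret N: prob_space N
    by (rule prob_spaceI)
  interpret DD: prob_space "distr M borel D"
    by (rule prob_space_distr) simp
  interpret P: pair_sigma_finite N "distr M borel D" ..
  have ind: "measure M (A \<inter> {\<omega>\<in>space M. D \<omega> \<in> B}) = measure M A * measure M {\<omega>\<in>space M. D \<omega> \<in> B}"
    if "A \<in> sets (F p)" "B \<in> sets borel" for A B
    using brownian pq that unfolding brownian2_def D_def by blast
  have eq: "N \<Otimes>\<^sub>M distr M borel D = distr M (N \<Otimes>\<^sub>M borel) (\<lambda>\<omega>. (\<omega>, D \<omega>))"
  proof (rule pair_measure_eqI)
    show "sigma_finite_measure N" "sigma_finite_measure (distr M borel D)" by unfold_locales
    show "sets (N \<Otimes>\<^sub>M distr M borel D) = sets (distr M (N \<Otimes>\<^sub>M borel) (\<lambda>\<omega>. (\<omega>, D \<omega>)))"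
      by (simp cong: sets_pair_measure_cong)
    fix A B assume A: "A \<in> sets N" and "B \<in> sets (distr M borel D)"
    then have B [measurable]: "B \<in> sets borel" by simp
    have AM: "A \<in> sets M" using A subalg[of p] by (auto simp: sN subalgebra_def)
    then have sub: "A \<subseteq> space M" by (rule sets.sets_into_space)
    have vi: "(\<lambda>\<omega>. (\<omega>, D \<omega>)) -` (A \<times> B) \<inter> space M = A \<inter> {\<omega>\<in>space M. D \<omega> \<in> B}"
      using sub by auto
    have "emeasure (distr M (N \<Otimes>\<^sub>M borel) (\<lambda>\<omega>. (\<omega>, D \<omega>))) (A \<times> B)
        = emeasure M (A \<inter> {\<omega>\<in>space M. D \<omega> \<in> B})"
      using A by (subst emeasure_distr) (auto simp: vi)
    also have "\<dots> = ennreal (measure M A * measure M {\<omega>\<in>space M. D \<omega> \<in> B})"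
      using A ind[of A B] by (simp add: sN emeasure_eq_measure)
    also have "\<dots> = emeasure N A * emeasure (distr M borel D) B"
      using A by (subst emeasure_distr)
        (auto simp: eN emeasure_eq_measure ennreal_mult vimage_def Int_def conj_commute)
    finally show "emeasure N A * emeasure (distr M borel D) B
      = emeasure (distr M (N \<Otimes>\<^sub>M borel) (\<lambda>\<omega>. (\<omega>, D \<omega>))) (A \<times> B)" by simp
  qed
  let ?g = "\<lambda>(\<omega>, w). Y \<omega> * \<phi> (\<xi> \<omega> + c *\<^sub>R w)"
  have g1: "\<bar>Y \<omega> * \<phi> z\<bar> \<le> 1" for \<omega> z
    using mult_mono[OF Y(2)[of \<omega>] \<phi>1[of z]] by (simp add: abs_mult)
  have "(\<lambda>\<omega>. (\<omega>, D \<omega>)) \<in> measurable M (N \<Otimes>\<^sub>M borel)"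
    by measurable
  from prob_space_distr[OF this] interpret PP: prob_space "N \<Otimes>\<^sub>M distr M borel D"
    unfolding eq .
  have ig: "integrable (N \<Otimes>\<^sub>M distr M borel D) ?g"
    by (rule PP.integrable_const_bound[of _ 1]) (use g1 in auto)
  have dD: "distr M borel D = distr std_gauss borel (\<lambda>y. sqrt (q - p) *\<^sub>R y)"
    using brownian pq gauss2_eq_distr_std_gauss[of "q - p"] unfolding brownian2_def D_def by auto
  have "(\<integral>\<omega>. Y \<omega> * \<phi> (\<xi> \<omega> + c *\<^sub>R D \<omega>) \<partial>M) = (\<integral>z. ?g z \<partial>(distr M (N \<Otimes>\<^sub>M borel) (\<lambda>\<omega>. (\<omega>, D \<omega>))))"
    by (subst integral_distr) auto
  also have "\<dots> = (\<integral>\<omega>. (\<integral>w. ?g (\<omega>, w) \<partial>distr M borel D) \<partial>N)"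
    unfolding eq[symmetric] by (rule P.integral_fst'[symmetric, OF ig])
  also have "\<dots> = (\<integral>\<omega>. Y \<omega> * gauss_avg (c * sqrt (q - p)) \<phi> (\<xi> \<omega>) \<partial>N)"
  proof (rule Bochner_Integration.integral_cong[OF refl])
    fix \<omega>
    have "(\<integral>w. ?g (\<omega>, w) \<partial>distr M borel D) = Y \<omega> * (\<integral>w. \<phi> (\<xi> \<omega> + c *\<^sub>R w) \<partial>distr M borel D)"
      by simp
    also have "(\<integral>w. \<phi> (\<xi> \<omega> + c *\<^sub>R w) \<partial>distr M borel D) = gauss_avg (c * sqrt (q - p)) \<phi> (\<xi> \<omega>)"
      unfolding dD gauss_avg_def by (subst integral_distr) auto
    finally show "(\<integral>w. ?g (\<omega>, w) \<partial>distr M borel D) = Y \<omega> * gauss_avg (c * sqrt (q - p)) \<phi> (\<xi> \<omega>)" .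
  qed
  also have "\<dots> = (\<integral>\<omega>. Y \<omega> * gauss_avg (c * sqrt (q - p)) \<phi> (\<xi> \<omega>) \<partial>M)"
    unfolding N_def by (rule integral_subalgebra2[OF subalg]) (use Y(1) \<xi> in measurable)
  finally show ?thesis by (simp add: D_def)
qed

text \<open>Both sides equal the expectation of Y * f (X p + c (W t - W p)). Averaging out the
  increment after p gives the left side, averaging out only the part after q gives the right side,
  so the semigroup law is never invoked.\<close>

lemma expectation_heat_step:
  fixes Y :: "'a \<Rightarrow> real"
  assumes pq: "0 \<le> p" "p < q" "q \<le> t" "t \<le> T"
    and Y: "Y \<in> borel_measurable (F p)" "\<And>\<omega>. \<bar>Y \<omega>\<bar> \<le> 1"
    and f [measurable]: "f \<in> borel_measurable borel" and f1: "\<And>x. \<bar>f x\<bar> \<le> 1"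
  shows "(\<integral>\<omega>. Y \<omega> * gauss_avg (c * sqrt (t - p)) f (X p \<omega>) \<partial>M)
       = (\<integral>\<omega>. Y \<omega> * gauss_avg (c * sqrt (t - q)) f (X p \<omega> + c *\<^sub>R (W q \<omega> - W p \<omega>)) \<partial>M)"
proof -
  have Xp: "X p \<in> borel_measurable (F p)" using pq by (intro X_adapted) auto
  have "(\<integral>\<omega>. Y \<omega> * gauss_avg (c * sqrt (t - p)) f (X p \<omega>) \<partial>M)
      = (\<integral>\<omega>. Y \<omega> * f (X p \<omega> + c *\<^sub>R (W t \<omega> - W p \<omega>)) \<partial>M)"
    by (rule expectation_increment[symmetric]) (use pq Y Xp f1 in auto)
  also have "\<dots> = (\<integral>\<omega>. Y \<omega> * gauss_avg (c * sqrt (t - q)) f (X p \<omega> + c *\<^sub>R (W q \<omega> - W p \<omega>)) \<partial>M)"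
  proof (cases "q = t")
    case False
    define \<xi> where "\<xi> \<omega> = X p \<omega> + c *\<^sub>R (W q \<omega> - W p \<omega>)" for \<omega>
    have [measurable]: "X p \<in> borel_measurable (F q)" "W p \<in> borel_measurable (F q)" "W q \<in> borel_measurable (F q)"
      using pq Xp W_adapted[of p] W_adapted[of q] by (auto intro: measurable_F_mono)
    have "\<xi> \<in> borel_measurable (F q)" unfolding \<xi>_def by measurable
    then have "(\<integral>\<omega>. Y \<omega> * f (\<xi> \<omega> + c *\<^sub>R (W t \<omega> - W q \<omega>)) \<partial>M)
      = (\<integral>\<omega>. Y \<omega> * gauss_avg (c * sqrt (t - q)) f (\<xi> \<omega>) \<partial>M)"
      by (intro expectation_increment) (use pq False Y f1 in \<open>auto intro: measurable_F_mono\<close>)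
    then show ?thesis by (simp add: \<xi>_def algebra_simps)
  qed simp
  finally show ?thesis .
qed

lemma drift_integrable:
  assumes "\<omega> \<in> space M"
  shows "integrable lborel (\<lambda>s. b s (X s \<omega>))"
proof (rule Bochner_Integration.integrable_bound[OF \<beta>_integrable])
  show "(\<lambda>s. b s (X s \<omega>)) \<in> borel_measurable lborel"
    using assms by measurable
  show "AE s in lborel. norm (b s (X s \<omega>)) \<le> norm (\<beta> s)"
    using b_bound by (auto intro!: AE_I2 order_trans[OF _ abs_ge_self])
qed

lemma sde_increment:
  assumes pq: "0 \<le> p" "p < q" "q \<le> T"
  shows "AE \<omega> in M. X q \<omega> = X p \<omega> + (\<integral>s\<in>{p<..q}. b s (X s \<omega>) \<partial>lborel) + c *\<^sub>R (W q \<omega> - W p \<omega>)"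
proof -
  have "AE \<omega> in M. X p \<omega> = X 0 \<omega> + (\<integral>s\<in>{0..p}. b s (X s \<omega>) \<partial>lborel) + c *\<^sub>R W p \<omega>"
    and "AE \<omega> in M. X q \<omega> = X 0 \<omega> + (\<integral>s\<in>{0..q}. b s (X s \<omega>) \<partial>lborel) + c *\<^sub>R W q \<omega>"
    using pq by (auto intro!: sde)
  then show ?thesis
    using AE_space
  proof eventually_elim
    case (elim \<omega>)
    have i: "set_integrable lborel A (\<lambda>s. b s (X s \<omega>))" if "A \<in> sets borel" for A
      unfolding set_integrable_def using drift_integrable[OF elim(3)] that
      by (intro integrable_mult_indicator) auto
    have "{0..p} \<union> {p<..q} = {0..q}" using pq by auto
    then have "(\<integral>s\<in>{0..q}. b s (X s \<omega>) \<partial>lborel)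
       = (\<integral>s\<in>{0..p}. b s (X s \<omega>) \<partial>lborel) + (\<integral>s\<in>{p<..q}. b s (X s \<omega>) \<partial>lborel)"
      using set_integral_Un[OF _ i[of "{0..p}"] i[of "{p<..q}"]] by (auto simp: ivl_disj_int)
    with elim(1,2) show ?case by (simp add: algebra_simps)
  qed
qed

end

context drift_sde
begin

lemma fubini_bounded:
  fixes h :: "real \<Rightarrow> 'a \<Rightarrow> real"
  assumes [measurable]: "(\<lambda>(r, \<omega>). h r \<omega>) \<in> borel_measurable (borel \<Otimes>\<^sub>M M)"
    and \<gamma>: "integrable lborel \<gamma>" and h: "\<And>r \<omega>. \<omega> \<in> space M \<Longrightarrow> \<bar>h r \<omega>\<bar> \<le> \<gamma> r"
  shows "integrable lborel (\<lambda>r. \<integral>\<omega>. h r \<omega> \<partial>M)"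
    and "(\<integral>\<omega>. (\<integral>r. h r \<omega> \<partial>lborel) \<partial>M) = (\<integral>r. (\<integral>\<omega>. h r \<omega> \<partial>M) \<partial>lborel)"
    and "integrable M (\<lambda>\<omega>. \<integral>r. h r \<omega> \<partial>lborel)"
proof -
  interpret P: pair_sigma_finite lborel M ..
  have hm [measurable]: "(\<lambda>(r, \<omega>). h r \<omega>) \<in> borel_measurable (lborel \<Otimes>\<^sub>M M)"
    by (simp cong: measurable_cong_sets sets_pair_measure_cong)
  have hr: "integrable M (h r)" for r
    by (rule integrable_const_bound[of _ "\<gamma> r"]) (use h in auto)
  have "integrable (lborel \<Otimes>\<^sub>M M) (\<lambda>(r, \<omega>). h r \<omega>)"
  proof (rule P.Fubini_integrable[OF hm])
    show "integrable lborel (\<lambda>r. \<integral>\<omega>. norm (case (r, \<omega>) of (r, \<omega>) \<Rightarrow> h r \<omega>) \<partial>M)"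
    proof (rule Bochner_Integration.integrable_bound[OF \<gamma>])
      show "AE r in lborel. norm (\<integral>\<omega>. norm (case (r, \<omega>) of (r, \<omega>) \<Rightarrow> h r \<omega>) \<partial>M) \<le> norm (\<gamma> r)"
      proof (rule AE_I2)
        fix r
        have "norm (\<integral>\<omega>. norm (h r \<omega>) \<partial>M) \<le> (\<integral>\<omega>. \<gamma> r \<partial>M)"
          by (rule norm_integral_le_integral) (use h in auto)
        then show "norm (\<integral>\<omega>. norm (case (r, \<omega>) of (r, \<omega>) \<Rightarrow> h r \<omega>) \<partial>M) \<le> norm (\<gamma> r)"
          by (simp add: prob_space)
      qed
    qed simp
    show "AE r in lborel. integrable M (\<lambda>\<omega>. case (r, \<omega>) of (r, \<omega>) \<Rightarrow> h r \<omega>)"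
      using hr by simp
  qed
  then show "integrable lborel (\<lambda>r. \<integral>\<omega>. h r \<omega> \<partial>M)"
    and "(\<integral>\<omega>. (\<integral>r. h r \<omega> \<partial>lborel) \<partial>M) = (\<integral>r. (\<integral>\<omega>. h r \<omega> \<partial>M) \<partial>lborel)"
    and "integrable M (\<lambda>\<omega>. \<integral>r. h r \<omega> \<partial>lborel)"
    using P.integrable_fst[of h] P.integrable_snd[of h] P.Fubini_integral[of h] by auto
qed

end

lemma indicator_Ioc_tendsto:
  fixes u :: "nat \<Rightarrow> real"
  assumes "u \<longlonglongrightarrow> q" "r \<noteq> q"
  shows "(\<lambda>n. indicator {s<..u n} r :: real) \<longlonglongrightarrow> indicator {s<..q} r"
proof (rule tendsto_eventually)
  show "\<forall>\<^sub>F n in sequentially. indicator {s<..u n} r = (indicator {s<..q} r :: real)"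
  proof (cases "r < q")
    case True
    then show ?thesis
      using order_tendstoD(1)[OF assms(1) True] by (auto elim!: eventually_mono simp: indicator_def)
  next
    case False
    then have "q < r" using assms(2) by simp
    from order_tendstoD(2)[OF assms(1) this] show ?thesis
      using \<open>q < r\<close> by (auto elim!: eventually_mono simp: indicator_def)
  qed
qed

lemma continuous_on_indefinite_lebesgue:
  fixes g :: "real \<Rightarrow> real"
  assumes g: "integrable lborel g"
  shows "continuous_on S (\<lambda>q. \<integral>r\<in>{s<..q}. g r \<partial>lborel)"
proof (rule continuous_on_sequentiallyI)
  fix u :: "nat \<Rightarrow> real" and q assume u: "u \<longlonglongrightarrow> q"
  have [measurable]: "g \<in> borel_measurable borel" using borel_measurable_integrable[OF g] by simp
  show "(\<lambda>n. \<integral>r\<in>{s<..u n}. g r \<partial>lborel) \<longlonglongrightarrow> (\<integral>r\<in>{s<..q}. g r \<partial>lborel)"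
    unfolding set_lebesgue_integral_def
  proof (rule integral_dominated_convergence)
    show "integrable lborel (\<lambda>r. norm (g r))" using g by simp
    show "AE r in lborel. (\<lambda>n. indicator {s<..u n} r *\<^sub>R g r) \<longlonglongrightarrow> indicator {s<..q} r *\<^sub>R g r"
      using AE_lborel_singleton[of q]
      by eventually_elim (intro tendsto_scaleR tendsto_const indicator_Ioc_tendsto[OF u])
    show "\<And>n. AE r in lborel. norm (indicator {s<..u n} r *\<^sub>R g r) \<le> norm (g r)"
      by (intro AE_I2) (simp add: indicator_def)
  qed auto
qed

section \<open>The Duhamel formula for a fixed time interval, weight and test function\<close>

context drift_sde
begin

context
  fixes s t :: real and Y :: "'a \<Rightarrow> real" and f :: "real^2 \<Rightarrow> real" and f' :: "real^2 \<Rightarrow> real^2" and L :: real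
  assumes st: "0 \<le> s" "s < t" "t \<le> T"
    and Y: "Y \<in> borel_measurable (F s)" "\<And>\<omega>. \<bar>Y \<omega>\<bar> \<le> 1"
    and f: "C11_test f f' L"
begin

text \<open>The heat flow run backwards from f at time t, with variance c^2 * (t - r). For r > t the
  real \<open>sqrt\<close> is negative and the average still makes sense, so continuity holds in r
  without restriction.\<close>

definition heat :: "real \<Rightarrow> real^2 \<Rightarrow> real" where
  "heat r x = gauss_avg (c * sqrt (t - r)) f x"

definition heat_grad :: "real \<Rightarrow> real^2 \<Rightarrow> real^2" where
  "heat_grad r x = gauss_avg (c * sqrt (t - r)) f' x"

lemma heat_facts:
  shows heat_le_1: "\<bar>heat r x\<bar> \<le> 1"
    and heat_grad_le_L: "norm (heat_grad r x) \<le> L"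
    and heat_taylor: "\<bar>heat r (x + v) - heat r x - v \<bullet> heat_grad r x\<bar> \<le> L * (norm v)^2"
    and heat_grad_cont: "continuous_on UNIV (\<lambda>p. heat_grad (fst p) (snd p))"
    and heat_measurable [measurable]: "heat r \<in> borel_measurable borel"
proof -
  note C = C11_testD[OF f]
  show "\<bar>heat r x\<bar> \<le> 1"
    using gauss_avg_bound[OF C(7), of 1] C(3) by (simp add: heat_def)
  show "norm (heat_grad r x) \<le> L"
    using gauss_avg_bound[OF C(8), of L] C(4) by (simp add: heat_grad_def)
  show "\<bar>heat r (x + v) - heat r x - v \<bullet> heat_grad r x\<bar> \<le> L * (norm v)^2"
    unfolding heat_def heat_grad_def by (rule gauss_avg_taylor[OF f])
  have "continuous_on UNIV (\<lambda>p. (c * sqrt (t - fst p), snd p :: real^2))"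
    by (intro continuous_intros)
  from continuous_on_compose2[OF continuous_gauss_avg[OF C(2,4)] this]
  show "continuous_on UNIV (\<lambda>p. heat_grad (fst p) (snd p))"
    by (simp add: heat_grad_def)
  show "heat r \<in> borel_measurable borel"
    unfolding heat_def using C(7) by measurable
qed

lemma heat_grad_measurable2 [measurable (raw)]:
  assumes [measurable]: "g \<in> borel_measurable N" "h \<in> borel_measurable N"
  shows "(\<lambda>x. heat_grad (g x) (h x)) \<in> borel_measurable N"
proof -
  have "(\<lambda>p. heat_grad (fst p) (snd p)) \<in> borel_measurable borel"
    by (rule borel_measurable_continuous_onI[OF heat_grad_cont])
  from measurable_compose[OF borel_measurable_Pair[OF assms] this] show ?thesis by simp
qed

lemma Y_measurable [measurable]: "Y \<in> borel_measurable M"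
  using Y(1) by (rule measurable_F_M)

lemma L_nonneg: "0 \<le> L"
  using C11_testD(6)[OF f] .

text \<open>The mean error made by freezing the gradient along the path at the other end of a time
  step.\<close>

definition grad_dist :: "real \<Rightarrow> real \<Rightarrow> real" where
  "grad_dist p q = (\<integral>\<omega>. norm (heat_grad q (X q \<omega>) - heat_grad p (X p \<omega>)) \<partial>M)"

text \<open>Path continuity and dominated convergence make \<open>grad_dist\<close> continuous on a
  compact square, and it vanishes on the diagonal. Uniform continuity then provides one step size
  for the whole interval.\<close>

lemma grad_dist_small:
  assumes "\<epsilon> > 0"
  shows "\<exists>\<delta>>0. \<forall>p\<in>{s..t}. \<forall>q\<in>{s..t}. \<bar>q - p\<bar> < \<delta> \<longrightarrow> grad_dist p q < \<epsilon>"
proof -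
  let ?K = "{s..t} \<times> {s..t}"
  have "continuous_on ?K (\<lambda>z. grad_dist (fst z) (snd z))"
  proof (rule continuous_on_sequentiallyI)
    fix u :: "nat \<Rightarrow> real \<times> real" and z
    assume uK: "\<forall>n. u n \<in> ?K" and zK: "z \<in> ?K" and u: "u \<longlonglongrightarrow> z"
    \<comment> \<open>A single null set, the one of discontinuous paths, serves all sequences and
      limits at once.\<close>
    have cont: "AE \<omega> in M. \<forall>v r. (\<forall>n. v n \<in> {s..t}) \<longrightarrow> r \<in> {s..t} \<longrightarrow> v \<longlonglongrightarrow> r \<longrightarrow>
        (\<lambda>n. heat_grad (v n) (X (v n) \<omega>)) \<longlonglongrightarrow> heat_grad r (X r \<omega>)"
      using X_cont
    proof eventually_elim
      case (elim \<omega>)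
      show ?case
      proof (intro allI impI)
        fix v :: "nat \<Rightarrow> real" and r assume v: "\<forall>n. v n \<in> {s..t}" "r \<in> {s..t}" "v \<longlonglongrightarrow> r"
        have "(\<lambda>n. X (v n) \<omega>) \<longlonglongrightarrow> X r \<omega>"
          by (rule continuous_on_tendsto_compose[OF elim v(3)])
             (use v st in \<open>auto intro!: always_eventually order_trans[OF st(1)] order_trans[OF _ st(3)]\<close>)
        from tendsto_Pair[OF v(3) this]
        have "(\<lambda>n. heat_grad (fst (v n, X (v n) \<omega>)) (snd (v n, X (v n) \<omega>)))
            \<longlonglongrightarrow> heat_grad (fst (r, X r \<omega>)) (snd (r, X r \<omega>))"
          by (rule continuous_on_tendsto_compose[OF heat_grad_cont]) auto
        then show "(\<lambda>n. heat_grad (v n) (X (v n) \<omega>)) \<longlonglongrightarrow> heat_grad r (X r \<omega>)" by simp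
      qed
    qed
    show "(\<lambda>n. grad_dist (fst (u n)) (snd (u n))) \<longlonglongrightarrow> grad_dist (fst z) (snd z)"
      unfolding grad_dist_def
    proof (rule integral_dominated_convergence[where w="\<lambda>_. 2 * L"])
      show "AE \<omega> in M. (\<lambda>n. norm (heat_grad (snd (u n)) (X (snd (u n)) \<omega>) - heat_grad (fst (u n)) (X (fst (u n)) \<omega>)))
         \<longlonglongrightarrow> norm (heat_grad (snd z) (X (snd z) \<omega>) - heat_grad (fst z) (X (fst z) \<omega>))"
        using cont
      proof eventually_elim
        case (elim \<omega>)
        have "(\<lambda>n. fst (u n)) \<longlonglongrightarrow> fst z" "(\<lambda>n. snd (u n)) \<longlonglongrightarrow> snd z"
          using u by (auto intro: tendsto_intros)
        moreover have "\<forall>n. fst (u n) \<in> {s..t}" "\<forall>n. snd (u n) \<in> {s..t}" "fst z \<in> {s..t}" "snd z \<in> {s..t}"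
          using uK zK by (auto simp: mem_Times_iff)
        ultimately show ?case
          using elim[rule_format, of "\<lambda>n. fst (u n)" "fst z"] elim[rule_format, of "\<lambda>n. snd (u n)" "snd z"]
          by (intro tendsto_norm tendsto_diff) blast+
      qed
      show "AE \<omega> in M. norm (norm (heat_grad (snd (u n)) (X (snd (u n)) \<omega>) - heat_grad (fst (u n)) (X (fst (u n)) \<omega>))) \<le> 2 * L" for n
      proof (rule AE_I2)
        fix \<omega>
        show "norm (norm (heat_grad (snd (u n)) (X (snd (u n)) \<omega>) - heat_grad (fst (u n)) (X (fst (u n)) \<omega>))) \<le> 2 * L"
          using norm_triangle_ineq4[of "heat_grad (snd (u n)) (X (snd (u n)) \<omega>)" "heat_grad (fst (u n)) (X (fst (u n)) \<omega>)"]
            heat_grad_le_L[of "snd (u n)" "X (snd (u n)) \<omega>"] heat_grad_le_L[of "fst (u n)" "X (fst (u n)) \<omega>"]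
          by simp
      qed
    qed auto
  qed
  then have "uniformly_continuous_on ?K (\<lambda>z. grad_dist (fst z) (snd z))"
    by (intro compact_uniformly_continuous compact_Times compact_Icc)
  from this[unfolded uniformly_continuous_on_def, rule_format, OF assms]
  obtain \<delta> where \<delta>: "\<delta> > 0" "\<And>z z'. z \<in> ?K \<Longrightarrow> z' \<in> ?K \<Longrightarrow> dist z' z < \<delta> \<Longrightarrow>
      dist (grad_dist (fst z') (snd z')) (grad_dist (fst z) (snd z)) < \<epsilon>"
    by blast
  have "grad_dist p q < \<epsilon>" if "p \<in> {s..t}" "q \<in> {s..t}" "\<bar>q - p\<bar> < \<delta>" for p q
  proof -
    have "dist (p, q) (p, p) < \<delta>" using that by (simp add: dist_Pair_Pair dist_real_def)
    from \<delta>(2)[OF _ _ this] that have "dist (grad_dist p q) (grad_dist p p) < \<epsilon>" by auto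
    then show ?thesis by (simp add: grad_dist_def dist_real_def)
  qed
  with \<delta>(1) show ?thesis by blast
qed

definition drift_term :: "real \<Rightarrow> real" where
  "drift_term r = (\<integral>\<omega>. Y \<omega> * (b r (X r \<omega>) \<bullet> heat_grad r (X r \<omega>)) \<partial>M)"

lemma drift_inner_bound:
  assumes "norm z \<le> K"
  shows "\<bar>Y \<omega> * (b r x \<bullet> z)\<bar> \<le> \<beta> r * K"
proof -
  have "\<bar>b r x \<bullet> z\<bar> \<le> norm (b r x) * norm z" by (rule Cauchy_Schwarz_ineq2)
  also have "\<dots> \<le> \<beta> r * K" using b_bound assms \<beta>_nonneg by (intro mult_mono) auto
  finally show ?thesis
    using mult_mono[OF Y(2)[of \<omega>], of "\<bar>b r x \<bullet> z\<bar>" "\<beta> r * K"] by (simp add: abs_mult)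
qed

lemma drift_term_integrable: "integrable lborel drift_term"
  unfolding drift_term_def
  by (rule fubini_bounded(1)[where \<gamma>="\<lambda>r. \<beta> r * L"])
     (use \<beta>_integrable drift_inner_bound[OF heat_grad_le_L] in auto)

text \<open>
  The expansion is taken at the end point \<open>X q\<close>: removing the drift from \<open>X q\<close> leaves
  \<open>X p\<close> plus the Brownian increment, whose contribution is exactly the heat flow.
\<close>

lemma taylor_step:
  assumes pq: "s \<le> p" "p < q" "q \<le> t"
  shows "\<bar>(\<integral>\<omega>. Y \<omega> * heat q (X q \<omega>) \<partial>M) - (\<integral>\<omega>. Y \<omega> * heat p (X p \<omega>) \<partial>M)
     - (\<integral>r\<in>{p<..q}. (\<integral>\<omega>. Y \<omega> * (b r (X r \<omega>) \<bullet> heat_grad q (X q \<omega>)) \<partial>M) \<partial>lborel)\<bar>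
    \<le> L * (\<integral>r\<in>{p<..q}. \<beta> r \<partial>lborel)^2"
proof -
  let ?V = "\<integral>r\<in>{p<..q}. \<beta> r \<partial>lborel"
  \<comment> \<open>The drift accumulated over the step. It is bounded by the deterministic
    \<open>?V\<close>, so the Taylor remainder is quadratic in \<open>?V\<close> and needs no
    moments of the Brownian increment.\<close>
  define B where "B \<omega> = (\<integral>r\<in>{p<..q}. b r (X r \<omega>) \<partial>lborel)" for \<omega>
  have pT: "0 \<le> p" "q \<le> T" using pq st by auto
  have [measurable]: "W q \<in> borel_measurable M" "W p \<in> borel_measurable M"
    using W_adapted pq pT by (auto intro: measurable_F_M[of _ q] measurable_F_M[of _ p])
  have B_meas [measurable]: "B \<in> borel_measurable M"
    unfolding B_def set_lebesgue_integral_def by measurable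
  have B_bound: "norm (B \<omega>) \<le> ?V" if "\<omega> \<in> space M" for \<omega>
    unfolding B_def set_lebesgue_integral_def
  proof (rule norm_integral_le_integral)
    show "(\<lambda>r. indicator {p<..q} r *\<^sub>R b r (X r \<omega>)) \<in> borel_measurable lborel"
      using that by measurable
    show "integrable lborel (\<lambda>r. indicator {p<..q} r *\<^sub>R \<beta> r)"
      using \<beta>_integrable by (intro integrable_mult_indicator) auto
  qed (use b_bound in \<open>auto simp: indicator_def\<close>)
  have Yint: "integrable M (\<lambda>\<omega>. Y \<omega> * heat r (h \<omega>))" if [measurable]: "h \<in> borel_measurable M" for r h
    by (rule integrable_const_bound[of _ 1])
       (use mult_mono[OF Y(2) heat_le_1] in \<open>auto simp: abs_mult\<close>)
  have sde': "AE \<omega> in M. X q \<omega> - B \<omega> = X p \<omega> + c *\<^sub>R (W q \<omega> - W p \<omega>)"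
    using sde_increment[OF pT(1) pq(2) pT(2)] by eventually_elim (simp add: B_def)
  have "(\<integral>\<omega>. Y \<omega> * heat p (X p \<omega>) \<partial>M)
      = (\<integral>\<omega>. Y \<omega> * heat q (X p \<omega> + c *\<^sub>R (W q \<omega> - W p \<omega>)) \<partial>M)"
    unfolding heat_def
    by (rule expectation_heat_step)
       (use pq pT st Y C11_testD(3,7)[OF f] in \<open>auto intro: measurable_F_mono\<close>)
  also have "\<dots> = (\<integral>\<omega>. Y \<omega> * heat q (X q \<omega> - B \<omega>) \<partial>M)"
    by (rule integral_cong_AE) (use sde' in auto)
  finally have 1: "(\<integral>\<omega>. Y \<omega> * heat q (X q \<omega>) \<partial>M) - (\<integral>\<omega>. Y \<omega> * heat p (X p \<omega>) \<partial>M)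
      = (\<integral>\<omega>. Y \<omega> * (heat q (X q \<omega>) - heat q (X q \<omega> - B \<omega>)) \<partial>M)"
    by (simp add: Yint right_diff_distrib)
  let ?h = "\<lambda>r \<omega>. indicator {p<..q} r * (Y \<omega> * (b r (X r \<omega>) \<bullet> heat_grad q (X q \<omega>)))"
  have hm: "(\<lambda>(r, \<omega>). ?h r \<omega>) \<in> borel_measurable (borel \<Otimes>\<^sub>M M)"
    by measurable
  have hb: "\<bar>?h r \<omega>\<bar> \<le> \<beta> r * L" for r \<omega>
    using drift_inner_bound[OF heat_grad_le_L] \<beta>_nonneg L_nonneg by (auto simp: indicator_def)
  have \<beta>L: "integrable lborel (\<lambda>r. \<beta> r * L)" using \<beta>_integrable by simp
  note fub = fubini_bounded[of ?h "\<lambda>r. \<beta> r * L", OF hm \<beta>L hb]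
  have hB: "(\<integral>r. ?h r \<omega> \<partial>lborel) = Y \<omega> * (B \<omega> \<bullet> heat_grad q (X q \<omega>))" if "\<omega> \<in> space M" for \<omega>
  proof -
    have i: "integrable lborel (\<lambda>r. indicator {p<..q} r *\<^sub>R b r (X r \<omega>))"
      using drift_integrable[OF that] by (intro integrable_mult_indicator) auto
    have "(\<integral>r. ?h r \<omega> \<partial>lborel)
       = (\<integral>r. Y \<omega> * ((indicator {p<..q} r *\<^sub>R b r (X r \<omega>)) \<bullet> heat_grad q (X q \<omega>)) \<partial>lborel)"
      by (simp add: mult_ac)
    also have "\<dots> = Y \<omega> * (B \<omega> \<bullet> heat_grad q (X q \<omega>))"
      unfolding B_def set_lebesgue_integral_def integral_mult_right_zero
      using integral_inner_left[OF i, of "heat_grad q (X q \<omega>)"] by simp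
    finally show ?thesis .
  qed
  have 2: "(\<integral>r\<in>{p<..q}. (\<integral>\<omega>. Y \<omega> * (b r (X r \<omega>) \<bullet> heat_grad q (X q \<omega>)) \<partial>M) \<partial>lborel)
      = (\<integral>\<omega>. Y \<omega> * (B \<omega> \<bullet> heat_grad q (X q \<omega>)) \<partial>M)"
  proof -
    have "(\<integral>\<omega>. Y \<omega> * (B \<omega> \<bullet> heat_grad q (X q \<omega>)) \<partial>M) = (\<integral>\<omega>. (\<integral>r. ?h r \<omega> \<partial>lborel) \<partial>M)"
      by (rule Bochner_Integration.integral_cong[OF refl]) (simp add: hB)
    also have "\<dots> = (\<integral>r. (\<integral>\<omega>. ?h r \<omega> \<partial>M) \<partial>lborel)" by (rule fub(2))
    finally show ?thesis by (simp add: set_lebesgue_integral_def)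
  qed
  have i2: "integrable M (\<lambda>\<omega>. Y \<omega> * (B \<omega> \<bullet> heat_grad q (X q \<omega>)))"
    using fub(3) by (rule Bochner_Integration.integrable_cong[OF refl, THEN iffD1, rotated]) (simp add: hB)
  have i1: "integrable M (\<lambda>\<omega>. Y \<omega> * (heat q (X q \<omega>) - heat q (X q \<omega> - B \<omega>)))"
    by (simp add: Yint right_diff_distrib)
  have "norm (\<integral>\<omega>. Y \<omega> * (heat q (X q \<omega>) - heat q (X q \<omega> - B \<omega>)) - Y \<omega> * (B \<omega> \<bullet> heat_grad q (X q \<omega>)) \<partial>M)
      \<le> (\<integral>\<omega>. L * ?V^2 \<partial>M)"
  proof (rule norm_integral_le_integral)
    fix \<omega> assume \<omega>: "\<omega> \<in> space M"
    let ?d = "heat q (X q \<omega>) - heat q (X q \<omega> - B \<omega>) - B \<omega> \<bullet> heat_grad q (X q \<omega>)"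
    have "\<bar>?d\<bar> \<le> L * (norm (B \<omega>))^2"
      using heat_taylor[of q "X q \<omega>" "- B \<omega>"] by simp
    also have "\<dots> \<le> L * ?V^2"
      using B_bound[OF \<omega>] L_nonneg by (intro mult_left_mono power_mono) auto
    finally have d: "\<bar>?d\<bar> \<le> L * ?V^2" .
    have "Y \<omega> * (heat q (X q \<omega>) - heat q (X q \<omega> - B \<omega>)) - Y \<omega> * (B \<omega> \<bullet> heat_grad q (X q \<omega>)) = Y \<omega> * ?d"
      by (simp add: algebra_simps)
    then show "norm (Y \<omega> * (heat q (X q \<omega>) - heat q (X q \<omega> - B \<omega>)) - Y \<omega> * (B \<omega> \<bullet> heat_grad q (X q \<omega>))) \<le> L * ?V^2"
      using mult_mono[OF Y(2)[of \<omega>] d] by (simp add: abs_mult)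
  qed auto
  then show ?thesis
    unfolding 1 2 using i1 i2 by (simp add: prob_space)
qed

text \<open>Replaces the gradient frozen at q by the running one. The drift is bounded by the
  deterministic \<beta> r, which leaves the expectation, and what remains is exactly
  \<open>grad_dist r q\<close>.\<close>

lemma drift_replace:
  assumes pq: "s \<le> p" "p < q" "q \<le> t" and \<epsilon>: "\<And>r. r \<in> {p<..q} \<Longrightarrow> grad_dist r q \<le> \<epsilon>"
  shows "\<bar>(\<integral>r\<in>{p<..q}. (\<integral>\<omega>. Y \<omega> * (b r (X r \<omega>) \<bullet> heat_grad q (X q \<omega>)) \<partial>M) \<partial>lborel)
     - (\<integral>r\<in>{p<..q}. drift_term r \<partial>lborel)\<bar> \<le> \<epsilon> * (\<integral>r\<in>{p<..q}. \<beta> r \<partial>lborel)"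
proof -
  let ?e = "\<lambda>r. \<integral>\<omega>. Y \<omega> * (b r (X r \<omega>) \<bullet> heat_grad q (X q \<omega>)) \<partial>M"
  have ie: "integrable lborel ?e"
    by (rule fubini_bounded(1)[where \<gamma>="\<lambda>r. \<beta> r * L"])
       (use \<beta>_integrable drift_inner_bound[OF heat_grad_le_L] in auto)
  have iY: "integrable M (\<lambda>\<omega>. Y \<omega> * (b r (X r \<omega>) \<bullet> heat_grad q' (X q' \<omega>)))" for r q'
    by (rule integrable_const_bound[of _ "\<beta> r * L"])
       (use drift_inner_bound[OF heat_grad_le_L] in auto)
  have si: "set_integrable lborel {p<..q} g" if "integrable lborel g" for g :: "real \<Rightarrow> real"
    unfolding set_integrable_def using that by (intro integrable_mult_indicator) auto
  have "(\<integral>r\<in>{p<..q}. ?e r \<partial>lborel) - (\<integral>r\<in>{p<..q}. drift_term r \<partial>lborel)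
      = (\<integral>r\<in>{p<..q}. ?e r - drift_term r \<partial>lborel)"
    by (rule set_integral_diff(2)[symmetric]) (intro si ie drift_term_integrable)+
  also have "norm \<dots> \<le> (\<integral>r. indicator {p<..q} r *\<^sub>R (\<epsilon> * \<beta> r) \<partial>lborel)"
    unfolding set_lebesgue_integral_def
  proof (rule norm_integral_le_integral)
    show "(\<lambda>r. indicator {p<..q} r *\<^sub>R (?e r - drift_term r)) \<in> borel_measurable lborel"
      using borel_measurable_integrable[OF ie] borel_measurable_integrable[OF drift_term_integrable]
      by measurable
    show "integrable lborel (\<lambda>r. indicator {p<..q} r *\<^sub>R (\<epsilon> * \<beta> r))"
      using \<beta>_integrable by (intro integrable_mult_indicator) auto
    fix r
    have "norm (?e r - drift_term r) \<le> \<epsilon> * \<beta> r" if r: "r \<in> {p<..q}"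
    proof -
      have "?e r - drift_term r
          = (\<integral>\<omega>. Y \<omega> * (b r (X r \<omega>) \<bullet> (heat_grad q (X q \<omega>) - heat_grad r (X r \<omega>))) \<partial>M)"
        unfolding drift_term_def using iY by (simp add: inner_diff_right right_diff_distrib)
      also have "norm \<dots> \<le> (\<integral>\<omega>. \<beta> r * norm (heat_grad q (X q \<omega>) - heat_grad r (X r \<omega>)) \<partial>M)"
      proof (rule norm_integral_le_integral)
        show "integrable M (\<lambda>\<omega>. \<beta> r * norm (heat_grad q (X q \<omega>) - heat_grad r (X r \<omega>)))"
          by (intro integrable_mult_right integrable_norm Bochner_Integration.integrable_diff
                integrable_const_bound[of _ L]) (use heat_grad_le_L in auto)
      qed (use drift_inner_bound[OF order_refl] in auto)
      also have "\<dots> = \<beta> r * grad_dist r q" by (simp add: grad_dist_def)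
      also have "\<dots> \<le> \<epsilon> * \<beta> r"
        using mult_right_mono[OF \<epsilon>[OF r] \<beta>_nonneg[of r]] by (simp add: mult.commute)
      finally show ?thesis .
    qed
    then show "norm (indicator {p<..q} r *\<^sub>R (?e r - drift_term r)) \<le> indicator {p<..q} r *\<^sub>R (\<epsilon> * \<beta> r)"
      by (simp add: indicator_def)
  qed
  also have "\<dots> = \<epsilon> * (\<integral>r\<in>{p<..q}. \<beta> r \<partial>lborel)"
    unfolding set_lebesgue_integral_def by (subst integral_mult_right_zero[symmetric]) (simp add: mult_ac)
  finally show ?thesis by simp
qed

text \<open>Let v be the integral of \<beta> over a short step. The increment of \<open>G\<close> is
  at most the Taylor error L * v^2 plus the freezing error \<epsilon> / 2 * v. As \<open>V\<close>
  is continuous, short steps have L * v \<le> \<epsilon> / 2, so the increment is at most \<epsilon>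
  * v and \<open>G\<close> is constant.\<close>

lemma duhamel:
  "(\<integral>\<omega>. Y \<omega> * f (X t \<omega>) \<partial>M) = (\<integral>\<omega>. Y \<omega> * heat s (X s \<omega>) \<partial>M) + (\<integral>r\<in>{s<..t}. drift_term r \<partial>lborel)"
proof -
  define a where "a q = (\<integral>\<omega>. Y \<omega> * heat q (X q \<omega>) \<partial>M)" for q
  define G where "G q = a q - (\<integral>r\<in>{s<..q}. drift_term r \<partial>lborel)" for q
  define V where "V q = (\<integral>r\<in>{s<..q}. \<beta> r \<partial>lborel)" for q
  have split: "(\<integral>r\<in>{s<..q}. g r \<partial>lborel) - (\<integral>r\<in>{s<..p}. g r \<partial>lborel) = (\<integral>r\<in>{p<..q}. g r \<partial>lborel)"
    if g: "integrable lborel g" and pq: "s \<le> p" "p < q" for g :: "real \<Rightarrow> real" and p q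
  proof -
    have "{s<..p} \<union> {p<..q} = {s<..q}" "{s<..p} \<inter> {p<..q} = {}" using pq by auto
    moreover have "set_integrable lborel A g" if "A \<in> sets borel" for A
      unfolding set_integrable_def using g that by (intro integrable_mult_indicator) auto
    ultimately show ?thesis
      using set_integral_Un[of "{s<..p}" "{p<..q}" lborel g] by auto
  qed
  have "G t = G s"
  proof (rule small_increments_imp_eq[where V=V, OF st(2)])
    fix \<epsilon> :: real assume \<epsilon>: "\<epsilon> > 0"
    obtain \<delta>1 where \<delta>1: "\<delta>1 > 0"
      "\<And>p q. p \<in> {s..t} \<Longrightarrow> q \<in> {s..t} \<Longrightarrow> \<bar>q - p\<bar> < \<delta>1 \<Longrightarrow> grad_dist p q < \<epsilon> / 2"
      using grad_dist_small[of "\<epsilon> / 2"] \<epsilon> by (meson half_gt_zero)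
    have "uniformly_continuous_on {s..t} V"
      unfolding V_def
      by (intro compact_uniformly_continuous continuous_on_indefinite_lebesgue \<beta>_integrable compact_Icc)
    \<comment> \<open>L + 1 in place of L keeps the denominator positive.\<close>
    moreover have e2: "\<epsilon> / (2 * (L + 1)) > 0" using \<epsilon> L_nonneg by simp
    ultimately obtain \<delta>2 where \<delta>2: "\<delta>2 > 0"
      "\<And>p q. p \<in> {s..t} \<Longrightarrow> q \<in> {s..t} \<Longrightarrow> dist q p < \<delta>2 \<Longrightarrow> dist (V q) (V p) < \<epsilon> / (2 * (L + 1))"
      unfolding uniformly_continuous_on_def by blast
    show "\<exists>\<delta>>0. \<forall>p q. s \<le> p \<and> p < q \<and> q \<le> t \<and> q - p < \<delta> \<longrightarrow> \<bar>G q - G p\<bar> \<le> \<epsilon> * (V q - V p)"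
    proof (intro exI[of _ "min \<delta>1 \<delta>2"] conjI allI impI)
      show "0 < min \<delta>1 \<delta>2" using \<delta>1 \<delta>2 by simp
      fix p q assume H: "s \<le> p \<and> p < q \<and> q \<le> t \<and> q - p < min \<delta>1 \<delta>2"
      then have pq: "s \<le> p" "p < q" "q \<le> t" by auto
      let ?v = "\<integral>r\<in>{p<..q}. \<beta> r \<partial>lborel"
      let ?e = "\<integral>r\<in>{p<..q}. (\<integral>\<omega>. Y \<omega> * (b r (X r \<omega>) \<bullet> heat_grad q (X q \<omega>)) \<partial>M) \<partial>lborel"
      have V: "V q - V p = ?v"
        unfolding V_def by (rule split[OF \<beta>_integrable pq(1,2)])
      have v0: "0 \<le> ?v"
        unfolding set_lebesgue_integral_def using \<beta>_nonneg by (intro integral_nonneg_AE AE_I2) simp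
      have vs: "L * ?v \<le> \<epsilon> / 2"
      proof -
        have "dist (V q) (V p) < \<epsilon> / (2 * (L + 1))"
          by (rule \<delta>2(2)) (use H in \<open>auto simp: dist_real_def\<close>)
        then have "?v \<le> \<epsilon> / (2 * (L + 1))" using V by (simp add: dist_real_def)
        then have "(L + 1) * ?v \<le> (L + 1) * (\<epsilon> / (2 * (L + 1)))"
          using L_nonneg by (intro mult_left_mono) auto
        also have "\<dots> = \<epsilon> / 2" using L_nonneg by (simp add: field_simps)
        finally show ?thesis using v0 by (simp add: algebra_simps)
      qed
      have "G q - G p = a q - a p - (\<integral>r\<in>{p<..q}. drift_term r \<partial>lborel)"
        using split[OF drift_term_integrable pq(1,2)] by (simp add: G_def)
      then have "\<bar>G q - G p\<bar> \<le> \<bar>a q - a p - ?e\<bar> + \<bar>?e - (\<integral>r\<in>{p<..q}. drift_term r \<partial>lborel)\<bar>"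
        by linarith
      also have "\<dots> \<le> L * ?v^2 + \<epsilon> / 2 * ?v"
      proof (rule add_mono)
        show "\<bar>a q - a p - ?e\<bar> \<le> L * ?v^2"
          unfolding a_def by (rule taylor_step[OF pq])
        show "\<bar>?e - (\<integral>r\<in>{p<..q}. drift_term r \<partial>lborel)\<bar> \<le> \<epsilon> / 2 * ?v"
        proof (rule drift_replace[OF pq])
          fix r assume "r \<in> {p<..q}"
          then show "grad_dist r q \<le> \<epsilon> / 2"
            using H by (intro less_imp_le \<delta>1(2)) auto
        qed
      qed
      also have "L * ?v^2 \<le> \<epsilon> / 2 * ?v"
        using mult_right_mono[OF vs v0] by (simp add: power2_eq_square mult.assoc)
      also have "\<epsilon> / 2 * ?v + \<epsilon> / 2 * ?v = \<epsilon> * (V q - V p)" using V by simp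
      finally show "\<bar>G q - G p\<bar> \<le> \<epsilon> * (V q - V p)" by simp
    qed
  qed
  moreover have "G s = a s" by (simp add: G_def set_lebesgue_integral_def)
  moreover have "a t = (\<integral>\<omega>. Y \<omega> * f (X t \<omega>) \<partial>M)" by (simp add: a_def heat_def)
  ultimately show ?thesis by (simp add: G_def a_def)
qed

end

end

section \<open>Contraction in total variation\<close>

text \<open>A Hoelder estimate with exponents 4 and 4/3 in the form of Young's inequality with a
  free scale. The fourth power is integrated over the whole line, so \<delta> depends neither on s
  nor on t.\<close>

lemma singular_integral_small:
  fixes \<gamma> :: "real \<Rightarrow> real"
  assumes [measurable]: "\<gamma> \<in> borel_measurable borel" and \<gamma>0: "\<And>r. 0 \<le> \<gamma> r"
    and \<gamma>4: "integrable lborel (\<lambda>r. \<gamma> r ^ 4)" and \<kappa>: "\<kappa> > 0"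
  shows "\<exists>\<delta>>0. \<forall>s t. s < t \<and> t - s \<le> \<delta> \<longrightarrow>
    (\<integral>\<^sup>+r. ennreal (\<gamma> r / sqrt (t - r)) * indicator {s<..t} r \<partial>lborel) \<le> ennreal \<kappa>"
proof -
  define I where "I = (\<integral>r. \<gamma> r ^ 4 \<partial>lborel)"
  have I0: "0 \<le> I" unfolding I_def by (intro integral_nonneg_AE AE_I2) simp
  \<comment> \<open>The scale l makes the fourth power part at most \<kappa> / 2; by Young's
    inequality the singular part then carries the factor m = l^{-4/3}.\<close>
  define l where "l = (\<kappa> / (2 * (I + 1))) powr (1/4)"
  have l: "0 < l" using \<kappa> I0 by (simp add: l_def)
  have l4: "l^4 * I \<le> \<kappa> / 2"
  proof -
    have "l^4 = \<kappa> / (2 * (I + 1))" using \<kappa> I0 by (simp add: l_def powr_power)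
    then have "l^4 * I = \<kappa> / 2 * (I / (I + 1))" using I0 by (simp add: field_simps)
    also have "\<dots> \<le> \<kappa> / 2 * 1" using \<kappa> I0 by (intro mult_left_mono) auto
    finally show ?thesis by simp
  qed
  define m where "m = l powr (-4/3)"
  have m: "0 < m" using l by (simp add: m_def)
  \<comment> \<open>The integral of (t - r)^{-2/3} is 3 * (t - s)^{1/3}, and \<delta> solves 3 * m *
    \<delta>^{1/3} = \<kappa> / 2.\<close>
  define \<delta> where "\<delta> = (\<kappa> / (6 * m))^3"
  have \<delta>: "0 < \<delta>" using \<kappa> m by (simp add: \<delta>_def)
  have bound: "(\<integral>\<^sup>+r. ennreal (\<gamma> r / sqrt (t - r)) * indicator {s<..t} r \<partial>lborel) \<le> ennreal \<kappa>"
    if st: "s < t" "t - s \<le> \<delta>" for s t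
  proof -
    let ?g = "\<lambda>z::real. ennreal (z powr (-2/3)) * indicator {0..t - s} z"
    have g: "(\<integral>\<^sup>+r. ?g (t - r) \<partial>lborel) = ennreal (3 * (t - s) powr (1/3))"
    proof -
      have "((\<lambda>x::real. x powr (-2/3)) has_integral ((t - s) powr (-2/3+1) / (-2/3+1))) {0..t - s}"
        by (rule has_integral_powr_from_0) (use st in auto)
      then have "(\<integral>\<^sup>+z. ?g z \<partial>lborel) = ennreal ((t - s) powr (-2/3+1) / (-2/3+1))"
        by (intro nn_integral_has_integral_lebesgue') auto
      moreover have "(\<integral>\<^sup>+z. ?g z \<partial>lborel) = (\<integral>\<^sup>+r. ?g (t - r) \<partial>lborel)"
        by (subst nn_integral_real_affine[of ?g "-1" t]) auto
      ultimately show ?thesis by (simp add: mult.commute[of 3])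
    qed
    have pw: "ennreal (\<gamma> r / sqrt (t - r)) * indicator {s<..t} r
        \<le> ennreal (l^4) * ennreal (\<gamma> r ^ 4) + ennreal m * ?g (t - r)" for r
    proof (cases "r \<in> {s<..<t}")
      case True
      define q where "q = 1 / sqrt (t - r)"
      have q: "0 < q" using True by (simp add: q_def)
      have "\<gamma> r / sqrt (t - r) = (l * \<gamma> r) * (q / l)" using l by (simp add: q_def)
      also have "\<dots> \<le> (l * \<gamma> r)^4 + (q / l) powr (4/3)"
        using l \<gamma>0 q by (intro young_4_third) auto
      also have "(q / l) powr (4/3) = m * (t - r) powr (-2/3)"
      proof -
        have "q = (t - r) powr (-1/2)"
          using True by (simp add: q_def powr_half_sqrt[symmetric] powr_minus_divide[symmetric])
        then have "q powr (4/3) = (t - r) powr (-2/3)" by (simp add: powr_powr)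
        moreover have "(q / l) powr (4/3) = q powr (4/3) * l powr (-4/3)"
          using q l by (simp add: powr_divide powr_minus_divide)
        ultimately show ?thesis by (simp add: m_def)
      qed
      finally have "ennreal (\<gamma> r / sqrt (t - r)) \<le> ennreal (l^4 * \<gamma> r ^ 4 + m * (t - r) powr (-2/3))"
        by (intro ennreal_leI) (simp add: power_mult_distrib)
      also have "\<dots> = ennreal (l^4) * ennreal (\<gamma> r ^ 4) + ennreal m * ennreal ((t - r) powr (-2/3))"
        using l m \<gamma>0 by (simp add: ennreal_mult)
      finally show ?thesis using True by (simp add: indicator_def)
    next
      case False
      then have "ennreal (\<gamma> r / sqrt (t - r)) * indicator {s<..t} r = 0"
        by (cases "r = t") (auto simp: indicator_def)
      then show ?thesis by (simp only: zero_le)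
    qed
    have "(\<integral>\<^sup>+r. ennreal (\<gamma> r / sqrt (t - r)) * indicator {s<..t} r \<partial>lborel)
      \<le> (\<integral>\<^sup>+r. ennreal (l^4) * ennreal (\<gamma> r ^ 4) + ennreal m * ?g (t - r) \<partial>lborel)"
      by (intro nn_integral_mono pw)
    also have "\<dots> = ennreal (l^4) * (\<integral>\<^sup>+r. ennreal (\<gamma> r ^ 4) \<partial>lborel) + ennreal m * (\<integral>\<^sup>+r. ?g (t - r) \<partial>lborel)"
      by (subst nn_integral_add, simp, simp, subst nn_integral_cmult, simp, subst nn_integral_cmult) auto
    also have "(\<integral>\<^sup>+r. ennreal (\<gamma> r ^ 4) \<partial>lborel) = ennreal I"
      unfolding I_def by (rule nn_integral_eq_integral[OF \<gamma>4]) simp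
    also have "ennreal (l^4) * ennreal I + ennreal m * (\<integral>\<^sup>+r. ?g (t - r) \<partial>lborel)
        = ennreal (l^4 * I + m * (3 * (t - s) powr (1/3)))"
      unfolding g using l m I0 by (simp add: ennreal_mult[symmetric] ennreal_plus[symmetric] del: ennreal_plus)
    also have "\<dots> \<le> ennreal \<kappa>"
    proof (rule ennreal_leI)
      have "(t - s) powr (1/3) \<le> \<delta> powr (1/3)"
        using st by (intro powr_mono2) auto
      also have "\<dots> = \<kappa> / (6 * m)"
      proof -
        have "\<delta> = (\<kappa> / (6 * m)) powr 3" using \<kappa> m by (simp add: \<delta>_def)
        then show ?thesis using \<kappa> m by (simp only: powr_powr) simp
      qed
      finally have "m * (3 * (t - s) powr (1/3)) \<le> m * (3 * (\<kappa> / (6 * m)))"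
        using m by (intro mult_left_mono) auto
      also have "\<dots> = \<kappa> / 2" using m by simp
      finally show "l^4 * I + m * (3 * (t - s) powr (1/3)) \<le> \<kappa>" using l4 by simp
    qed
    finally show ?thesis .
  qed
  show ?thesis using \<delta> bound by blast
qed

text \<open>Absolute continuity at positive times transfers Lebesgue almost everywhere convergence
  of test functions to both processes. The noise coefficient c is common, so both equations use the
  same heat flow.\<close>

locale drift_sde_pair =
  A: drift_sde M T c F W X b \<beta> + B: drift_sde M' T c F' W' X' b' \<beta>'
  for M :: "'a measure" and M' :: "'b measure" and T c F W X b \<beta> F' W' X' b' \<beta>' +
  assumes X_ac: "\<And>t. t \<in> {0<..T} \<Longrightarrow> absolutely_continuous lborel (distr M borel (X t))"
    and X'_ac: "\<And>t. t \<in> {0<..T} \<Longrightarrow> absolutely_continuous lborel (distr M' borel (X' t))"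
begin

text \<open>The integral of h against the difference of the two weighted laws at time r; the
  supremum over |h| \<le> 1 is its total variation norm.\<close>

definition law_diff :: "('a \<Rightarrow> real) \<Rightarrow> ('b \<Rightarrow> real) \<Rightarrow> real \<Rightarrow> (real^2 \<Rightarrow> real) \<Rightarrow> real" where
  "law_diff Y Y' r h = (\<integral>\<omega>. Y \<omega> * h (X r \<omega>) \<partial>M) - (\<integral>\<omega>. Y' \<omega> * h (X' r \<omega>) \<partial>M')"

lemma AE_X:
  assumes "AE x in lborel. P x" "t \<in> {0<..T}"
  shows "AE \<omega> in M. P (X t \<omega>)" "AE \<omega> in M'. P (X' t \<omega>)"
proof -
  have "AE x in distr M borel (X t). P x" "AE x in distr M' borel (X' t). P x"
    using absolutely_continuous_AE[OF _ X_ac[OF assms(2)] assms(1)]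
      absolutely_continuous_AE[OF _ X'_ac[OF assms(2)] assms(1)] by auto
  then show "AE \<omega> in M. P (X t \<omega>)" "AE \<omega> in M'. P (X' t \<omega>)"
    by (auto elim!: AE_distrD[rotated])
qed

text \<open>The assumption \<open>key\<close> isolates the comparison of the two drifts: if the
  weighted laws are within S in total variation, the drift terms tested with a field bounded by K
  differ by at most S * K * \<gamma> r. It is verified once for the constant weight 1 and once, with
  equal drifts, for general weights.\<close>

context
  fixes s0 :: real and Y :: "'a \<Rightarrow> real" and Y' :: "'b \<Rightarrow> real" and \<gamma> :: "real \<Rightarrow> real"
  assumes s0: "0 \<le> s0"
    and Y: "Y \<in> borel_measurable (F s0)" "\<And>\<omega>. \<bar>Y \<omega>\<bar> \<le> 1"
    and Y': "Y' \<in> borel_measurable (F' s0)" "\<And>\<omega>. \<bar>Y' \<omega>\<bar> \<le> 1"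
    and \<gamma>_meas [measurable]: "\<gamma> \<in> borel_measurable borel" and \<gamma>0: "\<And>r. 0 \<le> \<gamma> r"
    and \<gamma>4: "integrable lborel (\<lambda>r. \<gamma> r ^ 4)"
    and key: "AE r in lborel. r \<in> {s0<..<T} \<longrightarrow> (\<forall>\<psi> S K. \<psi> \<in> borel_measurable borel \<longrightarrow> 0 \<le> S \<longrightarrow>
        (\<forall>x. norm (\<psi> x) \<le> K) \<longrightarrow>
        (\<forall>h\<in>borel_measurable borel. (\<forall>x. \<bar>h x\<bar> \<le> 1) \<longrightarrow> \<bar>law_diff Y Y' r h\<bar> \<le> S) \<longrightarrow>
        \<bar>(\<integral>\<omega>. Y \<omega> * (b r (X r \<omega>) \<bullet> \<psi> (X r \<omega>)) \<partial>M)
          - (\<integral>\<omega>. Y' \<omega> * (b' r (X' r \<omega>) \<bullet> \<psi> (X' r \<omega>)) \<partial>M')\<bar> \<le> S * K * \<gamma> r)"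
begin

lemma Y_meas [measurable]: "Y \<in> borel_measurable M" "Y' \<in> borel_measurable M'"
  using Y(1) Y'(1) by (auto intro: A.measurable_F_M B.measurable_F_M)

lemma law_diff_tendsto:
  assumes t: "t \<in> {0<..T}"
    and hm [measurable]: "\<And>n. h n \<in> borel_measurable borel" "g \<in> borel_measurable borel"
    and h1: "\<And>n x. \<bar>h n x\<bar> \<le> 1"
    and lim: "AE x in lborel. (\<lambda>n. h n x) \<longlonglongrightarrow> g x"
  shows "(\<lambda>n. law_diff Y Y' t (h n)) \<longlonglongrightarrow> law_diff Y Y' t g"
  unfolding law_diff_def
proof (rule tendsto_diff)
  show "(\<lambda>n. \<integral>\<omega>. Y \<omega> * h n (X t \<omega>) \<partial>M) \<longlonglongrightarrow> (\<integral>\<omega>. Y \<omega> * g (X t \<omega>) \<partial>M)"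
  proof (rule integral_dominated_convergence[where w="\<lambda>_. 1"])
    show "AE \<omega> in M. (\<lambda>n. Y \<omega> * h n (X t \<omega>)) \<longlonglongrightarrow> Y \<omega> * g (X t \<omega>)"
      using AE_X(1)[OF lim t] by eventually_elim (intro tendsto_mult tendsto_const)
    show "AE \<omega> in M. norm (Y \<omega> * h n (X t \<omega>)) \<le> 1" for n
      using mult_mono[OF Y(2) h1] by (auto simp: abs_mult)
  qed auto
  show "(\<lambda>n. \<integral>\<omega>. Y' \<omega> * h n (X' t \<omega>) \<partial>M') \<longlonglongrightarrow> (\<integral>\<omega>. Y' \<omega> * g (X' t \<omega>) \<partial>M')"
  proof (rule integral_dominated_convergence[where w="\<lambda>_. 1"])
    show "AE \<omega> in M'. (\<lambda>n. Y' \<omega> * h n (X' t \<omega>)) \<longlonglongrightarrow> Y' \<omega> * g (X' t \<omega>)"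
      using AE_X(2)[OF lim t] by eventually_elim (intro tendsto_mult tendsto_const)
    show "AE \<omega> in M'. norm (Y' \<omega> * h n (X' t \<omega>)) \<le> 1" for n
      using mult_mono[OF Y'(2) h1] by (auto simp: abs_mult)
  qed auto
qed

text \<open>Two limits: Gaussian mollification reaches continuous functions, and almost everywhere
  approximation by continuous functions reaches measurable ones. R does not depend on L, so it
  survives both.\<close>

lemma law_diff_bound_of_C11:
  assumes t: "t \<in> {0<..T}"
    and C11: "\<And>f f' L. C11_test f f' L \<Longrightarrow> \<bar>law_diff Y Y' t f\<bar> \<le> R"
    and g [measurable]: "g \<in> borel_measurable borel" and g1: "\<And>x. \<bar>g x\<bar> \<le> 1"
  shows "\<bar>law_diff Y Y' t g\<bar> \<le> R"
proof -
  have cont: "\<bar>law_diff Y Y' t h\<bar> \<le> R" if h: "continuous_on UNIV h" "\<And>x. \<bar>h x\<bar> \<le> 1" for h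
  proof -
    have hm [measurable]: "h \<in> borel_measurable borel" using h(1) by (rule borel_measurable_continuous_onI)
    have "(\<lambda>n. law_diff Y Y' t (gauss_avg (inverse (real (Suc n))) h)) \<longlonglongrightarrow> law_diff Y Y' t h"
    proof (rule law_diff_tendsto[OF t])
      show "\<bar>gauss_avg (inverse (real (Suc n))) h x\<bar> \<le> 1" for n x
        using gauss_avg_bound[OF hm, of 1] h(2) by simp
      show "AE x in lborel. (\<lambda>n. gauss_avg (inverse (real (Suc n))) h x) \<longlonglongrightarrow> h x"
      proof (rule AE_I2)
        fix x
        have "continuous_on UNIV (\<lambda>p. gauss_avg (fst p) h (snd p))"
          by (rule continuous_gauss_avg[OF h(1), of 1]) (use h(2) in simp)
        from continuous_on_tendsto_compose[OF this tendsto_Pair[OF LIMSEQ_inverse_real_of_nat tendsto_const[of x]]]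
        show "(\<lambda>n. gauss_avg (inverse (real (Suc n))) h x) \<longlonglongrightarrow> h x" by simp
      qed
    qed auto
    then have "(\<lambda>n. \<bar>law_diff Y Y' t (gauss_avg (inverse (real (Suc n))) h)\<bar>) \<longlonglongrightarrow> \<bar>law_diff Y Y' t h\<bar>"
      by (rule tendsto_rabs)
    then show ?thesis
    proof (rule tendsto_upperbound)
      have "\<bar>law_diff Y Y' t (gauss_avg (inverse (real (Suc n))) h)\<bar> \<le> R" for n
        using C11_test_gauss_avg[OF h, of "inverse (real (Suc n))"] C11 by auto
      then show "\<forall>\<^sub>F n in sequentially. \<bar>law_diff Y Y' t (gauss_avg (inverse (real (Suc n))) h)\<bar> \<le> R"
        by simp
    qed simp
  qed
  have "g \<in> borel_measurable lebesgue"
    by (rule measurable_completion) simp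
  then have "g measurable_on UNIV"
    by (intro lebesgue_measurable_imp_measurable_on) auto
  then obtain N h where N: "negligible N" and h: "\<And>n::nat. continuous_on UNIV (h n)"
    and lim: "\<And>x. x \<notin> N \<Longrightarrow> (\<lambda>n. h n x) \<longlonglongrightarrow> g x"
    unfolding measurable_on_def by auto
  \<comment> \<open>Truncation to [-1, 1] leaves the limit unchanged, since |g| \<le> 1, and brings
    the approximants within reach of the continuous case.\<close>
  define k where "k n x = max (-1) (min 1 (h n x))" for n x
  have k: "continuous_on UNIV (k n)" "\<bar>k n x\<bar> \<le> 1" for n x
    unfolding k_def using h by (auto intro!: continuous_intros simp: abs_le_iff)
  have km [measurable]: "k n \<in> borel_measurable borel" for n
    using k(1) by (rule borel_measurable_continuous_onI)
  have lim': "AE x in lborel. (\<lambda>n. k n x) \<longlonglongrightarrow> g x"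
  proof -
    have "N \<in> null_sets lebesgue" using N by (simp add: negligible_iff_null_sets)
    then have "AE x in lebesgue. x \<notin> N" by (rule AE_not_in)
    then have "AE x in lborel. x \<notin> N" by (simp add: AE_completion_iff)
    then show ?thesis
    proof eventually_elim
      case (elim x)
      have "(\<lambda>n. k n x) \<longlonglongrightarrow> max (-1) (min 1 (g x))"
        unfolding k_def by (intro tendsto_max tendsto_min tendsto_const lim elim)
      moreover have "max (-1) (min 1 (g x)) = g x" using g1[of x] by (auto simp: abs_le_iff)
      ultimately show ?case by simp
    qed
  qed
  have "(\<lambda>n. \<bar>law_diff Y Y' t (k n)\<bar>) \<longlonglongrightarrow> \<bar>law_diff Y Y' t g\<bar>"
    by (intro tendsto_rabs law_diff_tendsto[OF t]) (use k lim' in auto)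
  then show ?thesis
    by (rule tendsto_upperbound) (use cont[OF k] in auto)
qed

lemma law_diff_le_2:
  assumes [measurable]: "h \<in> borel_measurable borel" and "\<And>x. \<bar>h x\<bar> \<le> 1"
  shows "\<bar>law_diff Y Y' r h\<bar> \<le> 2"
proof -
  have "norm (\<integral>\<omega>. Y \<omega> * h (X r \<omega>) \<partial>M) \<le> (\<integral>\<omega>. 1 \<partial>M)"
    by (rule norm_integral_le_integral) (use mult_mono[OF Y(2) assms(2)] in \<open>auto simp: abs_mult\<close>)
  moreover have "norm (\<integral>\<omega>. Y' \<omega> * h (X' r \<omega>) \<partial>M') \<le> (\<integral>\<omega>. 1 \<partial>M')"
    by (rule norm_integral_le_integral) (use mult_mono[OF Y'(2) assms(2)] in \<open>auto simp: abs_mult\<close>)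
  ultimately show ?thesis
    by (simp add: law_diff_def A.prob_space B.prob_space)
qed

text \<open>Subtract the two Duhamel formulas. The terms at time s cancel by \<open>zero\<close>,
  and \<open>key\<close> applied to the heat gradient, which is bounded by \<open>gauss_C1\<close> /
  (c * sqrt (t - r)), produces the singular time integral.\<close>

lemma law_diff_C11_estimate:
  assumes st: "s0 \<le> s" "s < t" "t \<le> T"
    and zero: "\<And>h. h \<in> borel_measurable borel \<Longrightarrow> (\<And>x. \<bar>h x\<bar> \<le> 1) \<Longrightarrow> law_diff Y Y' s h = 0"
    and S0: "0 \<le> S"
    and S: "\<And>r h. r \<in> {s<..t} \<Longrightarrow> h \<in> borel_measurable borel \<Longrightarrow> (\<And>x. \<bar>h x\<bar> \<le> 1) \<Longrightarrow> \<bar>law_diff Y Y' r h\<bar> \<le> S"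
    and f: "C11_test f f' L"
  shows "ennreal \<bar>law_diff Y Y' t f\<bar>
    \<le> ennreal (S * gauss_C1 / c) * (\<integral>\<^sup>+r. ennreal (\<gamma> r / sqrt (t - r)) * indicator {s<..t} r \<partial>lborel)"
proof -
  have s: "0 \<le> s" using s0 st by simp
  have Ys: "Y \<in> borel_measurable (F s)" "Y' \<in> borel_measurable (F' s)"
    using Y(1) Y'(1) st by (auto intro: A.measurable_F_mono B.measurable_F_mono)
  note ctA = s st(2,3) Ys(1) Y(2) f and ctB = s st(2,3) Ys(2) Y'(2) f
  let ?a = "A.drift_term t Y f'" and ?b = "B.drift_term t Y' f'"
  have i: "integrable lborel ?a" "integrable lborel ?b"
    by (rule A.drift_term_integrable[OF ctA] B.drift_term_integrable[OF ctB])+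
  have si: "set_integrable lborel {s<..t} ?a" "set_integrable lborel {s<..t} ?b"
    unfolding set_integrable_def using i by (intro integrable_mult_indicator; simp)+
  have "law_diff Y Y' t f = law_diff Y Y' s (A.heat t f s) + ((\<integral>r\<in>{s<..t}. ?a r \<partial>lborel) - (\<integral>r\<in>{s<..t}. ?b r \<partial>lborel))"
    using A.duhamel[OF ctA] B.duhamel[OF ctB] by (simp add: law_diff_def)
  also have "law_diff Y Y' s (A.heat t f s) = 0"
    by (rule zero) (use A.heat_measurable[OF ctA] A.heat_le_1[OF ctA] in auto)
  also have "(\<integral>r\<in>{s<..t}. ?a r \<partial>lborel) - (\<integral>r\<in>{s<..t}. ?b r \<partial>lborel) = (\<integral>r\<in>{s<..t}. ?a r - ?b r \<partial>lborel)"
    by (rule set_integral_diff(2)[symmetric]) (rule si)+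
  finally have eq: "law_diff Y Y' t f = (\<integral>r. indicator {s<..t} r *\<^sub>R (?a r - ?b r) \<partial>lborel)"
    by (simp add: set_lebesgue_integral_def)
  have "integrable lborel (\<lambda>r. indicator {s<..t} r *\<^sub>R (?a r - ?b r))"
    using i by (intro integrable_mult_indicator Bochner_Integration.integrable_diff) auto
  then have "ennreal \<bar>law_diff Y Y' t f\<bar> \<le> (\<integral>\<^sup>+r. ennreal (norm (indicator {s<..t} r *\<^sub>R (?a r - ?b r))) \<partial>lborel)"
    unfolding eq real_norm_def[symmetric] by (rule integral_norm_bound_ennreal)
  also have "\<dots> \<le> (\<integral>\<^sup>+r. ennreal (S * gauss_C1 / c) * (ennreal (\<gamma> r / sqrt (t - r)) * indicator {s<..t} r) \<partial>lborel)"
  proof (rule nn_integral_mono_AE)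
    show "AE r in lborel. ennreal (norm (indicator {s<..t} r *\<^sub>R (?a r - ?b r)))
        \<le> ennreal (S * gauss_C1 / c) * (ennreal (\<gamma> r / sqrt (t - r)) * indicator {s<..t} r)"
      using key AE_lborel_singleton[of t]
    proof eventually_elim
      case (elim r)
      show ?case
      proof (cases "r \<in> {s<..t}")
        case True
        with elim(2) st have r: "r \<in> {s0<..<T}" "0 < sqrt (t - r)" by auto
        have gm: "A.heat_grad t f' r \<in> borel_measurable borel"
          using A.heat_grad_measurable2[OF ctA, of "\<lambda>_. r" borel "\<lambda>x. x"] by simp
        have gb: "norm (A.heat_grad t f' r x) \<le> gauss_C1 / (c * sqrt (t - r))" for x
          unfolding A.heat_grad_def[OF ctA] using A.c_pos r(2) by (intro gauss_avg_grad_bound[OF f]) auto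
        have "\<bar>?a r - ?b r\<bar> \<le> S * (gauss_C1 / (c * sqrt (t - r))) * \<gamma> r"
          unfolding A.drift_term_def[OF ctA] B.drift_term_def[OF ctB]
          using elim(1) r(1) gm gb S[OF True] S0 by blast
        also have "\<dots> = S * gauss_C1 / c * (\<gamma> r / sqrt (t - r))" by simp
        finally have "ennreal \<bar>?a r - ?b r\<bar> \<le> ennreal (S * gauss_C1 / c * (\<gamma> r / sqrt (t - r)))"
          by (rule ennreal_leI)
        also have "\<dots> = ennreal (S * gauss_C1 / c) * ennreal (\<gamma> r / sqrt (t - r))"
          using S0 gauss_C_nonneg A.c_pos \<gamma>0[of r] r(2) by (intro ennreal_mult) auto
        finally show ?thesis using True by simp
      qed simp
    qed
  qed
  also have "\<dots> = ennreal (S * gauss_C1 / c) * (\<integral>\<^sup>+r. ennreal (\<gamma> r / sqrt (t - r)) * indicator {s<..t} r \<partial>lborel)"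
    by (rule nn_integral_cmult) auto
  finally show ?thesis .
qed

text \<open>S is the supremum over all times in the interval, because the estimate at time r
  involves the law differences at earlier times. Each value is at most S / 2, and S is finite, hence
  S = 0.\<close>

lemma law_diff_local_zero:
  "\<exists>\<delta>>0. \<forall>s t h. s0 \<le> s \<longrightarrow> s < t \<longrightarrow> t \<le> T \<longrightarrow> t - s \<le> \<delta> \<longrightarrow>
     (\<forall>h\<in>borel_measurable borel. (\<forall>x. \<bar>h x\<bar> \<le> 1) \<longrightarrow> law_diff Y Y' s h = 0) \<longrightarrow>
     h \<in> borel_measurable borel \<longrightarrow> (\<forall>x. \<bar>h x\<bar> \<le> 1) \<longrightarrow> law_diff Y Y' t h = 0"
proof -
  \<comment> \<open>Chosen to make the contraction factor \<open>gauss_C1\<close> / c * \<kappa> at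
    most 1/2; the added 1 keeps the denominator positive.\<close>
  define \<kappa> where "\<kappa> = c / (2 * (gauss_C1 + 1))"
  have \<kappa>: "\<kappa> > 0" using A.c_pos gauss_C_nonneg by (simp add: \<kappa>_def)
  have \<kappa>': "gauss_C1 / c * \<kappa> \<le> 1 / 2"
    using A.c_pos gauss_C_nonneg by (simp add: \<kappa>_def field_simps)
  obtain \<delta> where \<delta>: "\<delta> > 0" and small: "\<And>s t. s < t \<Longrightarrow> t - s \<le> \<delta> \<Longrightarrow>
    (\<integral>\<^sup>+r. ennreal (\<gamma> r / sqrt (t - r)) * indicator {s<..t} r \<partial>lborel) \<le> ennreal \<kappa>"
    using singular_integral_small[OF \<gamma>_meas \<gamma>0 \<gamma>4 \<kappa>] by blast
  have "law_diff Y Y' t h = 0"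
    if st: "s0 \<le> s" "s < t" "t \<le> T" "t - s \<le> \<delta>"
      and zero: "\<forall>h\<in>borel_measurable borel. (\<forall>x. \<bar>h x\<bar> \<le> 1) \<longrightarrow> law_diff Y Y' s h = 0"
      and h: "h \<in> borel_measurable borel" "\<forall>x. \<bar>h x\<bar> \<le> 1" for s t h
  proof -
    define Q where "Q = {\<bar>law_diff Y Y' r h\<bar> | r h. r \<in> {s<..t} \<and> h \<in> borel_measurable borel \<and> (\<forall>x. \<bar>h x\<bar> \<le> 1)}"
    define S where "S = Sup Q"
    have bdd: "bdd_above Q"
      unfolding Q_def using law_diff_le_2 by (intro bdd_aboveI[of _ 2]) blast
    have S: "\<bar>law_diff Y Y' r h\<bar> \<le> S" if "r \<in> {s<..t}" "h \<in> borel_measurable borel" "\<And>x. \<bar>h x\<bar> \<le> 1" for r h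
      unfolding S_def by (rule cSup_upper[OF _ bdd]) (use that in \<open>auto simp: Q_def\<close>)
    have Qh: "\<bar>law_diff Y Y' t h\<bar> \<in> Q" using st h by (auto simp: Q_def)
    have S0: "0 \<le> S" using S[of t h] st h by auto
    have "q \<le> S / 2" if q: "q \<in> Q" for q
    proof -
      obtain r g where r: "r \<in> {s<..t}" and g: "g \<in> borel_measurable borel" "\<And>x. \<bar>g x\<bar> \<le> 1"
        and qeq: "q = \<bar>law_diff Y Y' r g\<bar>"
        using q by (auto simp: Q_def)
      have "\<bar>law_diff Y Y' r g\<bar> \<le> S / 2"
      proof (rule law_diff_bound_of_C11[OF _ _ g])
        show "r \<in> {0<..T}" using r st s0 by auto
        fix f f' L assume f: "C11_test f f' L"
        have "ennreal \<bar>law_diff Y Y' r f\<bar>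
          \<le> ennreal (S * gauss_C1 / c) * (\<integral>\<^sup>+v. ennreal (\<gamma> v / sqrt (r - v)) * indicator {s<..r} v \<partial>lborel)"
          by (rule law_diff_C11_estimate[OF st(1) _ _ _ S0 _ f]) (use r st zero S in auto)
        also have "\<dots> \<le> ennreal (S * gauss_C1 / c) * ennreal \<kappa>"
          by (intro mult_left_mono small) (use r st in auto)
        also have "\<dots> = ennreal (S * (gauss_C1 / c * \<kappa>))"
          using S0 gauss_C_nonneg A.c_pos \<kappa> by (subst ennreal_mult[symmetric]) (auto simp: mult.assoc)
        also have "\<dots> \<le> ennreal (S / 2)"
          using mult_left_mono[OF \<kappa>' S0] by (intro ennreal_leI) simp
        finally show "\<bar>law_diff Y Y' r f\<bar> \<le> S / 2" using S0 by (simp add: ennreal_le_iff)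
      qed
      then show ?thesis using qeq by simp
    qed
    then have "S \<le> S / 2" unfolding S_def using Qh by (intro cSup_least) auto
    then have "S \<le> 0" by simp
    with S[of t h] st h show ?thesis by auto
  qed
  with \<delta> show ?thesis by blast
qed

text \<open>The step size \<delta> is uniform in the starting time, so finitely many steps cover the
  interval.\<close>

theorem law_diff_zero_propagates:
  assumes zero: "\<And>h. h \<in> borel_measurable borel \<Longrightarrow> (\<And>x. \<bar>h x\<bar> \<le> 1) \<Longrightarrow> law_diff Y Y' s0 h = 0"
    and t: "s0 \<le> t" "t \<le> T" and h: "h \<in> borel_measurable borel" "\<And>x. \<bar>h x\<bar> \<le> 1"
  shows "law_diff Y Y' t h = 0"
proof -
  obtain \<delta> where \<delta>: "\<delta> > 0" and step: "\<And>s t h. s0 \<le> s \<Longrightarrow> s < t \<Longrightarrow> t \<le> T \<Longrightarrow> t - s \<le> \<delta> \<Longrightarrow>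
     (\<forall>h\<in>borel_measurable borel. (\<forall>x. \<bar>h x\<bar> \<le> 1) \<longrightarrow> law_diff Y Y' s h = 0) \<Longrightarrow>
     h \<in> borel_measurable borel \<Longrightarrow> (\<forall>x. \<bar>h x\<bar> \<le> 1) \<Longrightarrow> law_diff Y Y' t h = 0"
    using law_diff_local_zero by blast
  have all: "\<forall>t h. s0 \<le> t \<and> t \<le> T \<and> t \<le> s0 + real n * \<delta> \<and> h \<in> borel_measurable borel \<and> (\<forall>x. \<bar>h x\<bar> \<le> 1)
      \<longrightarrow> law_diff Y Y' t h = 0" for n
  proof (induction n)
    case 0
    then show ?case using zero by auto
  next
    case (Suc n)
    show ?case
    proof (intro allI impI, elim conjE)
      fix t and h :: "real^2 \<Rightarrow> real" assume a: "s0 \<le> t" "t \<le> T" "t \<le> s0 + real (Suc n) * \<delta>"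
        and h: "h \<in> borel_measurable borel" "\<forall>x. \<bar>h x\<bar> \<le> 1"
      show "law_diff Y Y' t h = 0"
      proof (cases "t \<le> s0 + real n * \<delta>")
        case True
        then show ?thesis using Suc a h by blast
      next
        case False
        show ?thesis
        proof (rule step[of "s0 + real n * \<delta>" t, OF _ _ a(2) _ _ h])
          show "s0 \<le> s0 + real n * \<delta>" using \<delta> by simp
          then show "\<forall>h\<in>borel_measurable borel. (\<forall>x. \<bar>h x\<bar> \<le> 1) \<longrightarrow> law_diff Y Y' (s0 + real n * \<delta>) h = 0"
            using Suc False a by auto
        qed (use False a in \<open>auto simp: algebra_simps\<close>)
      qed
    qed
  qed
  obtain n :: nat where "(t - s0) / \<delta> < real n" using reals_Archimedean2 by blast
  then have "t \<le> s0 + real n * \<delta>" using \<delta> by (simp add: field_simps)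
  then show ?thesis using all[of n] t h by blast
qed

end

end

section \<open>Uniqueness of the path law\<close>

text \<open>The bound \<open>B\<close>, uniform in x, makes the double integral absolutely
  convergent despite the singular kernel; exchanging the order leaves a test function evaluated at
  the source \<eta>.\<close>

lemma kernel_fubini:
  fixes \<xi> :: "'a \<Rightarrow> real^2" and \<eta> :: "'b \<Rightarrow> real^2" and \<psi> :: "real^2 \<Rightarrow> real^2"
  assumes "prob_space P" "prob_space N"
    and [measurable]: "\<xi> \<in> borel_measurable P" "\<eta> \<in> borel_measurable N" "\<psi> \<in> borel_measurable borel"
    and \<psi>: "\<And>x. norm (\<psi> x) \<le> K"
    and B: "\<And>x. (\<integral>\<^sup>+\<omega>. ennreal (norm (bs_kernel (x - \<eta> \<omega>))) \<partial>N) \<le> ennreal B"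
  shows "(\<integral>\<omega>'. (\<integral>\<omega>. bs_kernel (\<xi> \<omega>' - \<eta> \<omega>) \<partial>N) \<bullet> \<psi> (\<xi> \<omega>') \<partial>P)
       = (\<integral>\<omega>. (\<integral>\<omega>'. bs_kernel (\<xi> \<omega>' - \<eta> \<omega>) \<bullet> \<psi> (\<xi> \<omega>') \<partial>P) \<partial>N)"
proof -
  interpret P: prob_space P by fact
  interpret N: prob_space N by fact
  interpret PN: pair_sigma_finite P N ..
  have K0: "0 \<le> K" using order_trans[OF norm_ge_zero \<psi>] .
  let ?f = "\<lambda>\<omega>' \<omega>. bs_kernel (\<xi> \<omega>' - \<eta> \<omega>) \<bullet> \<psi> (\<xi> \<omega>')"
  have ik: "integrable N (\<lambda>\<omega>. bs_kernel (x - \<eta> \<omega>))" for x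
    by (rule integrableI_bounded) (use le_less_trans[OF B] in auto)
  have "integrable (P \<Otimes>\<^sub>M N) (case_prod ?f)"
  proof (rule integrableI_bounded)
    have "(\<integral>\<^sup>+z. ennreal (norm (case_prod ?f z)) \<partial>(P \<Otimes>\<^sub>M N))
        = (\<integral>\<^sup>+\<omega>'. (\<integral>\<^sup>+\<omega>. ennreal (norm (?f \<omega>' \<omega>)) \<partial>N) \<partial>P)"
      by (subst N.nn_integral_fst[symmetric]) auto
    also have "\<dots> \<le> (\<integral>\<^sup>+\<omega>'. ennreal K * ennreal B \<partial>P)"
    proof (rule nn_integral_mono)
      fix \<omega>'
      have "(\<integral>\<^sup>+\<omega>. ennreal (norm (?f \<omega>' \<omega>)) \<partial>N)
          \<le> (\<integral>\<^sup>+\<omega>. ennreal K * ennreal (norm (bs_kernel (\<xi> \<omega>' - \<eta> \<omega>))) \<partial>N)"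
      proof (rule nn_integral_mono)
        fix \<omega>
        have "norm (?f \<omega>' \<omega>) \<le> norm (bs_kernel (\<xi> \<omega>' - \<eta> \<omega>)) * norm (\<psi> (\<xi> \<omega>'))"
          using Cauchy_Schwarz_ineq2 by simp
        also have "\<dots> \<le> norm (bs_kernel (\<xi> \<omega>' - \<eta> \<omega>)) * K"
          by (intro mult_left_mono \<psi>) simp
        finally show "ennreal (norm (?f \<omega>' \<omega>)) \<le> ennreal K * ennreal (norm (bs_kernel (\<xi> \<omega>' - \<eta> \<omega>)))"
          using K0 by (simp add: ennreal_mult[symmetric] mult.commute ennreal_leI)
      qed
      also have "\<dots> = ennreal K * (\<integral>\<^sup>+\<omega>. ennreal (norm (bs_kernel (\<xi> \<omega>' - \<eta> \<omega>))) \<partial>N)"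
        by (rule nn_integral_cmult) simp
      also have "\<dots> \<le> ennreal K * ennreal B"
        by (intro mult_left_mono B) simp
      finally show "(\<integral>\<^sup>+\<omega>. ennreal (norm (?f \<omega>' \<omega>)) \<partial>N) \<le> ennreal K * ennreal B" .
    qed
    also have "\<dots> < \<infinity>"
      by (simp add: P.emeasure_space_1 ennreal_mult_less_top)
    finally show "(\<integral>\<^sup>+z. ennreal (norm (case_prod ?f z)) \<partial>(P \<Otimes>\<^sub>M N)) < \<infinity>" .
  qed measurable
  from PN.Fubini_integral[OF this]
  have "(\<integral>\<omega>. (\<integral>\<omega>'. ?f \<omega>' \<omega> \<partial>P) \<partial>N) = (\<integral>\<omega>'. (\<integral>\<omega>. ?f \<omega>' \<omega> \<partial>N) \<partial>P)" by simp
  also have "\<dots> = (\<integral>\<omega>'. (\<integral>\<omega>. bs_kernel (\<xi> \<omega>' - \<eta> \<omega>) \<partial>N) \<bullet> \<psi> (\<xi> \<omega>') \<partial>P)"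
    by (intro Bochner_Integration.integral_cong refl integral_inner_left ik)
  finally show ?thesis by simp
qed

text \<open>The velocity is written as an expectation over the process rather than through a
  density, so equal marginals give equal drifts at once and the kernel bound can be fed directly to
  \<open>kernel_fubini\<close>.\<close>

locale biot_savart_pair = drift_sde_pair +
  assumes drift_A: "AE r in lborel. r \<in> {0<..<T} \<longrightarrow> (\<forall>x. b r x = (\<integral>\<omega>. bs_kernel (x - X r \<omega>) \<partial>M) \<and>
        (\<integral>\<^sup>+\<omega>. ennreal (norm (bs_kernel (x - X r \<omega>))) \<partial>M) \<le> ennreal (\<beta> r))"
    and drift_B: "AE r in lborel. r \<in> {0<..<T} \<longrightarrow> (\<forall>x. b' r x = (\<integral>\<omega>. bs_kernel (x - X' r \<omega>) \<partial>M') \<and>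
        (\<integral>\<^sup>+\<omega>. ennreal (norm (bs_kernel (x - X' r \<omega>))) \<partial>M') \<le> ennreal (\<beta>' r))"
    and \<beta>4: "integrable lborel (\<lambda>r. \<beta> r ^ 4)" "integrable lborel (\<lambda>r. \<beta>' r ^ 4)"
    and init: "distr M borel (X 0) = distr M' borel (X' 0)"
begin

lemma \<gamma>_facts:
  "(\<lambda>r. \<beta> r + \<beta>' r) \<in> borel_measurable borel" "0 \<le> \<beta> r + \<beta>' r"
  "integrable lborel (\<lambda>r. (\<beta> r + \<beta>' r) ^ 4)"
proof -
  show "(\<lambda>r. \<beta> r + \<beta>' r) \<in> borel_measurable borel" by measurable
  show "0 \<le> \<beta> r + \<beta>' r" using A.\<beta>_nonneg B.\<beta>_nonneg by simp
  show "integrable lborel (\<lambda>r. (\<beta> r + \<beta>' r) ^ 4)"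
  proof (rule Bochner_Integration.integrable_bound)
    show "integrable lborel (\<lambda>r. 16 * (\<beta> r ^ 4 + \<beta>' r ^ 4))" using \<beta>4 by simp
    show "AE r in lborel. norm ((\<beta> r + \<beta>' r) ^ 4) \<le> norm (16 * (\<beta> r ^ 4 + \<beta>' r ^ 4))"
    proof (rule AE_I2)
      fix r
      let ?m = "max (\<beta> r) (\<beta>' r)"
      have "(\<beta> r + \<beta>' r)^4 \<le> (2 * ?m)^4"
        using A.\<beta>_nonneg[of r] B.\<beta>_nonneg[of r] by (intro power_mono) auto
      also have "\<dots> = 16 * ?m^4" by (simp add: power_mult_distrib)
      also have "?m^4 \<le> \<beta> r ^ 4 + \<beta>' r ^ 4" by (auto simp: max_def)
      finally show "norm ((\<beta> r + \<beta>' r) ^ 4) \<le> norm (16 * (\<beta> r ^ 4 + \<beta>' r ^ 4))" by simp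
    qed
  qed measurable
qed

lemma law_diff_scale:
  assumes S: "\<forall>h\<in>borel_measurable borel. (\<forall>x. \<bar>h x\<bar> \<le> 1) \<longrightarrow> \<bar>law_diff Y Y' r h\<bar> \<le> S"
    and h: "h \<in> borel_measurable borel" "\<And>x. \<bar>h x\<bar> \<le> K"
  shows "\<bar>law_diff Y Y' r h\<bar> \<le> S * K"
proof (cases "K = 0")
  case True
  then have "h = (\<lambda>_. 0)" using h(2) by auto
  then show ?thesis using True by (simp add: law_diff_def)
next
  case False
  then have K: "0 < K" using order_trans[OF abs_ge_zero h(2)] by (simp add: less_le)
  have "law_diff Y Y' r (\<lambda>x. h x / K) = law_diff Y Y' r h / K"
    by (simp add: law_diff_def diff_divide_distrib)
  moreover have "\<bar>law_diff Y Y' r (\<lambda>x. h x / K)\<bar> \<le> S"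
  proof (rule S[rule_format])
    show "(\<lambda>x. h x / K) \<in> borel_measurable borel" using h(1) by measurable
    show "\<bar>h x / K\<bar> \<le> 1" for x using h(2)[of x] K by (simp add: abs_div)
  qed
  ultimately have "\<bar>law_diff Y Y' r h\<bar> / K \<le> S" using K by simp
  then show ?thesis using K by (simp add: pos_divide_le_eq)
qed

lemma drift_inner_bounded:
  assumes "norm z \<le> K"
  shows "\<bar>b r x \<bullet> z\<bar> \<le> \<beta> r * K"
proof -
  have "\<bar>b r x \<bullet> z\<bar> \<le> norm (b r x) * norm z" by (rule Cauchy_Schwarz_ineq2)
  also have "\<dots> \<le> \<beta> r * K" using A.b_bound assms A.\<beta>_nonneg by (intro mult_mono) auto
  finally show ?thesis .
qed

text \<open>With \<mu> and \<mu>' the two laws at time r, the drift terms differ by (\<mu> -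
  \<mu>')(b \<bullet> \<psi>) + \<mu>'((b - b') \<bullet> \<psi>), and the second term equals (\<mu>
  - \<mu>')(H). The test functions are bounded by \<beta> r * K and \<beta>' r * K, which gives
  \<open>key\<close> with \<gamma> = \<beta> + \<beta>'.\<close>

lemma marginal_laws_eq:
  assumes t: "t \<in> {0..T}"
  shows "distr M borel (X t) = distr M' borel (X' t)"
proof -
  let ?D = "law_diff (\<lambda>_. 1) (\<lambda>_. 1)"
  have key: "AE r in lborel. r \<in> {0<..<T} \<longrightarrow> (\<forall>\<psi> S K. \<psi> \<in> borel_measurable borel \<longrightarrow> 0 \<le> S \<longrightarrow>
        (\<forall>x. norm (\<psi> x) \<le> K) \<longrightarrow>
        (\<forall>h\<in>borel_measurable borel. (\<forall>x. \<bar>h x\<bar> \<le> 1) \<longrightarrow> \<bar>?D r h\<bar> \<le> S) \<longrightarrow>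
        \<bar>(\<integral>\<omega>. 1 * (b r (X r \<omega>) \<bullet> \<psi> (X r \<omega>)) \<partial>M)
          - (\<integral>\<omega>. 1 * (b' r (X' r \<omega>) \<bullet> \<psi> (X' r \<omega>)) \<partial>M')\<bar> \<le> S * K * (\<beta> r + \<beta>' r))"
    using drift_A drift_B
  proof eventually_elim
    case (elim r)
    show ?case
    proof (intro impI allI)
      fix \<psi> :: "real^2 \<Rightarrow> real^2" and S K
      assume r: "r \<in> {0<..<T}" and \<psi> [measurable]: "\<psi> \<in> borel_measurable borel" and "0 \<le> S"
        and \<psi>K: "\<forall>x. norm (\<psi> x) \<le> K"
        and S: "\<forall>h\<in>borel_measurable borel. (\<forall>x. \<bar>h x\<bar> \<le> 1) \<longrightarrow> \<bar>?D r h\<bar> \<le> S"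
      have bA: "b r x = (\<integral>\<omega>. bs_kernel (x - X r \<omega>) \<partial>M)"
          "(\<integral>\<^sup>+\<omega>. ennreal (norm (bs_kernel (x - X r \<omega>))) \<partial>M) \<le> ennreal (\<beta> r)" for x
        using elim(1) r by auto
      have bB: "b' r x = (\<integral>\<omega>. bs_kernel (x - X' r \<omega>) \<partial>M')"
          "(\<integral>\<^sup>+\<omega>. ennreal (norm (bs_kernel (x - X' r \<omega>))) \<partial>M') \<le> ennreal (\<beta>' r)" for x
        using elim(2) r by auto
      \<comment> \<open>Fubini turns the difference of the two velocities into the law difference of \<open>H\<close>.\<close>
      define H where "H y = (\<integral>\<omega>'. bs_kernel (X' r \<omega>' - y) \<bullet> \<psi> (X' r \<omega>') \<partial>M')" for y
      have Hm: "H \<in> borel_measurable borel" unfolding H_def by measurable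
      have Hb: "\<bar>H y\<bar> \<le> \<beta>' r * K" for y
      proof -
        \<comment> \<open>The kernel is odd, so its norm is even: although \<open>H\<close>
          integrates over the point where the velocity is evaluated, the velocity bound for the
          second process applies to it.\<close>
        have sym: "norm (bs_kernel (X' r \<omega>' - y)) = norm (bs_kernel (y - X' r \<omega>'))" for \<omega>'
          by (simp add: norm_bs_kernel norm_minus_commute)
        have "integrable M' (\<lambda>\<omega>'. bs_kernel (y - X' r \<omega>'))"
          by (rule integrableI_bounded) (use le_less_trans[OF bB(2)] in auto)
        then have i: "integrable M' (\<lambda>\<omega>'. norm (bs_kernel (y - X' r \<omega>')))" by simp
        have "norm (H y) \<le> (\<integral>\<omega>'. norm (bs_kernel (y - X' r \<omega>')) * K \<partial>M')"
          unfolding H_def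
        proof (rule norm_integral_le_integral)
          fix \<omega>'
          have "norm (bs_kernel (X' r \<omega>' - y) \<bullet> \<psi> (X' r \<omega>'))
              \<le> norm (bs_kernel (X' r \<omega>' - y)) * norm (\<psi> (X' r \<omega>'))"
            using Cauchy_Schwarz_ineq2 by simp
          also have "\<dots> \<le> norm (bs_kernel (y - X' r \<omega>')) * K"
            unfolding sym using \<psi>K by (intro mult_left_mono) auto
          finally show "norm (bs_kernel (X' r \<omega>' - y) \<bullet> \<psi> (X' r \<omega>')) \<le> norm (bs_kernel (y - X' r \<omega>')) * K" .
        qed (use i in auto)
        also have "\<dots> = (\<integral>\<omega>'. norm (bs_kernel (y - X' r \<omega>')) \<partial>M') * K" by simp
        also have "\<dots> \<le> \<beta>' r * K"
        proof (rule mult_right_mono)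
          have "ennreal (\<integral>\<omega>'. norm (bs_kernel (y - X' r \<omega>')) \<partial>M') \<le> ennreal (\<beta>' r)"
            using bB(2)[of y] nn_integral_eq_integral[OF i] by simp
          then show "(\<integral>\<omega>'. norm (bs_kernel (y - X' r \<omega>')) \<partial>M') \<le> \<beta>' r"
            using B.\<beta>_nonneg[of r] by (simp add: ennreal_le_iff)
          show "0 \<le> K" using order_trans[OF norm_ge_zero] \<psi>K by blast
        qed
        finally show ?thesis by simp
      qed
      have 1: "(\<integral>\<omega>'. b r (X' r \<omega>') \<bullet> \<psi> (X' r \<omega>') \<partial>M') = (\<integral>\<omega>. H (X r \<omega>) \<partial>M)"
        unfolding bA(1) H_def
        by (rule kernel_fubini[OF B.prob_space_axioms A.prob_space_axioms _ _ \<psi>])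
           (use \<psi>K bA(2) in auto)
      have 2: "(\<integral>\<omega>'. b' r (X' r \<omega>') \<bullet> \<psi> (X' r \<omega>') \<partial>M') = (\<integral>\<omega>. H (X' r \<omega>) \<partial>M')"
        unfolding bB(1) H_def
        by (rule kernel_fubini[OF B.prob_space_axioms B.prob_space_axioms _ _ \<psi>])
           (use \<psi>K bB(2) in auto)
      have "\<bar>?D r (\<lambda>x. b r x \<bullet> \<psi> x)\<bar> \<le> S * (\<beta> r * K)"
        by (rule law_diff_scale[OF S]) (use \<psi>K drift_inner_bounded in auto)
      moreover have "\<bar>?D r H\<bar> \<le> S * (\<beta>' r * K)"
        by (rule law_diff_scale[OF S Hm Hb])
      moreover have "(\<integral>\<omega>. b r (X r \<omega>) \<bullet> \<psi> (X r \<omega>) \<partial>M) - (\<integral>\<omega>. b' r (X' r \<omega>) \<bullet> \<psi> (X' r \<omega>) \<partial>M')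
          = ?D r (\<lambda>x. b r x \<bullet> \<psi> x) + ?D r H"
        using 1 2 by (simp add: law_diff_def)
      ultimately have "\<bar>(\<integral>\<omega>. b r (X r \<omega>) \<bullet> \<psi> (X r \<omega>) \<partial>M) - (\<integral>\<omega>. b' r (X' r \<omega>) \<bullet> \<psi> (X' r \<omega>) \<partial>M')\<bar>
          \<le> S * (\<beta> r * K) + S * (\<beta>' r * K)" by linarith
      then show "\<bar>(\<integral>\<omega>. 1 * (b r (X r \<omega>) \<bullet> \<psi> (X r \<omega>)) \<partial>M)
          - (\<integral>\<omega>. 1 * (b' r (X' r \<omega>) \<bullet> \<psi> (X' r \<omega>)) \<partial>M')\<bar> \<le> S * K * (\<beta> r + \<beta>' r)"
        by (simp add: algebra_simps)
    qed
  qed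
  have zero: "?D 0 h = 0" if [measurable]: "h \<in> borel_measurable borel" for h
  proof -
    have "(\<integral>\<omega>. h (X 0 \<omega>) \<partial>M) = (\<integral>x. h x \<partial>distr M borel (X 0))"
      by (subst integral_distr) auto
    also have "\<dots> = (\<integral>\<omega>. h (X' 0 \<omega>) \<partial>M')"
      unfolding init by (subst integral_distr) auto
    finally show ?thesis by (simp add: law_diff_def)
  qed
  have D0: "?D t h = 0" if "h \<in> borel_measurable borel" "\<And>x. \<bar>h x\<bar> \<le> 1" for h
    by (rule law_diff_zero_propagates[OF order_refl _ _ _ _ \<gamma>_facts key]) (use t that zero in auto)
  show ?thesis
  proof (rule measure_eqI)
    interpret dA: prob_space "distr M borel (X t)" by (rule A.prob_space_distr) simp
    interpret dB: prob_space "distr M' borel (X' t)" by (rule B.prob_space_distr) simp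
    fix E assume "E \<in> sets (distr M borel (X t))"
    then have E [measurable]: "E \<in> sets borel" by simp
    have "?D t (indicator E) = 0" by (rule D0) (auto simp: indicator_def)
    moreover have "(\<integral>\<omega>. indicat_real E (X t \<omega>) \<partial>M) = measure (distr M borel (X t)) E"
      by (subst integral_distr[of "X t" M borel "indicat_real E", symmetric]) auto
    moreover have "(\<integral>\<omega>. indicat_real E (X' t \<omega>) \<partial>M') = measure (distr M' borel (X' t)) E"
      by (subst integral_distr[of "X' t" M' borel "indicat_real E", symmetric]) auto
    ultimately have "measure (distr M borel (X t)) E = measure (distr M' borel (X' t)) E"
      by (simp add: law_diff_def)
    then show "emeasure (distr M borel (X t)) E = emeasure (distr M' borel (X' t)) E"
      by (simp add: dA.emeasure_eq_measure dB.emeasure_eq_measure)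
  qed simp
qed

text \<open>Equal marginals make the two drifts the same function, so the difference of the drift
  terms is a single weighted law difference tested with b r x \<bullet> \<psi> x.\<close>

lemma weighted_law_propagates:
  assumes s: "0 \<le> s" "s \<le> t" "t \<le> T"
    and Y: "Y \<in> borel_measurable (F s)" "\<And>\<omega>. \<bar>Y \<omega>\<bar> \<le> 1"
    and Y': "Y' \<in> borel_measurable (F' s)" "\<And>\<omega>. \<bar>Y' \<omega>\<bar> \<le> 1"
    and zero: "\<And>h. h \<in> borel_measurable borel \<Longrightarrow> (\<And>x. \<bar>h x\<bar> \<le> 1) \<Longrightarrow> law_diff Y Y' s h = 0"
    and h: "h \<in> borel_measurable borel" "\<And>x. \<bar>h x\<bar> \<le> 1"
  shows "law_diff Y Y' t h = 0"
proof (rule law_diff_zero_propagates[OF s(1) Y Y' \<gamma>_facts _ zero s(2,3) h])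
  show "AE r in lborel. r \<in> {s<..<T} \<longrightarrow> (\<forall>\<psi> S K. \<psi> \<in> borel_measurable borel \<longrightarrow> 0 \<le> S \<longrightarrow>
        (\<forall>x. norm (\<psi> x) \<le> K) \<longrightarrow>
        (\<forall>h\<in>borel_measurable borel. (\<forall>x. \<bar>h x\<bar> \<le> 1) \<longrightarrow> \<bar>law_diff Y Y' r h\<bar> \<le> S) \<longrightarrow>
        \<bar>(\<integral>\<omega>. Y \<omega> * (b r (X r \<omega>) \<bullet> \<psi> (X r \<omega>)) \<partial>M)
          - (\<integral>\<omega>. Y' \<omega> * (b' r (X' r \<omega>) \<bullet> \<psi> (X' r \<omega>)) \<partial>M')\<bar> \<le> S * K * (\<beta> r + \<beta>' r))"
    using drift_A drift_B
  proof eventually_elim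
    case (elim r)
    show ?case
    proof (intro impI allI)
      fix \<psi> :: "real^2 \<Rightarrow> real^2" and S K
      assume r: "r \<in> {s<..<T}" and \<psi> [measurable]: "\<psi> \<in> borel_measurable borel" and S0: "0 \<le> S"
        and \<psi>K: "\<forall>x. norm (\<psi> x) \<le> K"
        and S: "\<forall>h\<in>borel_measurable borel. (\<forall>x. \<bar>h x\<bar> \<le> 1) \<longrightarrow> \<bar>law_diff Y Y' r h\<bar> \<le> S"
      have r0: "r \<in> {0<..<T}" "r \<in> {0..T}" using r s by auto
      have "b' r x = b r x" for x
      proof -
        have "b r x = (\<integral>y. bs_kernel (x - y) \<partial>distr M borel (X r))"
          using elim(1) r0(1) by (subst integral_distr) auto
        also have "\<dots> = b' r x"
          unfolding marginal_laws_eq[OF r0(2)] using elim(2) r0(1) by (subst integral_distr) auto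
        finally show ?thesis by simp
      qed
      then have "(\<integral>\<omega>. Y \<omega> * (b r (X r \<omega>) \<bullet> \<psi> (X r \<omega>)) \<partial>M)
          - (\<integral>\<omega>. Y' \<omega> * (b' r (X' r \<omega>) \<bullet> \<psi> (X' r \<omega>)) \<partial>M') = law_diff Y Y' r (\<lambda>x. b r x \<bullet> \<psi> x)"
        by (simp add: law_diff_def)
      also have "\<bar>\<dots>\<bar> \<le> S * (\<beta> r * K)"
        by (rule law_diff_scale[OF S]) (use \<psi>K drift_inner_bounded in auto)
      also have "\<dots> \<le> S * K * (\<beta> r + \<beta>' r)"
      proof -
        have "0 \<le> K" using order_trans[OF norm_ge_zero] \<psi>K by blast
        then have "0 \<le> S * K * \<beta>' r" using S0 B.\<beta>_nonneg by simp
        then show ?thesis by (simp add: algebra_simps)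
      qed
      finally show "\<bar>(\<integral>\<omega>. Y \<omega> * (b r (X r \<omega>) \<bullet> \<psi> (X r \<omega>)) \<partial>M)
          - (\<integral>\<omega>. Y' \<omega> * (b' r (X' r \<omega>) \<bullet> \<psi> (X' r \<omega>)) \<partial>M')\<bar> \<le> S * K * (\<beta> r + \<beta>' r)" .
    qed
  qed
qed

text \<open>Induction on the largest time t of J. At time t the indicator of \<open>E t\<close> is
  absorbed into the test function, which leaves the case of the smaller set; the full product is
  \<open>F t\<close>-measurable, so it can then serve as the weight propagated from t to s.\<close>

lemma finite_dim_laws_eq:
  assumes "finite J" "J \<subseteq> {0..T}" "\<And>j. j \<in> J \<Longrightarrow> E j \<in> sets borel"
    and "s \<in> {0..T}" "\<And>j. j \<in> J \<Longrightarrow> j \<le> s"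
    and "h \<in> borel_measurable borel" "\<And>x. \<bar>h x\<bar> \<le> 1"
  shows "law_diff (\<lambda>\<omega>. \<Prod>j\<in>J. indicator (E j) (X j \<omega>)) (\<lambda>\<omega>. \<Prod>j\<in>J. indicator (E j) (X' j \<omega>)) s h = 0"
  using assms
proof (induction J arbitrary: s h rule: finite_linorder_max_induct)
  case empty
  then have [measurable]: "h \<in> borel_measurable borel" by simp
  have "(\<integral>\<omega>. h (X s \<omega>) \<partial>M) = (\<integral>x. h x \<partial>distr M borel (X s))"
    by (subst integral_distr) auto
  also have "\<dots> = (\<integral>\<omega>. h (X' s \<omega>) \<partial>M')"
    unfolding marginal_laws_eq[OF empty(3)] by (subst integral_distr) auto
  finally show ?case by (simp add: law_diff_def)
next
  case (insert t J)
  let ?Y = "\<lambda>J \<omega>. \<Prod>j\<in>J. indicat_real (E j) (X j \<omega>)" and ?Y' = "\<lambda>J \<omega>. \<Prod>j\<in>J. indicat_real (E j) (X' j \<omega>)"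
  have t: "t \<in> {0..T}" "t \<notin> J" "t \<le> s" using insert by auto
  have Em [measurable]: "E j \<in> sets borel" if "j \<in> insert t J" for j using insert(5) that by auto
  have m: "(\<lambda>\<omega>. indicat_real (E j) (X j \<omega>)) \<in> borel_measurable (F t)"
    "(\<lambda>\<omega>. indicat_real (E j) (X' j \<omega>)) \<in> borel_measurable (F' t)" if "j \<in> insert t J" for j
  proof -
    have j: "j \<in> {0..T}" "j \<le> t" using insert that by auto
    have [measurable]: "X j \<in> borel_measurable (F t)" "X' j \<in> borel_measurable (F' t)" "E j \<in> sets borel"
      using A.X_adapted[OF j(1)] B.X_adapted[OF j(1)] j(2) Em[OF that]
      by (auto intro: A.measurable_F_mono B.measurable_F_mono)
    show "(\<lambda>\<omega>. indicat_real (E j) (X j \<omega>)) \<in> borel_measurable (F t)"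
      "(\<lambda>\<omega>. indicat_real (E j) (X' j \<omega>)) \<in> borel_measurable (F' t)"
      by measurable
  qed
  have b1: "\<bar>\<Prod>j\<in>J'. indicat_real (E j) (z j)\<bar> \<le> 1" for J' and z :: "real \<Rightarrow> real^2"
    by (auto simp: abs_prod intro!: prod_le_1)
  show ?case
  proof (rule weighted_law_propagates[of t])
    show "?Y (insert t J) \<in> borel_measurable (F t)" "?Y' (insert t J) \<in> borel_measurable (F' t)"
      using m by (auto intro!: borel_measurable_prod)
    show "\<bar>?Y (insert t J) \<omega>\<bar> \<le> 1" for \<omega> by (rule b1)
    show "\<bar>?Y' (insert t J) \<omega>\<bar> \<le> 1" for \<omega> by (rule b1)
    fix g :: "real^2 \<Rightarrow> real" assume g: "g \<in> borel_measurable borel" "\<And>x. \<bar>g x\<bar> \<le> 1"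
    have "law_diff (?Y (insert t J)) (?Y' (insert t J)) t g
        = law_diff (?Y J) (?Y' J) t (\<lambda>x. indicator (E t) x * g x)"
      using insert(1) t(2) by (simp add: law_diff_def mult_ac)
    also have "\<dots> = 0"
    proof (rule insert.IH)
      have [measurable]: "E t \<in> sets borel" "g \<in> borel_measurable borel" using Em g by auto
      show "(\<lambda>x. indicator (E t) x * g x) \<in> borel_measurable borel" by measurable
      show "\<bar>indicator (E t) x * g x\<bar> \<le> 1" for x using g(2)[of x] by (simp add: indicator_def)
    qed (use insert t in auto)
    finally show "law_diff (?Y (insert t J)) (?Y' (insert t J)) t g = 0" .
  qed (use t insert in auto)
qed

theorem path_laws_eq:
  assumes T: "0 \<le> T"
  shows "path_law T M X = path_law T M' X'"
proof -
  have meas: "(\<lambda>\<omega>. \<lambda>t\<in>{0..T}. X t \<omega>) \<in> measurable M (\<Pi>\<^sub>M t\<in>{0..T}. borel)"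
    "(\<lambda>\<omega>. \<lambda>t\<in>{0..T}. X' t \<omega>) \<in> measurable M' (\<Pi>\<^sub>M t\<in>{0..T}. borel)"
    by (auto intro!: measurable_restrict)
  show ?thesis
    unfolding path_law_def
  proof (rule measure_eqI_PiM_infinite[where I="{0..T}" and M="\<lambda>_. borel"])
    interpret P: prob_space "distr M (\<Pi>\<^sub>M t\<in>{0..T}. borel) (\<lambda>\<omega>. \<lambda>t\<in>{0..T}. X t \<omega>)"
      by (rule A.prob_space_distr[OF meas(1)])
    show "finite_measure (distr M (\<Pi>\<^sub>M t\<in>{0..T}. borel) (\<lambda>\<omega>. \<lambda>t\<in>{0..T}. X t \<omega>))"
      by (rule P.finite_measure_axioms)
    fix E :: "real \<Rightarrow> (real^2) set" and J
    assume J: "finite J" "J \<subseteq> {0..T}" and E: "\<And>i. i \<in> J \<Longrightarrow> E i \<in> sets borel"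
    let ?C = "prod_emb {0..T} (\<lambda>_. borel) J (Pi\<^sub>E J E)"
    have C: "?C \<in> sets (\<Pi>\<^sub>M t\<in>{0..T}. borel)"
      using J E by (intro sets_PiM_I) auto
    have mem: "(\<lambda>t\<in>{0..T}. z t) \<in> ?C \<longleftrightarrow> (\<forall>j\<in>J. z j \<in> E j)" for z :: "real \<Rightarrow> real^2"
      using J by (auto simp: prod_emb_def PiE_def Pi_def subset_eq)
    have ind: "(\<Prod>j\<in>J. indicat_real (E j) (z j)) = indicat_real {z. \<forall>j\<in>J. z j \<in> E j} z" for z
      using J(1) by (auto simp: indicator_def prod_zero_iff)
    have eA: "emeasure (distr M (\<Pi>\<^sub>M t\<in>{0..T}. borel) (\<lambda>\<omega>. \<lambda>t\<in>{0..T}. X t \<omega>)) ?C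
        = ennreal (\<integral>\<omega>. (\<Prod>j\<in>J. indicat_real (E j) (X j \<omega>)) \<partial>M)"
    proof -
      have vi: "(\<lambda>\<omega>. \<lambda>t\<in>{0..T}. X t \<omega>) -` ?C \<inter> space M = {\<omega>\<in>space M. \<forall>j\<in>J. X j \<omega> \<in> E j}"
        using mem by auto
      have "(\<integral>\<omega>. (\<Prod>j\<in>J. indicat_real (E j) (X j \<omega>)) \<partial>M)
          = (\<integral>\<omega>. indicat_real {\<omega>\<in>space M. \<forall>j\<in>J. X j \<omega> \<in> E j} \<omega> \<partial>M)"
        unfolding ind by (intro Bochner_Integration.integral_cong) (auto simp: indicator_def)
      then show ?thesis
        by (simp add: emeasure_distr[OF meas(1) C] vi A.emeasure_eq_measure Int_absorb2)
    qed
    have eB: "emeasure (distr M' (\<Pi>\<^sub>M t\<in>{0..T}. borel) (\<lambda>\<omega>. \<lambda>t\<in>{0..T}. X' t \<omega>)) ?C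
        = ennreal (\<integral>\<omega>. (\<Prod>j\<in>J. indicat_real (E j) (X' j \<omega>)) \<partial>M')"
    proof -
      have vi: "(\<lambda>\<omega>. \<lambda>t\<in>{0..T}. X' t \<omega>) -` ?C \<inter> space M' = {\<omega>\<in>space M'. \<forall>j\<in>J. X' j \<omega> \<in> E j}"
        using mem by auto
      have "(\<integral>\<omega>. (\<Prod>j\<in>J. indicat_real (E j) (X' j \<omega>)) \<partial>M')
          = (\<integral>\<omega>. indicat_real {\<omega>\<in>space M'. \<forall>j\<in>J. X' j \<omega> \<in> E j} \<omega> \<partial>M')"
        unfolding ind by (intro Bochner_Integration.integral_cong) (auto simp: indicator_def)
      then show ?thesis
        by (simp add: emeasure_distr[OF meas(2) C] vi B.emeasure_eq_measure Int_absorb2)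
    qed
    \<comment> \<open>All times of the cylinder are at most T, so the test function 1 at time T
      recovers its probability.\<close>
    have "law_diff (\<lambda>\<omega>. \<Prod>j\<in>J. indicator (E j) (X j \<omega>)) (\<lambda>\<omega>. \<Prod>j\<in>J. indicator (E j) (X' j \<omega>)) T (\<lambda>_. 1) = 0"
      by (rule finite_dim_laws_eq[OF J E]) (use J T in auto)
    then show "emeasure (distr M (\<Pi>\<^sub>M t\<in>{0..T}. borel) (\<lambda>\<omega>. \<lambda>t\<in>{0..T}. X t \<omega>)) ?C
        = emeasure (distr M' (\<Pi>\<^sub>M t\<in>{0..T}. borel) (\<lambda>\<omega>. \<lambda>t\<in>{0..T}. X' t \<omega>)) ?C"
      unfolding eA eB by (simp add: law_diff_def)
  qed auto
qed

end

text \<open>Passes to versions of process and drift defined on the whole time line. Where the L^4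
  norm of the density is infinite the drift is set to 0: these times form a null set, so the
  equation is unaffected and the velocity bound holds at every time.\<close>

lemma weak_solution_imp_drift_sde:
  fixes u :: "real \<Rightarrow> real^2 \<Rightarrow> real"
  assumes \<nu>: "\<nu> > 0" and T: "T > 0" and ws: "weak_solution \<nu> T u0 M F W X u" and L4: "L4L4 T u"
  obtains Z b \<beta> where "drift_sde M T (sqrt (2 * \<nu>)) F W Z b \<beta>"
    and "\<And>t. t \<in> {0..T} \<Longrightarrow> Z t = X t"
    and "\<And>t. t \<in> {0<..T} \<Longrightarrow> absolutely_continuous lborel (distr M borel (Z t))"
    and "AE r in lborel. r \<in> {0<..<T} \<longrightarrow> (\<forall>x. b r x = (\<integral>\<omega>. bs_kernel (x - Z r \<omega>) \<partial>M) \<and>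
        (\<integral>\<^sup>+\<omega>. ennreal (norm (bs_kernel (x - Z r \<omega>))) \<partial>M) \<le> ennreal (\<beta> r))"
    and "integrable lborel (\<lambda>r. \<beta> r ^ 4)"
proof -
  have ps: "prob_space M" and filt: "is_filtration M F" and bm: "brownian2 T M F W"
    and prog: "prog_measurable T F X"
    and cont: "AE \<omega> in M. continuous_on {0..T} (\<lambda>t. X t \<omega>)"
    and dens: "\<And>t. t \<in> {0<..T} \<Longrightarrow> (\<forall>x. 0 \<le> u t x) \<and> u t \<in> borel_measurable lborel \<and>
         distr M borel (X t) = density lborel (\<lambda>x. ennreal (u t x))"
    and eq: "\<And>t. t \<in> {0..T} \<Longrightarrow> AE \<omega> in M.
        X t \<omega> = X 0 \<omega> + (\<integral>s\<in>{0..t}. BS (u s) (X s \<omega>) \<partial>lborel) + sqrt (2 * \<nu>) *\<^sub>R W t \<omega>"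
    using ws by (auto simp: weak_solution_def)
  interpret prob_space M by fact
  have um: "(\<lambda>(t, x). u t x) \<in> borel_measurable (restrict_space lborel {0<..<T} \<Otimes>\<^sub>M lborel)"
    and uf: "(\<integral>\<^sup>+t\<in>{0<..<T}. (\<integral>\<^sup>+x. ennreal (\<bar>u t x\<bar> ^ 4) \<partial>lborel) \<partial>lborel) < \<infinity>"
    using L4 by (auto simp: L4L4_def)

  \<comment> \<open>T / 2 is an arbitrary interior time that keeps the argument of u inside the
    interval of joint measurability.\<close>
  define \<pi> where "\<pi> r = (if r \<in> {0<..<T} then r else T / 2)" for r
  \<comment> \<open>\<open>u\<close> is jointly measurable only over the open interval, so it is replaced by \<open>0\<close> outside.\<close>
  define v where "v r x = indicator {0<..<T} r * u (\<pi> r) x" for r x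
  have v_eq: "v r x = u r x" if "r \<in> {0<..<T}" for r x
    using that by (simp add: v_def \<pi>_def)
  have v0: "0 \<le> v r x" for r x
    using dens[of r] v_eq[of r x] by (cases "r \<in> {0<..<T}") (auto simp: v_def)
  have "\<pi> \<in> borel_measurable borel"
    unfolding \<pi>_def by measurable
  then have \<pi>: "\<pi> \<in> measurable borel (restrict_space lborel {0<..<T})"
    using T by (intro measurable_restrict_space2) (auto simp: \<pi>_def)
  have "(\<lambda>p. (\<pi> (fst p), snd p)) \<in> measurable (borel \<Otimes>\<^sub>M borel) (restrict_space lborel {0<..<T} \<Otimes>\<^sub>M (lborel :: (real^2) measure))"
    using \<pi> by measurable
  from measurable_compose[OF this um]
  have "(\<lambda>p. u (\<pi> (fst p)) (snd p)) \<in> borel_measurable (borel \<Otimes>\<^sub>M borel)" by simp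
  then have vm: "(\<lambda>p. v (fst p) (snd p)) \<in> borel_measurable (borel \<Otimes>\<^sub>M borel)"
    unfolding v_def by measurable
  \<comment> \<open>One fact in two instances: \<open>BS_meas\<close> integrates over triples ((r,
    x), y), \<open>m4_meas\<close> over pairs (r, x).\<close>
  have v_meas_triple [measurable (raw)]: "f \<in> borel_measurable N \<Longrightarrow> g \<in> borel_measurable N \<Longrightarrow> (\<lambda>x. v (f x) (g x)) \<in> borel_measurable N"
    for f g and N :: "((real \<times> (real^2)) \<times> (real^2)) measure"
    using measurable_compose[OF measurable_Pair vm, of f N g] by simp
  have v_meas_pair [measurable (raw)]: "f \<in> borel_measurable N \<Longrightarrow> g \<in> borel_measurable N \<Longrightarrow> (\<lambda>x. v (f x) (g x)) \<in> borel_measurable N"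
    for f g and N :: "(real \<times> (real^2)) measure"
    using measurable_compose[OF measurable_Pair vm, of f N g] by simp
  have v_meas [measurable]: "v r \<in> borel_measurable borel" for r
    using measurable_compose[OF measurable_Pair vm, of "\<lambda>_. r" borel "\<lambda>x. x"] by simp

  define m4 where "m4 r = (\<integral>\<^sup>+x. ennreal (v r x ^ 4) \<partial>lborel)" for r
  have m4_meas [measurable]: "m4 \<in> borel_measurable borel"
    unfolding m4_def by measurable
  have m4_fin: "(\<integral>\<^sup>+r. m4 r * indicator {0<..<T} r \<partial>lborel) < \<infinity>"
  proof -
    have "(\<integral>\<^sup>+r. m4 r * indicator {0<..<T} r \<partial>lborel)
       = (\<integral>\<^sup>+t\<in>{0<..<T}. (\<integral>\<^sup>+x. ennreal (\<bar>u t x\<bar> ^ 4) \<partial>lborel) \<partial>lborel)"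
    proof (rule nn_integral_cong)
      fix r :: real
      show "m4 r * indicator {0<..<T} r = (\<integral>\<^sup>+x. ennreal (\<bar>u r x\<bar> ^ 4) \<partial>lborel) * indicator {0<..<T} r"
      proof (cases "r \<in> {0<..<T}")
        case True
        then have "v r x ^ 4 = \<bar>u r x\<bar> ^ 4" for x using v0[of r x] by (simp add: v_eq)
        then show ?thesis by (simp add: m4_def)
      qed simp
    qed
    then show ?thesis using uf by simp
  qed
  define good where "good r \<longleftrightarrow> r \<in> {0<..<T} \<and> m4 r < \<infinity>" for r
  have good_meas [measurable]: "Measurable.pred borel good"
    unfolding good_def by measurable
  have good_AE: "AE r in lborel. r \<in> {0<..<T} \<longrightarrow> good r"
  proof -
    have "AE r in lborel. m4 r * indicator {0<..<T} r \<noteq> \<infinity>"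
      by (rule nn_integral_noteq_infinite) (use m4_fin in auto)
    then show ?thesis
      by eventually_elim (auto simp: good_def less_top)
  qed
  \<comment> \<open>The added 1 secures 1 \<le> m r, as \<open>nn_integral_kernel_bound\<close>
    requires, and keeps m^4 integrable over the bounded interval.\<close>
  define m where "m r = (1 + enn2real (m4 r)) powr (1/4)" for r
  have m4th: "m r ^ 4 = 1 + enn2real (m4 r)" for r
    by (simp add: m_def powr_power add_nonneg_eq_0_iff)
  have m1: "1 \<le> m r" for r
    unfolding m_def by (rule ge_one_powr_ge_zero) auto
  define \<beta> where "\<beta> r = (if good r then 38 * m r else 0)" for r
  define b where "b r x = (if good r then BS (v r) x else 0)" for r x
  have \<beta>_meas [measurable]: "\<beta> \<in> borel_measurable borel"
    unfolding \<beta>_def m_def by measurable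
  have BS_meas: "(\<lambda>p. BS (v (fst p)) (snd p)) \<in> borel_measurable (borel \<Otimes>\<^sub>M borel)"
    unfolding BS_def by measurable
  have b_meas: "(\<lambda>(r, x). b r x) \<in> borel_measurable (borel \<Otimes>\<^sub>M borel)"
    unfolding b_def split_beta' using BS_meas by measurable

  \<comment> \<open>Clamping the time makes the process jointly measurable on the whole line.\<close>
  define Z where "Z s \<omega> = X (max 0 (min s T)) \<omega>" for s \<omega>
  have Z_eq: "Z t = X t" if "t \<in> {0..T}" for t
    using that by (auto simp: Z_def fun_eq_iff)
  have prog': "(\<lambda>(s, \<omega>). X s \<omega>) \<in> borel_measurable (restrict_space borel {0..t} \<Otimes>\<^sub>M F t)" if "t \<in> {0..T}" for t
    using prog that by (simp add: prog_measurable_def)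
  have X_adapted: "X t \<in> borel_measurable (F t)" if t: "t \<in> {0..T}" for t
  proof -
    have "(\<lambda>\<omega>. (t, \<omega>)) \<in> measurable (F t) (restrict_space borel {0..t} \<Otimes>\<^sub>M F t)"
      using t by (intro measurable_Pair measurable_ident measurable_const) (auto simp: space_restrict_space)
    from measurable_compose[OF this prog'[OF t]] show ?thesis by simp
  qed
  have X_meas: "X t \<in> borel_measurable M" if "t \<in> {0..T}" for t
    using measurable_from_subalg[OF _ X_adapted[OF that]] filt by (auto simp: is_filtration_def)
  have Z_joint: "(\<lambda>(s, \<omega>). Z s \<omega>) \<in> borel_measurable (borel \<Otimes>\<^sub>M M)"
  proof -
    have clamp: "(\<lambda>s. max 0 (min s T)) \<in> measurable borel (restrict_space borel {0..T})"
      using T by (intro measurable_restrict_space2) auto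
    have "(\<lambda>\<omega>. \<omega>) \<in> measurable M (F T)"
      by (rule measurable_from_subalg[of M "F T"]) (use filt in \<open>auto simp: is_filtration_def\<close>)
    then have "(\<lambda>p. (max 0 (min (fst p) T), snd p)) \<in> measurable (borel \<Otimes>\<^sub>M M) (restrict_space borel {0..T} \<Otimes>\<^sub>M F T)"
      using clamp by (intro measurable_Pair measurable_compose[OF measurable_fst] measurable_compose[OF measurable_snd])
    from measurable_compose[OF this prog'[of T]] T
    have "(\<lambda>p. X (max 0 (min (fst p) T)) (snd p)) \<in> borel_measurable (borel \<Otimes>\<^sub>M M)"
      by simp
    then show ?thesis by (simp add: Z_def split_beta')
  qed
  have Zr [measurable]: "Z r \<in> borel_measurable M" for r
    using T by (auto simp: Z_def[abs_def] intro!: X_meas)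
  have Z_law: "distr M borel (Z r) = density lborel (\<lambda>x. ennreal (u r x))" if "r \<in> {0<..T}" for r
    using dens[OF that] Z_eq[of r] that by simp

  have kernel: "(\<integral>\<^sup>+y. ennreal (v r y * norm (bs_kernel (x - y))) \<partial>lborel) \<le> ennreal (\<beta> r)"
    if g: "good r" for r x
  proof -
    have r: "r \<in> {0<..T}" "r \<in> {0<..<T}" using g by (auto simp: good_def)
    have vlaw: "distr M borel (Z r) = density lborel (\<lambda>x. ennreal (v r x))"
      unfolding Z_law[OF r(1)] using v_eq[OF r(2)] by simp
    interpret dz: prob_space "distr M borel (Z r)" by (rule prob_space_distr) simp
    have "(\<integral>\<^sup>+y. ennreal (v r y) \<partial>lborel) = 1"
      using dz.emeasure_space_1 unfolding vlaw by (simp add: emeasure_density)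
    moreover have "(\<integral>\<^sup>+y. ennreal ((v r y)^4) \<partial>lborel) \<le> ennreal (m r ^ 4)"
    proof -
      have "(\<integral>\<^sup>+y. ennreal ((v r y)^4) \<partial>lborel) = ennreal (enn2real (m4 r))"
        using g by (simp add: m4_def[symmetric] good_def)
      also have "\<dots> \<le> ennreal (m r ^ 4)" unfolding m4th by (intro ennreal_leI) simp
      finally show ?thesis .
    qed
    ultimately have "(\<integral>\<^sup>+y. ennreal (v r y * norm (bs_kernel (x - y))) \<partial>lborel) \<le> ennreal (38 * m r)"
      by (intro nn_integral_kernel_bound v0 m1) auto
    then show ?thesis using g by (simp add: \<beta>_def)
  qed
  have b_bound: "norm (b r x) \<le> \<beta> r" for r x
  proof (cases "good r")
    case True
    have n: "norm (v r y *\<^sub>R bs_kernel (x - y)) = v r y * norm (bs_kernel (x - y))" for y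
      using v0 by simp
    have "integrable lborel (\<lambda>y. v r y *\<^sub>R bs_kernel (x - y))"
    proof (rule integrableI_bounded)
      show "(\<integral>\<^sup>+y. ennreal (norm (v r y *\<^sub>R bs_kernel (x - y))) \<partial>lborel) < \<infinity>"
        unfolding n by (rule le_less_trans[OF kernel[OF True]]) simp
    qed measurable
    from integral_norm_bound_ennreal[OF this]
    have "ennreal (norm (BS (v r) x)) \<le> ennreal (\<beta> r)"
      unfolding BS_def n using kernel[OF True, of x] by (rule order_trans)
    moreover have "0 \<le> \<beta> r" using m1[of r] by (simp add: \<beta>_def)
    ultimately show ?thesis using True by (simp add: b_def ennreal_le_iff)
  qed (simp add: b_def \<beta>_def)
  have b_law: "b r x = (\<integral>\<omega>. bs_kernel (x - Z r \<omega>) \<partial>M)"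
    "(\<integral>\<^sup>+\<omega>. ennreal (norm (bs_kernel (x - Z r \<omega>))) \<partial>M) \<le> ennreal (\<beta> r)" if g: "good r" for r x
  proof -
    have r: "r \<in> {0<..T}" "r \<in> {0<..<T}" using g by (auto simp: good_def)
    have vlaw: "distr M borel (Z r) = density lborel (\<lambda>x. ennreal (v r x))"
      unfolding Z_law[OF r(1)] using v_eq[OF r(2)] by simp
    have "(\<integral>\<omega>. bs_kernel (x - Z r \<omega>) \<partial>M) = (\<integral>y. bs_kernel (x - y) \<partial>distr M borel (Z r))"
      by (subst integral_distr) auto
    also have "\<dots> = BS (v r) x"
      unfolding vlaw BS_def using v0 by (subst integral_density) auto
    finally show "b r x = (\<integral>\<omega>. bs_kernel (x - Z r \<omega>) \<partial>M)" using g by (simp add: b_def)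
    have "(\<integral>\<^sup>+\<omega>. ennreal (norm (bs_kernel (x - Z r \<omega>))) \<partial>M)
        = (\<integral>\<^sup>+y. ennreal (norm (bs_kernel (x - y))) \<partial>distr M borel (Z r))"
      by (subst nn_integral_distr) auto
    also have "\<dots> = (\<integral>\<^sup>+y. ennreal (v r y * norm (bs_kernel (x - y))) \<partial>lborel)"
      unfolding vlaw using v0 by (subst nn_integral_density) (auto simp: ennreal_mult)
    also have "\<dots> \<le> ennreal (\<beta> r)" by (rule kernel[OF g])
    finally show "(\<integral>\<^sup>+\<omega>. ennreal (norm (bs_kernel (x - Z r \<omega>))) \<partial>M) \<le> ennreal (\<beta> r)" .
  qed
  have \<beta>4: "integrable lborel (\<lambda>r. \<beta> r ^ 4)"
  proof (rule integrableI_bounded)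
    have "(\<integral>\<^sup>+r. ennreal (norm (\<beta> r ^ 4)) \<partial>lborel)
        \<le> (\<integral>\<^sup>+r. ennreal (38^4) * (indicator {0<..<T} r + m4 r * indicator {0<..<T} r) \<partial>lborel)"
    proof (rule nn_integral_mono)
      fix r
      show "ennreal (norm (\<beta> r ^ 4)) \<le> ennreal (38^4) * (indicator {0<..<T} r + m4 r * indicator {0<..<T} r)"
      proof (cases "good r")
        case True
        then have "norm (\<beta> r ^ 4) = 38^4 * (1 + enn2real (m4 r))"
          by (simp add: \<beta>_def power_mult_distrib m4th)
        then have "ennreal (norm (\<beta> r ^ 4)) = ennreal (38^4) * (1 + ennreal (enn2real (m4 r)))"
          by (simp only: ennreal_mult[of "38^4"] ennreal_plus enn2real_nonneg zero_le_one ennreal_1) (simp add: ennreal_mult)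
        then show ?thesis using True by (simp add: good_def)
      qed (simp add: \<beta>_def)
    qed
    also have "\<dots> = ennreal (38^4) * ((\<integral>\<^sup>+r. indicator {0<..<T} r \<partial>lborel) + (\<integral>\<^sup>+r. m4 r * indicator {0<..<T} r \<partial>lborel))"
      by (subst nn_integral_cmult, simp, subst nn_integral_add) auto
    also have "\<dots> < \<infinity>"
      using m4_fin T by (simp add: ennreal_mult_less_top)
    finally show "(\<integral>\<^sup>+r. ennreal (norm (\<beta> r ^ 4)) \<partial>lborel) < \<infinity>" .
  qed measurable
  \<comment> \<open>\<beta> is either 0 or at least 1, so \<beta> \<le> \<beta>^4.\<close>
  have \<beta>_int: "integrable lborel \<beta>"
  proof (rule Bochner_Integration.integrable_bound[OF \<beta>4])
    show "AE r in lborel. norm (\<beta> r) \<le> norm (\<beta> r ^ 4)"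
    proof (rule AE_I2)
      fix r
      show "norm (\<beta> r) \<le> norm (\<beta> r ^ 4)"
      proof (cases "good r")
        case True
        then have "1 \<le> \<beta> r" using m1[of r] by (simp add: \<beta>_def)
        then show ?thesis using self_le_power[of "\<beta> r" 4] by simp
      qed (simp add: \<beta>_def)
    qed
  qed measurable
  have sde: "AE \<omega> in M. Z t \<omega> = Z 0 \<omega> + (\<integral>s\<in>{0..t}. b s (Z s \<omega>) \<partial>lborel) + sqrt (2 * \<nu>) *\<^sub>R W t \<omega>"
    if t: "t \<in> {0..T}" for t
    using eq[OF t] AE_space
  proof eventually_elim
    case (elim \<omega>)
    have Zs [measurable]: "(\<lambda>s. Z s \<omega>) \<in> borel_measurable borel"
      using measurable_compose[OF measurable_Pair[OF measurable_ident measurable_const[OF elim(2)]] Z_joint] by simp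
    have m1': "(\<lambda>s. BS (v s) (Z s \<omega>)) \<in> borel_measurable borel"
      using measurable_compose[OF measurable_Pair[OF measurable_ident Zs] BS_meas] by simp
    have m2': "(\<lambda>s. b s (Z s \<omega>)) \<in> borel_measurable borel"
      using measurable_compose[OF measurable_Pair[OF measurable_ident Zs] b_meas] by simp
    have "(\<integral>s. indicator {0..t} s *\<^sub>R BS (u s) (X s \<omega>) \<partial>lborel)
        = (\<integral>s. indicator {0..t} s *\<^sub>R BS (v s) (Z s \<omega>) \<partial>lborel)"
    \<comment> \<open>The replacement v is known to agree with u only on the open interval; the end
      points do not affect the integral.\<close>
    proof (rule integral_discrete_difference[of "{0, T}"])
      fix s assume "s \<in> space lborel" "s \<notin> {0, T}"
      show "indicator {0..t} s *\<^sub>R BS (u s) (X s \<omega>) = indicator {0..t} s *\<^sub>R BS (v s) (Z s \<omega>)"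
      proof (cases "s \<in> {0..t}")
        case True
        with \<open>s \<notin> {0, T}\<close> t have s: "s \<in> {0<..<T}" by auto
        then have "u s = v s" using v_eq by auto
        moreover have "X s = Z s" using s by (simp add: Z_eq)
        ultimately show ?thesis by simp
      qed simp
    qed auto
    also have "\<dots> = (\<integral>s. indicator {0..t} s *\<^sub>R b s (Z s \<omega>) \<partial>lborel)"
    proof (rule integral_cong_AE)
      show "AE s in lborel. indicator {0..t} s *\<^sub>R BS (v s) (Z s \<omega>) = indicator {0..t} s *\<^sub>R b s (Z s \<omega>)"
        using good_AE AE_lborel_singleton[of 0] AE_lborel_singleton[of T]
      proof eventually_elim
        case (elim s)
        show ?case
        proof (cases "s \<in> {0..t}")
          case True
          with elim t have "good s" by auto
          then show ?thesis by (simp add: b_def)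
        qed simp
      qed
    qed (use m1' m2' in measurable)
    finally show ?case
      using elim(1) t T by (simp add: set_lebesgue_integral_def Z_eq)
  qed
  show thesis
  proof (rule that[of Z b \<beta>])
    show "drift_sde M T (sqrt (2 * \<nu>)) F W Z b \<beta>"
    proof unfold_locales
      show "0 < sqrt (2 * \<nu>)" using \<nu> by simp
      show "AE \<omega> in M. continuous_on {0..T} (\<lambda>t. Z t \<omega>)"
        using cont
      proof eventually_elim
        case (elim \<omega>)
        then show ?case using continuous_on_cong[OF refl, of "{0..T}" "\<lambda>t. X t \<omega>" "\<lambda>t. Z t \<omega>"] Z_eq by simp
      qed
      show "Z t \<in> borel_measurable (F t)" if "t \<in> {0..T}" for t
        using X_adapted[OF that] Z_eq[OF that] by simp
    qed (fact filt bm Z_joint b_meas b_bound \<beta>_int sde)+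
    show "absolutely_continuous lborel (distr M borel (Z t))" if "t \<in> {0<..T}" for t
      unfolding Z_law[OF that] using dens[OF that] by (intro absolutely_continuousI_density) auto
    show "AE r in lborel. r \<in> {0<..<T} \<longrightarrow> (\<forall>x. b r x = (\<integral>\<omega>. bs_kernel (x - Z r \<omega>) \<partial>M) \<and>
        (\<integral>\<^sup>+\<omega>. ennreal (norm (bs_kernel (x - Z r \<omega>))) \<partial>M) \<le> ennreal (\<beta> r))"
      using good_AE by eventually_elim (use b_law in blast)
  qed (fact Z_eq \<beta>4)+
qed

theorem theorem4p4:
  fixes \<nu> T :: real and u0 :: "(real^2) measure"
    and M :: "'a measure" and F :: "real \<Rightarrow> 'a measure" and W X :: "real \<Rightarrow> 'a \<Rightarrow> real^2"
    and M' :: "'b measure" and F' :: "real \<Rightarrow> 'b measure" and W' X' :: "real \<Rightarrow> 'b \<Rightarrow> real^2"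
    and u u' :: "real \<Rightarrow> real^2 \<Rightarrow> real"
  assumes "\<nu> > 0" and "T > 0"
    and "prob_space u0" and "sets u0 = sets borel"
    and "weak_solution \<nu> T u0 M F W X u"
    and "weak_solution \<nu> T u0 M' F' W' X' u'"
    and "L4L4 T u" and "LinfHm1 T u"
    and "L4L4 T u'" and "LinfHm1 T u'"
  shows "path_law T M X = path_law T M' X'"
proof -
  obtain Z b \<beta> where Z: "drift_sde M T (sqrt (2 * \<nu>)) F W Z b \<beta>"
    "\<And>t. t \<in> {0..T} \<Longrightarrow> Z t = X t"
    "\<And>t. t \<in> {0<..T} \<Longrightarrow> absolutely_continuous lborel (distr M borel (Z t))"
    "AE r in lborel. r \<in> {0<..<T} \<longrightarrow> (\<forall>x. b r x = (\<integral>\<omega>. bs_kernel (x - Z r \<omega>) \<partial>M) \<and>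
        (\<integral>\<^sup>+\<omega>. ennreal (norm (bs_kernel (x - Z r \<omega>))) \<partial>M) \<le> ennreal (\<beta> r))"
    "integrable lborel (\<lambda>r. \<beta> r ^ 4)"
    by (rule weak_solution_imp_drift_sde[OF assms(1,2,5,7)]) blast
  obtain Z' b' \<beta>' where Z': "drift_sde M' T (sqrt (2 * \<nu>)) F' W' Z' b' \<beta>'"
    "\<And>t. t \<in> {0..T} \<Longrightarrow> Z' t = X' t"
    "\<And>t. t \<in> {0<..T} \<Longrightarrow> absolutely_continuous lborel (distr M' borel (Z' t))"
    "AE r in lborel. r \<in> {0<..<T} \<longrightarrow> (\<forall>x. b' r x = (\<integral>\<omega>. bs_kernel (x - Z' r \<omega>) \<partial>M') \<and>
        (\<integral>\<^sup>+\<omega>. ennreal (norm (bs_kernel (x - Z' r \<omega>))) \<partial>M') \<le> ennreal (\<beta>' r))"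
    "integrable lborel (\<lambda>r. \<beta>' r ^ 4)"
    by (rule weak_solution_imp_drift_sde[OF assms(1,2,6,9)]) blast
  have "distr M borel (Z 0) = distr M' borel (Z' 0)"
    using assms(2,5,6) Z(2)[of 0] Z'(2)[of 0] by (simp add: weak_solution_def)
  then interpret biot_savart_pair M M' T "sqrt (2 * \<nu>)" F W Z b \<beta> F' W' Z' b' \<beta>'
    using Z Z' by (intro biot_savart_pair.intro drift_sde_pair.intro
      drift_sde_pair_axioms.intro biot_savart_pair_axioms.intro) auto
  have "(\<lambda>\<omega>. \<lambda>t\<in>{0..T}. X t \<omega>) = (\<lambda>\<omega>. \<lambda>t\<in>{0..T}. Z t \<omega>)"
    "(\<lambda>\<omega>. \<lambda>t\<in>{0..T}. X' t \<omega>) = (\<lambda>\<omega>. \<lambda>t\<in>{0..T}. Z' t \<omega>)"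
    using Z(2) Z'(2) by (auto simp: fun_eq_iff restrict_def)
  then show ?thesis
    using path_laws_eq assms(2) by (simp add: path_law_def)
qed

end
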